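(* Let $C$ be a locally presentable category, let $(X_l)_{l\in L}$ be a set of objects of $C$, and let $I=\{i_l,j_l : l\in L\}$, where $i_l:\phi\to X_l$ is the unique morphism from the initial object and $j_l:X_l+X_l\to X_l$ is the folding morphism. Let $W=\mathrm{inj}(I)$ be the class of weak equivalences of the closed model defined by counting the objects $(X_l)_{l\in L}$; equivalently, $W$ is the class of morphisms $f:X\to Y$ such that for every $l\in L$ the map $\mathrm{Hom}(X_l,X)\to\mathrm{Hom}(X_l,Y)$, $g\mapsto f\circ g$, is bijective. Let $J=(f_j)_{j\in P}$ be a set of morphisms of $C$ such that $\mathrm{cell}(J)\subset W$. Put $F=\mathrm{inj}(J)$ and $Cof=\mathrm{cell}(I\cup J)$. Then $(W,F,Cof)$ (weak equivalences, fibrations, cofibrations) is a cofibrantly generated closed model structure on $C$.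
   Context: For a class $K$ of morphisms, $\mathrm{inj}(K)$ is the class of morphisms having the right lifting property with respect to every morphism of $K$, and $\mathrm{cell}(K)$ is the class of retracts of transfinite compositions of pushouts of elements of $K$. A weak factorization system $(\mathcal L,\mathcal R)$: every morphism factors as $g\circ h$ with $h\in\mathcal L$, $g\in\mathcal R$; $\mathcal L$ is exactly the class of morphisms with the left lifting property with respect to all of $\mathcal R$, and $\mathcal R$ is exactly the class of morphisms with the right lifting property with respect to all of $\mathcal L$. A closed model structure on a category having all limits and colimits is a triple of classes of morphisms: weak equivalences $W$, fibrations $F$, cofibrations $Cof$, such that (M1) $(Cof,F\cap W)$ and $(Cof\cap W,F)$ are weak factorization systems; (M2) if two of $f,g,g\circ f$ are in $W$, so is the third. It is cofibrantly generated if there are sets of morphisms $I',J'$ such that $\mathrm{inj}(I')=F\cap W$ and $\mathrm{inj}(J')=F$. The closed model defined by counting $(X_l)_{l\in L}$ is the one with weak equivalences $W=\mathrm{inj}(I)$, with all morphisms as fibrations and with cofibrations $\mathrm{cell}(I)$. *)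

theory Defs
  imports Main
begin

unbundle cardinal_syntax

section \<open>Categories\<close>

record ('o, 'm) cat =
  Obj :: "'o set"
  Arr :: "'m set"
  Dom :: "'m \<Rightarrow> 'o"
  Cod :: "'m \<Rightarrow> 'o"
  Ident :: "'o \<Rightarrow> 'm"
  Comp :: "'m \<Rightarrow> 'm \<Rightarrow> 'm"  (infixr \<open>\<odot>\<index>\<close> 70)

definition hom :: "('o, 'm) cat \<Rightarrow> 'o \<Rightarrow> 'o \<Rightarrow> 'm set" where
  "hom C a b = {f \<in> Arr C. Dom C f = a \<and> Cod C f = b}"

definition category :: "('o, 'm) cat \<Rightarrow> bool" where
  "category C \<longleftrightarrow>
     (\<forall>f \<in> Arr C. Dom C f \<in> Obj C \<and> Cod C f \<in> Obj C) \<and>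
     (\<forall>a \<in> Obj C. Ident C a \<in> hom C a a) \<and>
     (\<forall>a b c. \<forall>f \<in> hom C a b. \<forall>g \<in> hom C b c. g \<odot>\<^bsub>C\<^esub> f \<in> hom C a c) \<and>
     (\<forall>a b. \<forall>f \<in> hom C a b. f \<odot>\<^bsub>C\<^esub> Ident C a = f \<and> Ident C b \<odot>\<^bsub>C\<^esub> f = f) \<and>
     (\<forall>a b c d. \<forall>f \<in> hom C a b. \<forall>g \<in> hom C b c. \<forall>h \<in> hom C c d.
        h \<odot>\<^bsub>C\<^esub> (g \<odot>\<^bsub>C\<^esub> f) = (h \<odot>\<^bsub>C\<^esub> g) \<odot>\<^bsub>C\<^esub> f)"

definition is_functor ::
  "('i, 'a) cat \<Rightarrow> ('o, 'm) cat \<Rightarrow> ('i \<Rightarrow> 'o) \<Rightarrow> ('a \<Rightarrow> 'm) \<Rightarrow> bool" where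
  "is_functor D C FO FA \<longleftrightarrow>
     category D \<and> category C \<and>
     (\<forall>a \<in> Obj D. FO a \<in> Obj C) \<and>
     (\<forall>a b. \<forall>u \<in> hom D a b. FA u \<in> hom C (FO a) (FO b)) \<and>
     (\<forall>a \<in> Obj D. FA (Ident D a) = Ident C (FO a)) \<and>
     (\<forall>a b c. \<forall>u \<in> hom D a b. \<forall>v \<in> hom D b c.
        FA (v \<odot>\<^bsub>D\<^esub> u) = FA v \<odot>\<^bsub>C\<^esub> FA u)"

section \<open>Smallness\<close>

text \<open>
  Sets in the sense of the universe are modelled by the collections of cardinality less than a
  strongly inaccessible cardinal \<^term>\<open>\<kappa>\<close> (Grothendieck universe), classes by arbitrary
  collections.  Every small collection is equipotent to a subset of the underlying type of
  \<^term>\<open>\<kappa>\<close>, so it suffices to let diagram shapes and ordinals live on that type.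
\<close>

definition inaccessible :: "'k rel \<Rightarrow> bool" where
  "inaccessible \<kappa> \<longleftrightarrow>
     Card_order \<kappa> \<and> natLeq <o \<kappa> \<and> regularCard \<kappa> \<and>
     (\<forall>A :: 'k set. |A| <o \<kappa> \<longrightarrow> |Pow A| <o \<kappa>)"

definition small :: "'k rel \<Rightarrow> 'a set \<Rightarrow> bool" where
  "small \<kappa> A \<longleftrightarrow> |A| <o \<kappa>"

definition small_category :: "'k rel \<Rightarrow> ('i, 'a) cat \<Rightarrow> bool" where
  "small_category \<kappa> D \<longleftrightarrow> category D \<and> small \<kappa> (Obj D) \<and> small \<kappa> (Arr D)"

definition locally_small :: "'k rel \<Rightarrow> ('o, 'm) cat \<Rightarrow> bool" where
  "locally_small \<kappa> C \<longleftrightarrow> (\<forall>a \<in> Obj C. \<forall>b \<in> Obj C. small \<kappa> (hom C a b))"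

section \<open>Limits and colimits\<close>

definition is_cocone ::
  "('o, 'm) cat \<Rightarrow> ('i, 'a) cat \<Rightarrow> ('i \<Rightarrow> 'o) \<Rightarrow> ('a \<Rightarrow> 'm) \<Rightarrow> 'o \<Rightarrow> ('i \<Rightarrow> 'm) \<Rightarrow> bool" where
  "is_cocone C D FO FA x c \<longleftrightarrow>
     x \<in> Obj C \<and> (\<forall>a \<in> Obj D. c a \<in> hom C (FO a) x) \<and>
     (\<forall>u \<in> Arr D. c (Cod D u) \<odot>\<^bsub>C\<^esub> FA u = c (Dom D u))"

definition is_colimit ::
  "('o, 'm) cat \<Rightarrow> ('i, 'a) cat \<Rightarrow> ('i \<Rightarrow> 'o) \<Rightarrow> ('a \<Rightarrow> 'm) \<Rightarrow> 'o \<Rightarrow> ('i \<Rightarrow> 'm) \<Rightarrow> bool" where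
  "is_colimit C D FO FA x c \<longleftrightarrow>
     is_cocone C D FO FA x c \<and>
     (\<forall>y d. is_cocone C D FO FA y d \<longrightarrow>
        (\<exists>!h. h \<in> hom C x y \<and> (\<forall>a \<in> Obj D. h \<odot>\<^bsub>C\<^esub> c a = d a)))"

definition is_cone ::
  "('o, 'm) cat \<Rightarrow> ('i, 'a) cat \<Rightarrow> ('i \<Rightarrow> 'o) \<Rightarrow> ('a \<Rightarrow> 'm) \<Rightarrow> 'o \<Rightarrow> ('i \<Rightarrow> 'm) \<Rightarrow> bool" where
  "is_cone C D FO FA x c \<longleftrightarrow>
     x \<in> Obj C \<and> (\<forall>a \<in> Obj D. c a \<in> hom C x (FO a)) \<and>
     (\<forall>u \<in> Arr D. FA u \<odot>\<^bsub>C\<^esub> c (Dom D u) = c (Cod D u))"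

definition is_limit ::
  "('o, 'm) cat \<Rightarrow> ('i, 'a) cat \<Rightarrow> ('i \<Rightarrow> 'o) \<Rightarrow> ('a \<Rightarrow> 'm) \<Rightarrow> 'o \<Rightarrow> ('i \<Rightarrow> 'm) \<Rightarrow> bool" where
  "is_limit C D FO FA x c \<longleftrightarrow>
     is_cone C D FO FA x c \<and>
     (\<forall>y d. is_cone C D FO FA y d \<longrightarrow>
        (\<exists>!h. h \<in> hom C y x \<and> (\<forall>a \<in> Obj D. c a \<odot>\<^bsub>C\<^esub> h = d a)))"

definition cocomplete :: "'k rel \<Rightarrow> ('o, 'm) cat \<Rightarrow> bool" where
  "cocomplete \<kappa> C \<longleftrightarrow>
     (\<forall>(D :: ('k, 'k) cat) FO FA. small_category \<kappa> D \<and> is_functor D C FO FA \<longrightarrow>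
        (\<exists>x c. is_colimit C D FO FA x c))"

definition complete :: "'k rel \<Rightarrow> ('o, 'm) cat \<Rightarrow> bool" where
  "complete \<kappa> C \<longleftrightarrow>
     (\<forall>(D :: ('k, 'k) cat) FO FA. small_category \<kappa> D \<and> is_functor D C FO FA \<longrightarrow>
        (\<exists>x c. is_limit C D FO FA x c))"

definition is_initial :: "('o, 'm) cat \<Rightarrow> 'o \<Rightarrow> bool" where
  "is_initial C z \<longleftrightarrow> z \<in> Obj C \<and> (\<forall>x \<in> Obj C. \<exists>!h. h \<in> hom C z x)"

definition is_coproduct :: "('o, 'm) cat \<Rightarrow> 'o \<Rightarrow> 'o \<Rightarrow> 'o \<Rightarrow> 'm \<Rightarrow> 'm \<Rightarrow> bool" where
  "is_coproduct C a b s in1 in2 \<longleftrightarrow>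
     in1 \<in> hom C a s \<and> in2 \<in> hom C b s \<and>
     (\<forall>x. \<forall>p \<in> hom C a x. \<forall>q \<in> hom C b x.
        \<exists>!h. h \<in> hom C s x \<and> h \<odot>\<^bsub>C\<^esub> in1 = p \<and> h \<odot>\<^bsub>C\<^esub> in2 = q)"

text \<open>\<^term>\<open>g\<close> is the pushout of \<^term>\<open>f\<close> along \<^term>\<open>u\<close>; the remaining leg is \<^term>\<open>v\<close>.\<close>

definition is_pushout :: "('o, 'm) cat \<Rightarrow> 'm \<Rightarrow> 'm \<Rightarrow> 'm \<Rightarrow> 'm \<Rightarrow> bool" where
  "is_pushout C f u g v \<longleftrightarrow>
     f \<in> Arr C \<and> u \<in> Arr C \<and> Dom C u = Dom C f \<and>
     g \<in> Arr C \<and> v \<in> Arr C \<and> Dom C g = Cod C u \<and> Dom C v = Cod C f \<and> Cod C g = Cod C v \<and>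
     g \<odot>\<^bsub>C\<^esub> u = v \<odot>\<^bsub>C\<^esub> f \<and>
     (\<forall>x. \<forall>p \<in> hom C (Cod C u) x. \<forall>q \<in> hom C (Cod C f) x.
        p \<odot>\<^bsub>C\<^esub> u = q \<odot>\<^bsub>C\<^esub> f \<longrightarrow>
        (\<exists>!h. h \<in> hom C (Cod C g) x \<and> h \<odot>\<^bsub>C\<^esub> g = p \<and> h \<odot>\<^bsub>C\<^esub> v = q))"

section \<open>Locally presentable categories\<close>

definition poset_cat :: "'i rel \<Rightarrow> ('i, 'i \<times> 'i) cat" where
  "poset_cat r = \<lparr>Obj = Field r, Arr = r, Dom = fst, Cod = snd,
     Ident = (\<lambda>a. (a, a)), Comp = (\<lambda>v u. (fst u, snd v))\<rparr>"

definition small_regular_cardinal :: "'k rel \<Rightarrow> 'k rel \<Rightarrow> bool" where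
  "small_regular_cardinal \<kappa> \<mu> \<longleftrightarrow>
     Card_order \<mu> \<and> natLeq \<le>o \<mu> \<and> regularCard \<mu> \<and> \<mu> <o \<kappa>"

text \<open>For the empty subset the bound says that a directed poset is nonempty.\<close>

definition small_directed_poset :: "'k rel \<Rightarrow> 'k rel \<Rightarrow> 'k rel \<Rightarrow> bool" where
  "small_directed_poset \<kappa> \<mu> r \<longleftrightarrow>
     Partial_order r \<and> small \<kappa> (Field r) \<and>
     (\<forall>S \<subseteq> Field r. |S| <o \<mu> \<longrightarrow> (\<exists>b \<in> Field r. \<forall>a \<in> S. (a, b) \<in> r))"

text \<open>
  The two conditions after the colimit say that \<open>Hom(K, -)\<close> preserves the colimit: the
  canonical map to \<open>Hom(K, x)\<close> from the directed colimit of the sets \<open>Hom(K, FO a)\<close>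
  is surjective and injective.  That colimit in sets is the quotient of the disjoint union
  which identifies elements that become equal at some later stage.
\<close>

definition presentable :: "'k rel \<Rightarrow> ('o, 'm) cat \<Rightarrow> 'k rel \<Rightarrow> 'o \<Rightarrow> bool" where
  "presentable \<kappa> C \<mu> K \<longleftrightarrow>
     K \<in> Obj C \<and>
     (\<forall>(r :: 'k rel) FO FA x c.
        small_directed_poset \<kappa> \<mu> r \<and> is_functor (poset_cat r) C FO FA \<and>
        is_colimit C (poset_cat r) FO FA x c \<longrightarrow>
          (\<forall>h \<in> hom C K x. \<exists>a \<in> Field r. \<exists>g \<in> hom C K (FO a). c a \<odot>\<^bsub>C\<^esub> g = h) \<and>
          (\<forall>a \<in> Field r. \<forall>b \<in> Field r. \<forall>g \<in> hom C K (FO a). \<forall>g' \<in> hom C K (FO b).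
             c a \<odot>\<^bsub>C\<^esub> g = c b \<odot>\<^bsub>C\<^esub> g' \<longrightarrow>
             (\<exists>d. (a, d) \<in> r \<and> (b, d) \<in> r \<and>
                  FA (a, d) \<odot>\<^bsub>C\<^esub> g = FA (b, d) \<odot>\<^bsub>C\<^esub> g')))"

definition locally_presentable :: "'k rel \<Rightarrow> ('o, 'm) cat \<Rightarrow> bool" where
  "locally_presentable \<kappa> C \<longleftrightarrow>
     category C \<and> locally_small \<kappa> C \<and> cocomplete \<kappa> C \<and>
     (\<exists>(\<mu> :: 'k rel) A. small_regular_cardinal \<kappa> \<mu> \<and>
        small \<kappa> A \<and> (\<forall>a \<in> A. presentable \<kappa> C \<mu> a) \<and>
        (\<forall>x \<in> Obj C. \<exists>(r :: 'k rel) FO FA c.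
           small_directed_poset \<kappa> \<mu> r \<and> is_functor (poset_cat r) C FO FA \<and>
           (\<forall>a \<in> Field r. FO a \<in> A) \<and> is_colimit C (poset_cat r) FO FA x c))"

section \<open>Lifting properties and cellular morphisms\<close>

definition lifts :: "('o, 'm) cat \<Rightarrow> 'm \<Rightarrow> 'm \<Rightarrow> bool" where
  "lifts C i p \<longleftrightarrow>
     (\<forall>u \<in> hom C (Dom C i) (Dom C p). \<forall>v \<in> hom C (Cod C i) (Cod C p).
        p \<odot>\<^bsub>C\<^esub> u = v \<odot>\<^bsub>C\<^esub> i \<longrightarrow>
        (\<exists>h \<in> hom C (Cod C i) (Dom C p). h \<odot>\<^bsub>C\<^esub> i = u \<and> p \<odot>\<^bsub>C\<^esub> h = v))"

definition rlp :: "('o, 'm) cat \<Rightarrow> 'm set \<Rightarrow> 'm set" where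
  "rlp C K = {p \<in> Arr C. \<forall>i \<in> K. lifts C i p}"

definition llp :: "('o, 'm) cat \<Rightarrow> 'm set \<Rightarrow> 'm set" where
  "llp C K = {i \<in> Arr C. \<forall>p \<in> K. lifts C i p}"

abbreviation inj_class :: "('o, 'm) cat \<Rightarrow> 'm set \<Rightarrow> 'm set" where
  "inj_class \<equiv> rlp"

definition pushouts_of :: "('o, 'm) cat \<Rightarrow> 'm set \<Rightarrow> 'm set" where
  "pushouts_of C K = {g. \<exists>f \<in> K. \<exists>u v. is_pushout C f u g v}"

definition immediate_succ :: "'i rel \<Rightarrow> 'i \<Rightarrow> 'i \<Rightarrow> bool" where
  "immediate_succ r a b \<longleftrightarrow> a \<in> underS r b \<and> (\<forall>d \<in> underS r b. (d, a) \<in> r)"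

definition limit_element :: "'i rel \<Rightarrow> 'i \<Rightarrow> bool" where
  "limit_element r b \<longleftrightarrow>
     b \<in> Field r \<and> underS r b \<noteq> {} \<and> (\<nexists>a. immediate_succ r a b)"

text \<open>
  A transfinite composition is the canonical morphism \<^term>\<open>c z\<close> from the first stage to the
  colimit of a sequence indexed by a nonempty small ordinal (a well-order \<^term>\<open>r\<close> with least
  element \<^term>\<open>z\<close>).  The sequence is continuous at limit elements and each of its successor
  steps lies in \<^term>\<open>K\<close>.
\<close>

definition transfinite_compositions :: "'k rel \<Rightarrow> ('o, 'm) cat \<Rightarrow> 'm set \<Rightarrow> 'm set" where
  "transfinite_compositions \<kappa> C K =
     {t. \<exists>(r :: 'k rel) z FO FA x c.
        Well_order r \<and> small \<kappa> (Field r) \<and> z \<in> Field r \<and> (\<forall>a \<in> Field r. (z, a) \<in> r) \<and>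
        is_functor (poset_cat r) C FO FA \<and>
        (\<forall>a b. immediate_succ r a b \<longrightarrow> FA (a, b) \<in> K) \<and>
        (\<forall>b. limit_element r b \<longrightarrow>
           is_colimit C (poset_cat (Restr r (underS r b))) FO FA (FO b) (\<lambda>a. FA (a, b))) \<and>
        is_colimit C (poset_cat r) FO FA x c \<and> t = c z}"

definition is_retract :: "('o, 'm) cat \<Rightarrow> 'm \<Rightarrow> 'm \<Rightarrow> bool" where
  "is_retract C f g \<longleftrightarrow>
     f \<in> Arr C \<and> g \<in> Arr C \<and>
     (\<exists>i \<in> hom C (Dom C f) (Dom C g). \<exists>r \<in> hom C (Dom C g) (Dom C f).
      \<exists>i' \<in> hom C (Cod C f) (Cod C g). \<exists>r' \<in> hom C (Cod C g) (Cod C f).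
        r \<odot>\<^bsub>C\<^esub> i = Ident C (Dom C f) \<and> r' \<odot>\<^bsub>C\<^esub> i' = Ident C (Cod C f) \<and>
        g \<odot>\<^bsub>C\<^esub> i = i' \<odot>\<^bsub>C\<^esub> f \<and> f \<odot>\<^bsub>C\<^esub> r = r' \<odot>\<^bsub>C\<^esub> g)"

definition cell :: "'k rel \<Rightarrow> ('o, 'm) cat \<Rightarrow> 'm set \<Rightarrow> 'm set" where
  "cell \<kappa> C K =
     {f. \<exists>g \<in> transfinite_compositions \<kappa> C (pushouts_of C K). is_retract C f g}"

section \<open>Model structures\<close>

definition weak_factorization_system :: "('o, 'm) cat \<Rightarrow> 'm set \<Rightarrow> 'm set \<Rightarrow> bool" where
  "weak_factorization_system C \<L> \<R> \<longleftrightarrow>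
     (\<forall>f \<in> Arr C. \<exists>h \<in> \<L>. \<exists>g \<in> \<R>. Dom C g = Cod C h \<and> f = g \<odot>\<^bsub>C\<^esub> h) \<and>
     \<L> = llp C \<R> \<and> \<R> = rlp C \<L>"

definition two_out_of_three :: "('o, 'm) cat \<Rightarrow> 'm set \<Rightarrow> bool" where
  "two_out_of_three C W \<longleftrightarrow>
     (\<forall>f \<in> Arr C. \<forall>g \<in> Arr C. Dom C g = Cod C f \<longrightarrow>
        (f \<in> W \<and> g \<in> W \<longrightarrow> g \<odot>\<^bsub>C\<^esub> f \<in> W) \<and>
        (f \<in> W \<and> g \<odot>\<^bsub>C\<^esub> f \<in> W \<longrightarrow> g \<in> W) \<and>
        (g \<in> W \<and> g \<odot>\<^bsub>C\<^esub> f \<in> W \<longrightarrow> f \<in> W))"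

text \<open>The arguments are, in this order, weak equivalences, fibrations and cofibrations.\<close>

definition closed_model_structure ::
  "'k rel \<Rightarrow> ('o, 'm) cat \<Rightarrow> 'm set \<Rightarrow> 'm set \<Rightarrow> 'm set \<Rightarrow> bool" where
  "closed_model_structure \<kappa> C W F Cof \<longleftrightarrow>
     category C \<and> complete \<kappa> C \<and> cocomplete \<kappa> C \<and>
     W \<subseteq> Arr C \<and> F \<subseteq> Arr C \<and> Cof \<subseteq> Arr C \<and>
     weak_factorization_system C Cof (F \<inter> W) \<and>
     weak_factorization_system C (Cof \<inter> W) F \<and>
     two_out_of_three C W"

definition cofibrantly_generated ::
  "'k rel \<Rightarrow> ('o, 'm) cat \<Rightarrow> 'm set \<Rightarrow> 'm set \<Rightarrow> bool" where
  "cofibrantly_generated \<kappa> C W F \<longleftrightarrow>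
     (\<exists>I' J'. I' \<subseteq> Arr C \<and> J' \<subseteq> Arr C \<and> small \<kappa> I' \<and> small \<kappa> J' \<and>
        inj_class C I' = F \<inter> W \<and> inj_class C J' = F)"

end

theory Submission
  imports Defs
begin

text \<open>
  For a small set \<open>K\<close> of morphisms the small object argument gives the weak factorization system
  \<open>(cell K, inj K)\<close>.  Applied to \<open>I \<union> J\<close> and to \<open>J\<close> it yields both factorization systems of the model
  structure, since \<open>inj (I \<union> J) = F \<inter> W\<close>, and since \<open>cell J = Cof \<inter> W\<close>: a morphism of \<open>Cof \<inter> W\<close> factors as
  \<open>g h\<close> with \<open>h\<close> in \<open>cell J\<close> and \<open>g\<close> in \<open>F\<close>, two-out-of-three puts \<open>g\<close> into \<open>F \<inter> W\<close>, and
  the retract argument applies.  Two-out-of-three is evident because lifting against \<open>i\<^sub>l\<close> and \<open>j\<^sub>l\<close>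
  means surjectivity and injectivity on \<open>Hom(X\<^sub>l, -)\<close>.  For completeness, the colimit of all cones with a
  generator as apex is weakly terminal among cones, and coequalizing its endomorphisms makes it terminal.
\<close>

section \<open>Small sets\<close>

text \<open>The steps of a transfinite composition are pushouts of single members of
  \<open>K\<close>, so cells are attached one at a time and their order has to be scheduled. Every
  stage poses new lifting problems, and the length at which one may stop depends on the
  presentability ranks of the domains. The chain is therefore run along all of
  \<open>\<kappa>\<close>, whose field is not small, and cut afterwards. An identity need not be a
  pushout of a member of \<open>K\<close>; hence each step attaches some cell as long as a problem
  exists, and a stage without problems ends the chain. Presentability is granted only to the
  generators; the rank of an arbitrary object has to be extracted from its presentation as a small
  directed colimit. Local presentability is defined through cocompleteness, which is why
  completeness needs a proof.\<close>

locale inaccessible_cardinal =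
  fixes \<kappa> :: "'k rel"
  assumes inacc: "inaccessible \<kappa>"
begin

lemma card_\<kappa>: "Card_order \<kappa>" and regular_\<kappa>: "regularCard \<kappa>"
  using inacc by (auto simp: inaccessible_def)

lemma wo_\<kappa>: "Well_order \<kappa>"
  using card_\<kappa> by (rule card_order_on_well_order_on)

lemma infinite_\<kappa>: "infinite (Field \<kappa>)"
proof -
  have "natLeq \<le>o \<kappa>"
    using inacc by (auto simp: inaccessible_def intro: ordLess_imp_ordLeq)
  then show ?thesis
    using cinfinite_mono natLeq_cinfinite unfolding cinfinite_def by blast
qed

lemma stable_\<kappa>: "stable \<kappa>"
  using card_\<kappa> infinite_\<kappa> regular_\<kappa> by (rule regularCard_stable)

lemma small_mono: "small \<kappa> B \<Longrightarrow> A \<subseteq> B \<Longrightarrow> small \<kappa> A"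
  unfolding small_def by (meson card_of_mono1 ordLeq_ordLess_trans)

lemma small_image: "small \<kappa> A \<Longrightarrow> small \<kappa> (f ` A)"
  unfolding small_def by (meson card_of_image ordLeq_ordLess_trans)

lemma small_inj_on: "inj_on f A \<Longrightarrow> f ` A \<subseteq> B \<Longrightarrow> small \<kappa> B \<Longrightarrow> small \<kappa> A"
  unfolding small_def by (meson card_of_ordLeqI image_subset_iff ordLeq_ordLess_trans)

lemma small_finite: "finite A \<Longrightarrow> small \<kappa> A"
  unfolding small_def
  by (rule finite_ordLess_infinite[OF card_of_Well_order wo_\<kappa>]) (simp_all add: infinite_\<kappa> Field_card_of)

lemma small_Sigma: "small \<kappa> A \<Longrightarrow> (\<And>a. a \<in> A \<Longrightarrow> small \<kappa> (B a)) \<Longrightarrow> small \<kappa> (Sigma A B)"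
  unfolding small_def using stable_elim[OF stable_\<kappa>] by blast

lemma small_UN: "small \<kappa> A \<Longrightarrow> (\<And>a. a \<in> A \<Longrightarrow> small \<kappa> (B a)) \<Longrightarrow> small \<kappa> (\<Union>a\<in>A. B a)"
  unfolding small_def using stable_UNION[OF stable_\<kappa>] by blast

lemma small_Times: "small \<kappa> A \<Longrightarrow> small \<kappa> B \<Longrightarrow> small \<kappa> (A \<times> B)"
  by (rule small_Sigma)

lemma small_Un:
  assumes "small \<kappa> A" "small \<kappa> B"
  shows "small \<kappa> (A \<union> B)"
proof -
  have "small \<kappa> (\<Union>b\<in>(UNIV::bool set). if b then A else B)"
    by (rule small_UN) (use assms in \<open>auto intro: small_finite\<close>)
  then show ?thesis
    by (rule small_mono) (auto split: if_splits)
qed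

lemma small_Plus: "small \<kappa> A \<Longrightarrow> small \<kappa> B \<Longrightarrow> small \<kappa> (A <+> B)"
  unfolding Plus_def by (intro small_Un small_image)

text \<open>Supplies codes in the type \<open>'k\<close>: shapes of diagrams are transported along
  such embeddings, and lifting problems are numbered by them.\<close>

lemma small_embedding:
  assumes "small \<kappa> A"
  obtains \<phi> :: "_ \<Rightarrow> 'k" where "inj_on \<phi> A" "\<phi> ` A \<subseteq> Field \<kappa>"
proof -
  have "|A| \<le>o |Field \<kappa>|"
    using assms unfolding small_def
    by (meson card_\<kappa> card_of_Field_ordIso ordIso_symmetric ordLess_imp_ordLeq ordLeq_ordIso_trans)
  then show ?thesis
    using that unfolding card_of_ordLeq[symmetric] by blast
qed

text \<open>Inaccessibility speaks of power sets of subsets of \<open>'k\<close> only, so an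
  arbitrary small set is first embedded there.\<close>

lemma small_Pow:
  assumes "small \<kappa> A"
  shows "small \<kappa> (Pow A)"
proof -
  obtain \<phi> :: "_ \<Rightarrow> 'k" where \<phi>: "inj_on \<phi> A"
    using assms by (rule small_embedding)
  have "small \<kappa> (Pow (\<phi> ` A))"
    using small_image[OF assms, of \<phi>] inacc unfolding small_def inaccessible_def by blast
  then show ?thesis
    using \<phi> by (intro small_inj_on[of "image \<phi>"]) (auto simp: inj_on_image_Pow)
qed

text \<open>Fixing the value \<open>undefined\<close> off \<open>A\<close> makes a function
  recoverable from its graph over \<open>A\<close>, which is a subset of
  \<open>A \<times> B\<close>. Families of legs of cones are counted in this way.\<close>

lemma small_funs:
  assumes "small \<kappa> A" "small \<kappa> B"
  shows "small \<kappa> {f. (\<forall>a\<in>A. f a \<in> B) \<and> (\<forall>a. a \<notin> A \<longrightarrow> f a = undefined)}" (is "small \<kappa> ?F")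
proof (rule small_inj_on)
  show "inj_on (\<lambda>f. (\<lambda>a. (a, f a)) ` A) ?F"
  proof (rule inj_onI, rule ext)
    fix f g a assume fg: "f \<in> ?F" "g \<in> ?F" and eq: "(\<lambda>a. (a, f a)) ` A = (\<lambda>a. (a, g a)) ` A"
    show "f a = g a"
    proof (cases "a \<in> A")
      case True
      then have "(a, f a) \<in> (\<lambda>a. (a, g a)) ` A" unfolding eq[symmetric] by blast
      then show ?thesis by auto
    qed (use fg in auto)
  qed
  show "(\<lambda>f. (\<lambda>a. (a, f a)) ` A) ` ?F \<subseteq> Pow (A \<times> B)" by auto
  show "small \<kappa> (Pow (A \<times> B))" by (intro small_Pow small_Times assms)
qed

lemma small_underS: "a \<in> Field \<kappa> \<Longrightarrow> small \<kappa> (underS \<kappa> a)"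
  unfolding small_def by (rule card_of_underS[OF card_\<kappa>])

text \<open>Regularity: a set of fewer than \<open>\<kappa>\<close> elements cannot be
  cofinal.\<close>

lemma small_bounded:
  assumes D: "small \<kappa> D" "D \<subseteq> Field \<kappa>"
  obtains b where "b \<in> Field \<kappa>" "D \<subseteq> underS \<kappa> b"
proof -
  have wo: "wo_rel \<kappa>" using wo_\<kappa> by (simp add: wo_rel_def)
  have "\<not> |D| =o \<kappa>"
    using D(1) not_ordLess_ordIso unfolding small_def by blast
  then have "\<not> cofinal D \<kappa>"
    using regular_\<kappa> D(2) unfolding regularCard_def by blast
  then obtain a where a: "a \<in> Field \<kappa>" "\<And>d. d \<in> D \<Longrightarrow> a = d \<or> (a, d) \<notin> \<kappa>"
    unfolding cofinal_def by blast
  have le: "(d, a) \<in> \<kappa>" if "d \<in> D" for d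
    using a(2)[OF that] wo_rel.TOTALS[OF wo] a(1) D(2) that wo_rel.REFL[OF wo] unfolding refl_on_def by blast
  \<comment> \<open>The failure of cofinality gives only a weak bound \<open>a\<close>; an infinite
    cardinal has no largest element, so a strict bound exists above it.\<close>
  obtain b where b: "b \<in> Field \<kappa>" "a \<noteq> b" "(a, b) \<in> \<kappa>"
    using infinite_Card_order_limit[OF card_\<kappa> infinite_\<kappa> a(1)] by (auto simp: Field_def)
  have "d \<in> underS \<kappa> b" if "d \<in> D" for d
    using le[OF that] b wo_rel.TRANS[OF wo] wo_rel.ANTISYM[OF wo] unfolding underS_def trans_def antisym_def by blast
  with b(1) show ?thesis using that by blast
qed

end

section \<open>Categories and lifting\<close>

locale cat =
  fixes C :: "('o, 'm) cat" (structure)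
  assumes category: "category C"
begin

lemma in_hom_iff: "f \<in> hom C a b \<longleftrightarrow> f \<in> Arr C \<and> Dom C f = a \<and> Cod C f = b"
  by (simp add: hom_def)

lemma hom_arr: "f \<in> hom C a b \<Longrightarrow> f \<in> Arr C"
  and hom_dom: "f \<in> hom C a b \<Longrightarrow> Dom C f = a"
  and hom_cod: "f \<in> hom C a b \<Longrightarrow> Cod C f = b"
  by (auto simp: hom_def)

lemma arr_hom: "f \<in> Arr C \<Longrightarrow> f \<in> hom C (Dom C f) (Cod C f)"
  by (simp add: hom_def)

lemma dom_obj: "f \<in> Arr C \<Longrightarrow> Dom C f \<in> Obj C"
  and cod_obj: "f \<in> Arr C \<Longrightarrow> Cod C f \<in> Obj C"
  using category by (auto simp: category_def)

lemma hom_obj: "f \<in> hom C a b \<Longrightarrow> a \<in> Obj C" "f \<in> hom C a b \<Longrightarrow> b \<in> Obj C"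
  using dom_obj cod_obj by (auto simp: hom_def)

lemma ident_hom [simp]: "a \<in> Obj C \<Longrightarrow> Ident C a \<in> hom C a a"
  using category by (auto simp: category_def)

lemma comp_hom [intro]: "g \<in> hom C b c \<Longrightarrow> f \<in> hom C a b \<Longrightarrow> g \<odot> f \<in> hom C a c"
  using category unfolding category_def by blast

lemma comp_ident [simp]: "f \<in> hom C a b \<Longrightarrow> f \<odot> Ident C a = f"
  and ident_comp [simp]: "f \<in> hom C a b \<Longrightarrow> Ident C b \<odot> f = f"
  using category unfolding category_def by blast+

lemma comp_assoc:
  "h \<in> hom C c d \<Longrightarrow> g \<in> hom C b c \<Longrightarrow> f \<in> hom C a b \<Longrightarrow> (h \<odot> g) \<odot> f = h \<odot> (g \<odot> f)"
  using category unfolding category_def by metis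

lemma comp_arr:
  assumes "f \<in> Arr C" "g \<in> Arr C" "Dom C g = Cod C f"
  shows "g \<odot> f \<in> Arr C" "Dom C (g \<odot> f) = Dom C f" "Cod C (g \<odot> f) = Cod C g"
  using comp_hom[OF arr_hom[OF assms(2)], of f "Dom C f"] assms by (auto simp: hom_def)

lemma lifts_hom:
  assumes "i \<in> hom C a b" "p \<in> hom C x y"
  shows "lifts C i p \<longleftrightarrow> (\<forall>u \<in> hom C a x. \<forall>v \<in> hom C b y. p \<odot> u = v \<odot> i \<longrightarrow>
    (\<exists>h \<in> hom C b x. h \<odot> i = u \<and> p \<odot> h = v))"
  using assms by (simp add: lifts_def hom_dom[OF assms(1)] hom_cod[OF assms(1)] hom_dom[OF assms(2)] hom_cod[OF assms(2)])

lemma liftsE: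
  assumes "lifts C i p" "i \<in> hom C a b" "p \<in> hom C x y" "u \<in> hom C a x" "v \<in> hom C b y" "p \<odot> u = v \<odot> i"
  obtains h where "h \<in> hom C b x" "h \<odot> i = u" "p \<odot> h = v"
  using assms lifts_hom by blast

text \<open>Composing the square with the pushout square gives a lifting problem for
  \<open>f\<close>; its solution agrees with the given top map on the corner, so the two glue along
  the pushout.\<close>

lemma lifts_pushout:
  assumes "is_pushout C f u g v" "lifts C f p" "p \<in> Arr C"
  shows "lifts C g p"
proof -
  obtain a b c d x y where h: "f \<in> hom C a b" "u \<in> hom C a c" "g \<in> hom C c d" "v \<in> hom C b d"
    and p: "p \<in> hom C x y" and gu: "g \<odot> u = v \<odot> f"
    using assms by (auto simp: is_pushout_def hom_def)
  have univ: "\<exists>!h. h \<in> hom C d z \<and> h \<odot> g = s \<and> h \<odot> v = t"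
    if "s \<in> hom C c z" "t \<in> hom C b z" "s \<odot> u = t \<odot> f" for s t z
    using assms(1) that unfolding is_pushout_def hom_cod[OF h(1)] hom_cod[OF h(2)] hom_cod[OF h(3)] by blast
  show ?thesis unfolding lifts_hom[OF h(3) p]
  proof (intro ballI impI)
    fix s t assume st: "s \<in> hom C c x" "t \<in> hom C d y" "p \<odot> s = t \<odot> g"
    have "p \<odot> (s \<odot> u) = (t \<odot> v) \<odot> f"
      by (metis comp_assoc[OF p st(1) h(2)] comp_assoc[OF st(2) h(3,2)] comp_assoc[OF st(2) h(4,1)] gu st(3))
    then obtain k where k: "k \<in> hom C b x" "k \<odot> f = s \<odot> u" "p \<odot> k = t \<odot> v"
      using liftsE[OF assms(2) h(1) p] comp_hom st h by metis
    obtain l where l: "l \<in> hom C d x" "l \<odot> g = s" "l \<odot> v = k"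
      using univ[OF st(1) k(1)] k(2) by auto
    \<comment> \<open>Both sides restrict to \<open>t \<odot> g\<close> and
      \<open>t \<odot> v\<close> on the legs, so the uniqueness part of the pushout property
      identifies them.\<close>
    have "p \<odot> l = t"
    proof (rule ex1E[OF univ[of "t \<odot> g" y "t \<odot> v"]])
      show "t \<odot> g \<in> hom C c y" "t \<odot> v \<in> hom C b y" using st h by auto
      show "(t \<odot> g) \<odot> u = (t \<odot> v) \<odot> f"
        by (metis comp_assoc[OF st(2) h(3,2)] comp_assoc[OF st(2) h(4,1)] gu)
      fix e assume "\<forall>y'. y' \<in> hom C d y \<and> y' \<odot> g = t \<odot> g \<and> y' \<odot> v = t \<odot> v \<longrightarrow> y' = e"
      moreover have "p \<odot> l \<in> hom C d y" "(p \<odot> l) \<odot> g = t \<odot> g" "(p \<odot> l) \<odot> v = t \<odot> v"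
        using p l st k h comp_assoc[OF p l(1) h(3)] comp_assoc[OF p l(1) h(4)] by auto
      ultimately show "p \<odot> l = t" using st(2) by metis
    qed
    with l show "\<exists>h\<in>hom C d x. h \<odot> g = s \<and> p \<odot> h = t" by blast
  qed
qed

text \<open>Extend the square along the retractions \<open>r\<close> and \<open>r'\<close>, lift it
  against \<open>g\<close>, and restrict the lift along \<open>i'\<close>.\<close>

lemma lifts_retract:
  assumes "is_retract C f g" "lifts C g p" "p \<in> Arr C"
  shows "lifts C f p"
proof -
  obtain a b c d i r i' r' x y where f: "f \<in> hom C a b" and g: "g \<in> hom C c d" and p: "p \<in> hom C x y"
    and h: "i \<in> hom C a c" "r \<in> hom C c a" "i' \<in> hom C b d" "r' \<in> hom C d b"
    and eq: "r \<odot> i = Ident C a" "r' \<odot> i' = Ident C b" "g \<odot> i = i' \<odot> f" "f \<odot> r = r' \<odot> g"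
    using assms by (auto simp: is_retract_def hom_def)
  show ?thesis unfolding lifts_hom[OF f p]
  proof (intro ballI impI)
    fix u v assume uv: "u \<in> hom C a x" "v \<in> hom C b y" "p \<odot> u = v \<odot> f"
    have "p \<odot> (u \<odot> r) = (v \<odot> r') \<odot> g"
      by (metis comp_assoc[OF p uv(1) h(2)] comp_assoc[OF uv(2) f h(2)] comp_assoc[OF uv(2) h(4) g] eq(4) uv(3))
    then obtain k where k: "k \<in> hom C d x" "k \<odot> g = u \<odot> r" "p \<odot> k = v \<odot> r'"
      using liftsE[OF assms(2) g p] comp_hom uv h by metis
    have "(k \<odot> i') \<odot> f = u"
      by (metis comp_assoc[OF k(1) h(3) f] comp_assoc[OF k(1) g h(1)] comp_assoc[OF uv(1) h(2,1)] comp_ident[OF uv(1)] eq(1,3) k(2))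
    moreover have "p \<odot> (k \<odot> i') = v"
      by (metis comp_assoc[OF p k(1) h(3)] comp_assoc[OF uv(2) h(4,3)] comp_ident[OF uv(2)] eq(2) k(3))
    ultimately show "\<exists>h\<in>hom C b x. h \<odot> f = u \<and> p \<odot> h = v"
      using k h by blast
  qed
qed

lemma is_retract_refl: "f \<in> Arr C \<Longrightarrow> is_retract C f f"
  unfolding is_retract_def using arr_hom[of f] dom_obj[of f] cod_obj[of f]
  by (metis ident_hom comp_ident ident_comp)

text \<open>The square with top \<open>h\<close> and bottom the identity has a lift
  \<open>s\<close>, which is a section of \<open>g\<close>. The retract uses identities on the
  domains and the pair \<open>s\<close>, \<open>g\<close> on the codomains.\<close>

lemma retract_argument:
  assumes "h \<in> hom C a b" "g \<in> hom C b c" "f = g \<odot> h" "lifts C f g"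
  shows "is_retract C f h"
proof -
  have f: "f \<in> hom C a c" using assms by auto
  have "g \<odot> h = Ident C c \<odot> f" using assms f by simp
  then obtain s where s: "s \<in> hom C c b" "s \<odot> f = h" "g \<odot> s = Ident C c"
    using liftsE[OF assms(4) f assms(2,1), of "Ident C c"] hom_obj[OF f] by auto
  have a: "Ident C a \<in> hom C a a" using hom_obj[OF f] by simp
  show ?thesis
    unfolding is_retract_def hom_dom[OF f] hom_cod[OF f] hom_dom[OF assms(1)] hom_cod[OF assms(1)]
    using a s f assms(1,2,3) comp_ident[OF a] comp_ident[OF f] comp_ident[OF assms(1)]
    by (intro conjI bexI[of _ "Ident C a"] bexI[of _ s] bexI[of _ g]) (auto simp: hom_arr)
qed

lemma llp_mono: "A \<subseteq> B \<Longrightarrow> llp C B \<subseteq> llp C A"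
  by (auto simp: llp_def)

lemma rlp_llp_rlp: "K \<subseteq> Arr C \<Longrightarrow> rlp C (llp C (rlp C K)) = rlp C K"
  by (auto simp: llp_def rlp_def)

end

section \<open>Colimits of small graphs and completeness\<close>

lemma categoryI:
  assumes "\<And>f. f \<in> Arr C \<Longrightarrow> Dom C f \<in> Obj C" "\<And>f. f \<in> Arr C \<Longrightarrow> Cod C f \<in> Obj C"
    and "\<And>a. a \<in> Obj C \<Longrightarrow> Ident C a \<in> Arr C \<and> Dom C (Ident C a) = a \<and> Cod C (Ident C a) = a"
    and "\<And>f g. f \<in> Arr C \<Longrightarrow> g \<in> Arr C \<Longrightarrow> Dom C g = Cod C f \<Longrightarrow>
      Comp C g f \<in> Arr C \<and> Dom C (Comp C g f) = Dom C f \<and> Cod C (Comp C g f) = Cod C g"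
    and "\<And>f. f \<in> Arr C \<Longrightarrow> Comp C f (Ident C (Dom C f)) = f \<and> Comp C (Ident C (Cod C f)) f = f"
    and "\<And>f g h. f \<in> Arr C \<Longrightarrow> g \<in> Arr C \<Longrightarrow> h \<in> Arr C \<Longrightarrow> Dom C g = Cod C f \<Longrightarrow> Dom C h = Cod C g \<Longrightarrow>
      Comp C h (Comp C g f) = Comp C (Comp C h g) f"
  shows "category C"
  unfolding category_def hom_def using assms by auto

lemma functorI:
  assumes "category D" "category C"
    and "\<And>a. a \<in> Obj D \<Longrightarrow> FO a \<in> Obj C"
    and "\<And>u. u \<in> Arr D \<Longrightarrow> FA u \<in> hom C (FO (Dom D u)) (FO (Cod D u))"
    and "\<And>a. a \<in> Obj D \<Longrightarrow> FA (Ident D a) = Ident C (FO a)"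
    and "\<And>u v. u \<in> Arr D \<Longrightarrow> v \<in> Arr D \<Longrightarrow> Dom D v = Cod D u \<Longrightarrow>
      FA (Comp D v u) = Comp C (FA v) (FA u)"
  shows "is_functor D C FO FA"
  unfolding is_functor_def using assms by (auto simp: hom_def)

lemma
  assumes "is_functor D C FO FA"
  shows functor_obj: "a \<in> Obj D \<Longrightarrow> FO a \<in> Obj C"
    and functor_arr: "u \<in> Arr D \<Longrightarrow> FA u \<in> hom C (FO (Dom D u)) (FO (Cod D u))"
    and functor_ident: "a \<in> Obj D \<Longrightarrow> FA (Ident D a) = Ident C (FO a)"
    and functor_comp: "u \<in> Arr D \<Longrightarrow> v \<in> Arr D \<Longrightarrow> Dom D v = Cod D u \<Longrightarrow>
      FA (Comp D v u) = Comp C (FA v) (FA u)"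
  using assms unfolding is_functor_def by (auto simp: hom_def)

context cat
begin

lemma cocone_obj: "is_cocone C D FO FA x c \<Longrightarrow> x \<in> Obj C"
  and cocone_hom: "is_cocone C D FO FA x c \<Longrightarrow> a \<in> Obj D \<Longrightarrow> c a \<in> hom C (FO a) x"
  and cocone_compat: "is_cocone C D FO FA x c \<Longrightarrow> u \<in> Arr D \<Longrightarrow> c (Cod D u) \<odot> FA u = c (Dom D u)"
  by (auto simp: is_cocone_def)

lemma colimit_cocone: "is_colimit C D FO FA x c \<Longrightarrow> is_cocone C D FO FA x c"
  by (simp add: is_colimit_def)

lemmas colimit_obj = cocone_obj[OF colimit_cocone]
  and colimit_hom = cocone_hom[OF colimit_cocone]
  and colimit_compat = cocone_compat[OF colimit_cocone]

lemma colimit_factor: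
  assumes "is_colimit C D FO FA x c" "is_cocone C D FO FA y d"
  shows "\<exists>h \<in> hom C x y. \<forall>a \<in> Obj D. h \<odot> c a = d a"
proof -
  have "\<exists>!h. h \<in> hom C x y \<and> (\<forall>a \<in> Obj D. h \<odot> c a = d a)"
    using assms by (simp add: is_colimit_def)
  then show ?thesis by auto
qed

lemma cocone_comp:
  assumes "is_cocone C D FO FA x c" "h \<in> hom C x y"
    and D: "\<And>u. u \<in> Arr D \<Longrightarrow> Dom D u \<in> Obj D \<and> Cod D u \<in> Obj D"
    and FA: "\<And>u. u \<in> Arr D \<Longrightarrow> FA u \<in> hom C (FO (Dom D u)) (FO (Cod D u))"
  shows "is_cocone C D FO FA y (\<lambda>a. h \<odot> c a)"
  unfolding is_cocone_def
proof (intro conjI ballI)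
  fix u assume u: "u \<in> Arr D"
  show "(h \<odot> c (Cod D u)) \<odot> FA u = h \<odot> c (Dom D u)"
    using comp_assoc[OF assms(2) cocone_hom[OF assms(1)] FA[OF u]] D[OF u] cocone_compat[OF assms(1) u] by simp
qed (use assms(2) cocone_hom[OF assms(1)] hom_obj in auto)

text \<open>The shape is constrained by endpoint conditions instead of \<open>is_functor\<close>,
  because it may be a mere graph whose composition is undefined.\<close>

lemma colimit_eqI:
  assumes c: "is_colimit C D FO FA x c"
    and D: "\<And>u. u \<in> Arr D \<Longrightarrow> Dom D u \<in> Obj D \<and> Cod D u \<in> Obj D"
    and FA: "\<And>u. u \<in> Arr D \<Longrightarrow> FA u \<in> hom C (FO (Dom D u)) (FO (Cod D u))"
    and h: "h \<in> hom C x y" "k \<in> hom C x y" "\<And>a. a \<in> Obj D \<Longrightarrow> h \<odot> c a = k \<odot> c a"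
  shows "h = k"
proof -
  have "is_cocone C D FO FA y (\<lambda>a. h \<odot> c a)"
    by (rule cocone_comp[OF colimit_cocone[OF c] h(1) D FA])
  then have "\<exists>!l. l \<in> hom C x y \<and> (\<forall>a \<in> Obj D. l \<odot> c a = h \<odot> c a)"
    using c unfolding is_colimit_def by blast
  then show ?thesis using h by metis
qed

text \<open>In a recursion along \<open>\<kappa>\<close> two diagrams may agree only on the stages
  already constructed; this makes their colimits interchangeable.\<close>

lemma colimit_cong:
  assumes "is_colimit C D FO FA x c"
    and "\<And>a. a \<in> Obj D \<Longrightarrow> FO a = FO' a" "\<And>u. u \<in> Arr D \<Longrightarrow> FA u = FA' u" "\<And>a. a \<in> Obj D \<Longrightarrow> c a = c' a"
    and D: "\<And>u. u \<in> Arr D \<Longrightarrow> Dom D u \<in> Obj D \<and> Cod D u \<in> Obj D"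
  shows "is_colimit C D FO' FA' x c'"
proof -
  have cc: "is_cocone C D FO' FA' y d = is_cocone C D FO FA y d" for y d
    using assms(2-) unfolding is_cocone_def by auto
  have "is_cocone C D FO FA x c' = is_cocone C D FO FA x c"
    using assms(2-) unfolding is_cocone_def by auto
  with assms(1,4) show ?thesis unfolding is_colimit_def cc by auto
qed

end

locale small_cocomplete = inaccessible_cardinal \<kappa> + cat C
  for \<kappa> :: "'k rel" and C :: "('o, 'm) cat" (structure) +
  assumes locally_small: "locally_small \<kappa> C" and cocomplete: "cocomplete \<kappa> C"
begin

lemma small_hom: "small \<kappa> (hom C a b)"
proof (cases "a \<in> Obj C \<and> b \<in> Obj C")
  case True
  then show ?thesis using locally_small unfolding locally_small_def by blast
next
  case False
  then have "hom C a b = {}" using hom_obj by blast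
  then show ?thesis by (simp add: small_finite)
qed

text \<open>The diagram shapes of \<^const>\<open>cocomplete\<close> live on \<^typ>\<open>'k\<close>, so the shape is first
  transported along embeddings into that type.\<close>

lemma functor_colimit:
  assumes D: "small_category \<kappa> D" and F: "is_functor D C FO FA"
  shows "\<exists>x c. is_colimit C D FO FA x c"
proof -
  interpret D: cat D using D by (unfold_locales) (simp add: small_category_def)
  obtain \<phi> :: "_ \<Rightarrow> 'k" where \<phi>: "inj_on \<phi> (Obj D)"
    using D unfolding small_category_def by (metis small_embedding)
  obtain \<psi> :: "_ \<Rightarrow> 'k" where \<psi>: "inj_on \<psi> (Arr D)"
    using D unfolding small_category_def by (metis small_embedding)
  define \<phi>' where "\<phi>' = inv_into (Obj D) \<phi>"
  define \<psi>' where "\<psi>' = inv_into (Arr D) \<psi>"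
  have [simp]: "\<And>a. a \<in> Obj D \<Longrightarrow> \<phi>' (\<phi> a) = a" "\<And>u. u \<in> Arr D \<Longrightarrow> \<psi>' (\<psi> u) = u"
    using \<phi> \<psi> by (auto simp: \<phi>'_def \<psi>'_def)
  define E where "E = \<lparr>Obj = \<phi> ` Obj D, Arr = \<psi> ` Arr D,
    Dom = (\<lambda>k. \<phi> (Dom D (\<psi>' k))), Cod = (\<lambda>k. \<phi> (Cod D (\<psi>' k))),
    Ident = (\<lambda>k. \<psi> (Ident D (\<phi>' k))), Comp = (\<lambda>g f. \<psi> (Comp D (\<psi>' g) (\<psi>' f)))\<rparr>"
  have eq: "\<phi> a = \<phi> b \<longleftrightarrow> a = b" if "a \<in> Obj D" "b \<in> Obj D" for a b
    using \<phi> that by (auto simp: inj_on_def)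
  note Dsimps = E_def eq D.dom_obj D.cod_obj D.comp_arr D.hom_arr[OF D.ident_hom]
    D.hom_dom[OF D.ident_hom] D.hom_cod[OF D.ident_hom]
    D.comp_ident[OF D.arr_hom] D.ident_comp[OF D.arr_hom]
    D.comp_assoc[OF D.arr_hom, OF _ _ D.arr_hom]
  have assoc: "Comp D h (Comp D g f) = Comp D (Comp D h g) f"
    if "f \<in> Arr D" "g \<in> Arr D" "h \<in> Arr D" "Dom D g = Cod D f" "Dom D h = Cod D g" for f g h
    using D.comp_assoc[of h "Cod D g" "Cod D h" g "Cod D f" f "Dom D f"] that by (simp add: D.in_hom_iff)
  have "category E"
    by (rule categoryI) (auto simp: Dsimps assoc)
  moreover have "small \<kappa> (Obj E)" "small \<kappa> (Arr E)"
    using D by (auto simp: E_def small_category_def intro: small_image)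
  moreover have "is_functor E C (\<lambda>k. FO (\<phi>' k)) (\<lambda>k. FA (\<psi>' k))"
    by (rule functorI[OF \<open>category E\<close> category])
      (auto simp: Dsimps functor_obj[OF F] functor_arr[OF F] functor_ident[OF F] functor_comp[OF F])
  ultimately obtain x c where xc: "is_colimit C E (\<lambda>k. FO (\<phi>' k)) (\<lambda>k. FA (\<psi>' k)) x c"
    using cocomplete unfolding cocomplete_def small_category_def by blast
  have cc: "is_cocone C D FO FA y (\<lambda>a. d (\<phi> a)) \<longleftrightarrow> is_cocone C E (\<lambda>k. FO (\<phi>' k)) (\<lambda>k. FA (\<psi>' k)) y d" for y d
    unfolding is_cocone_def E_def by (auto simp: D.dom_obj D.cod_obj)
  have "is_colimit C D FO FA x (\<lambda>a. c (\<phi> a))"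
    unfolding is_colimit_def cc
  proof (intro conjI allI impI)
    show "is_cocone C E (\<lambda>k. FO (\<phi>' k)) (\<lambda>k. FA (\<psi>' k)) x c" by (rule colimit_cocone[OF xc])
    fix y d assume "is_cocone C D FO FA y d"
    then have "is_cocone C D FO FA y (\<lambda>a. d (\<phi>' (\<phi> a)))"
      unfolding is_cocone_def by (auto simp: D.dom_obj D.cod_obj)
    then have "is_cocone C E (\<lambda>k. FO (\<phi>' k)) (\<lambda>k. FA (\<psi>' k)) y (\<lambda>k. d (\<phi>' k))"
      using cc[of y "\<lambda>k. d (\<phi>' k)"] by simp
    then have "\<exists>!h. h \<in> hom C x y \<and> (\<forall>a \<in> Obj E. h \<odot> c a = d (\<phi>' a))"
      using xc unfolding is_colimit_def by blast
    then show "\<exists>!h. h \<in> hom C x y \<and> (\<forall>a\<in>Obj D. h \<odot> c (\<phi> a) = d a)"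
      by (simp add: E_def)
  qed
  then show ?thesis by blast
qed

text \<open>\<^const>\<open>is_colimit\<close> only reads objects, arrows, domains and codomains of the shape, so it makes
  sense for graphs.  A graph is replaced by the bipartite category of its nodes and edges, in which
  no two non-identity arrows are composable.\<close>

lemma graph_colimit:
  assumes D: "small \<kappa> (Obj D)" "small \<kappa> (Arr D)"
      "\<And>u. u \<in> Arr D \<Longrightarrow> Dom D u \<in> Obj D" "\<And>u. u \<in> Arr D \<Longrightarrow> Cod D u \<in> Obj D"
    and FO: "\<And>a. a \<in> Obj D \<Longrightarrow> FO a \<in> Obj C"
    and FA: "\<And>u. u \<in> Arr D \<Longrightarrow> FA u \<in> hom C (FO (Dom D u)) (FO (Cod D u))"
  shows "\<exists>x c. is_colimit C D FO FA x c"
proof -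
  \<comment> \<open>An edge \<open>u\<close> becomes an object \<open>Inr u\<close> with two arrows:
    \<open>(u, False)\<close> to its source, sent to an identity, and \<open>(u, True)\<close> to
    its target, sent to \<open>FA u\<close>. Composable pairs always contain an identity
    \<open>Inl _\<close>, which explains the form of \<open>Comp\<close>.\<close>
  define B where "B = \<lparr>Obj = Obj D <+> Arr D, Arr = (Obj D <+> Arr D) <+> (Arr D \<times> (UNIV :: bool set)),
    Dom = case_sum id (\<lambda>(u, b). Inr u),
    Cod = case_sum id (\<lambda>(u, b). Inl (if b then Cod D u else Dom D u)),
    Ident = Inl, Comp = (\<lambda>g f. case g of Inl _ \<Rightarrow> f | Inr _ \<Rightarrow> g)\<rparr>"
  define GO where "GO = case_sum FO (\<lambda>u. FO (Dom D u))"
  define GA where "GA = case_sum (\<lambda>x. Ident C (GO x))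
    (\<lambda>(u, b). if b then FA u else Ident C (FO (Dom D u)))"
  have "category B"
    by (rule categoryI) (auto simp: B_def D(3,4) split: sum.splits)
  then have "small_category \<kappa> B"
    using small_Plus[OF D(1,2)] small_Times[OF D(2) small_finite[of "UNIV :: bool set"]]
    by (simp add: small_category_def B_def small_Plus)
  moreover have "is_functor B C GO GA"
  proof (rule functorI[OF \<open>category B\<close> category])
    show "GA (Comp B v u) = GA v \<odot> GA u" if "u \<in> Arr B" "v \<in> Arr B" "Dom B v = Cod B u" for u v
      using that D(3,4) FO hom_obj[OF FA]
      by (auto simp: B_def GO_def GA_def comp_ident[OF FA] comp_ident[OF ident_hom] ident_comp[OF ident_hom] ident_comp[OF FA])
  qed (use D(3,4) FO FA in \<open>auto simp: B_def GO_def GA_def\<close>)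
  ultimately obtain x c where xc: "is_colimit C B GO GA x c"
    using functor_colimit by blast
  have cc: "is_cocone C B GO GA y (case_sum d (\<lambda>u. d (Dom D u)))" if "is_cocone C D FO FA y d" for y d
    unfolding is_cocone_def
    using cocone_obj[OF that] cocone_hom[OF that] cocone_compat[OF that] D(3,4)
    by (auto simp: B_def GO_def GA_def comp_ident[OF cocone_hom[OF that]])
  \<comment> \<open>The arrow \<open>(u, False)\<close> is sent to an identity, so a cocone is
    determined at the edge object by its component at the source; compatibility along
    \<open>(u, True)\<close> then is compatibility along the edge.\<close>
  have cInr: "d (Inr u) = d (Inl (Dom D u))" if d: "is_cocone C B GO GA y d" and u: "u \<in> Arr D" for u y d
  proof -
    have "Inr (u, False) \<in> Arr B" "Inl (Dom D u) \<in> Obj B"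
      using u D(3)[OF u] by (auto simp: B_def)
    then show ?thesis
      using cocone_compat[OF d, of "Inr (u, False)"] comp_ident[OF cocone_hom[OF d, of "Inl (Dom D u)"]]
      by (simp add: B_def GO_def GA_def)
  qed
  have cc': "is_cocone C D FO FA y (\<lambda>a. d (Inl a))" if d: "is_cocone C B GO GA y d" for y d
    unfolding is_cocone_def
  proof (intro conjI ballI)
    fix u assume "u \<in> Arr D"
    then show "d (Inl (Cod D u)) \<odot> FA u = d (Inl (Dom D u))"
      using cocone_compat[OF d, of "Inr (u, True)"] cInr[OF d, of u] by (simp add: B_def GA_def InrI)
  next
    fix a assume "a \<in> Obj D"
    then show "d (Inl a) \<in> hom C (FO a) y"
      using cocone_hom[OF d, of "Inl a"] by (simp add: B_def GO_def InlI)
  qed (rule cocone_obj[OF d])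
  have "is_colimit C D FO FA x (\<lambda>a. c (Inl a))"
    unfolding is_colimit_def
  proof (intro conjI allI impI)
    show "is_cocone C D FO FA x (\<lambda>a. c (Inl a))" by (rule cc'[OF colimit_cocone[OF xc]])
    fix y d assume d: "is_cocone C D FO FA y d"
    have "\<exists>!h. h \<in> hom C x y \<and> (\<forall>a \<in> Obj B. h \<odot> c a = case_sum d (\<lambda>u. d (Dom D u)) a)"
      using xc cc[OF d] unfolding is_colimit_def by blast
    moreover have "(\<forall>a \<in> Obj B. h \<odot> c a = case_sum d (\<lambda>u. d (Dom D u)) a) \<longleftrightarrow> (\<forall>a\<in>Obj D. h \<odot> c (Inl a) = d a)" for h
      using cInr[OF colimit_cocone[OF xc]] D(3) by (auto simp: B_def Plus_def ball_Un)
    ultimately show "\<exists>!h. h \<in> hom C x y \<and> (\<forall>a\<in>Obj D. h \<odot> c (Inl a) = d a)" by simp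
  qed
  then show ?thesis by blast
qed

lemma pushout_exists:
  assumes f: "f \<in> hom C a b" and u: "u \<in> hom C a c"
  obtains d g v where "is_pushout C f u g v" "g \<in> hom C c d" "v \<in> hom C b d"
proof -
  \<comment> \<open>The span as a graph: nodes 0, 1, 2 carry \<open>a\<close>, \<open>c\<close>,
    \<open>b\<close>, and the edges \<open>True\<close> and \<open>False\<close> carry
    \<open>u\<close> and \<open>f\<close>.\<close>
  define D :: "(nat, bool) cat" where "D = \<lparr>Obj = {0, 1, 2}, Arr = UNIV, Dom = (\<lambda>_. 0),
    Cod = (\<lambda>k. if k then 1 else 2), Ident = undefined, Comp = undefined\<rparr>"
  define FO where "FO = (\<lambda>n. if n = (0::nat) then a else if n = 1 then c else b)"
  define FA where "FA = (\<lambda>k. if k then u else f)"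
  have "\<exists>x l. is_colimit C D FO FA x l"
    by (rule graph_colimit) (use f u hom_obj[OF f] hom_obj[OF u] in
      \<open>auto simp: D_def FO_def FA_def intro: small_finite\<close>)
  then obtain x l where xl: "is_colimit C D FO FA x l" by blast
  have g: "l 1 \<in> hom C c x" and v: "l 2 \<in> hom C b x"
    using colimit_hom[OF xl, of 1] colimit_hom[OF xl, of 2] by (auto simp: D_def FO_def)
  have l0: "l 1 \<odot> u = l 0" "l 2 \<odot> f = l 0"
    using colimit_compat[OF xl, of True] colimit_compat[OF xl, of False] by (auto simp: D_def FA_def)
  have "is_pushout C f u (l 1) (l 2)"
    unfolding is_pushout_def hom_cod[OF f] hom_cod[OF u] hom_cod[OF g]
  proof (intro conjI allI ballI impI)
    fix y p q assume p: "p \<in> hom C c y" and q: "q \<in> hom C b y" and eq: "p \<odot> u = q \<odot> f"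
    define d where "d = (\<lambda>n. if n = (0::nat) then p \<odot> u else if n = 1 then p else q)"
    have "is_cocone C D FO FA y d"
      using p q u f eq hom_obj[OF p] by (auto simp: is_cocone_def D_def FO_def FA_def d_def)
    then have "\<exists>!h. h \<in> hom C x y \<and> (\<forall>n\<in>Obj D. h \<odot> l n = d n)"
      using xl unfolding is_colimit_def by blast
    moreover have "(\<forall>n\<in>Obj D. h \<odot> l n = d n) \<longleftrightarrow> h \<odot> l 1 = p \<and> h \<odot> l 2 = q" if "h \<in> hom C x y" for h
      using comp_assoc[OF that g u] l0 by (auto simp: D_def d_def)
    ultimately show "\<exists>!h. h \<in> hom C x y \<and> h \<odot> l 1 = p \<and> h \<odot> l 2 = q" by metis
  qed (use f u g v l0 in \<open>auto simp: in_hom_iff\<close>)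
  with g v show ?thesis using that by blast
qed

end

section \<open>Limits obtained from weakly terminal cones\<close>

context cat
begin

lemma cone_obj: "is_cone C D FO FA x c \<Longrightarrow> x \<in> Obj C"
  and cone_hom: "is_cone C D FO FA x c \<Longrightarrow> a \<in> Obj D \<Longrightarrow> c a \<in> hom C x (FO a)"
  and cone_compat: "is_cone C D FO FA x c \<Longrightarrow> u \<in> Arr D \<Longrightarrow> FA u \<odot> c (Dom D u) = c (Cod D u)"
  by (auto simp: is_cone_def)

lemma cone_comp:
  assumes c: "is_cone C D FO FA x c" "h \<in> hom C y x" and F: "is_functor D C FO FA"
  shows "is_cone C D FO FA y (\<lambda>a. c a \<odot> h)"
  unfolding is_cone_def
proof (intro conjI ballI)
  interpret D: cat D using F by (unfold_locales) (simp add: is_functor_def)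
  fix u assume u: "u \<in> Arr D"
  show "FA u \<odot> c (Dom D u) \<odot> h = c (Cod D u) \<odot> h"
    using comp_assoc[OF functor_arr[OF F u] cone_hom[OF c(1)] c(2)] D.dom_obj[OF u] cone_compat[OF c(1) u] by simp
qed (use c cone_hom[OF c(1)] hom_obj in auto)

text \<open>Colimits of cones are formed on the apexes. For a fixed \<open>a\<close> the legs
  \<open>d n a\<close> form a cocone in \<open>n\<close> and induce \<open>e a\<close>; the cone
  equations for \<open>e\<close> hold because they hold after composition with every
  \<open>c n\<close>.\<close>

lemma cone_factor_colimit:
  assumes G: "is_colimit C G GO GA x c"
    and GD: "\<And>u. u \<in> Arr G \<Longrightarrow> Dom G u \<in> Obj G \<and> Cod G u \<in> Obj G"
    and GA: "\<And>u. u \<in> Arr G \<Longrightarrow> GA u \<in> hom C (GO (Dom G u)) (GO (Cod G u))"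
    and F: "is_functor D C FO FA"
    and d: "\<And>n. n \<in> Obj G \<Longrightarrow> is_cone C D FO FA (GO n) (d n)"
    and dG: "\<And>u a. u \<in> Arr G \<Longrightarrow> a \<in> Obj D \<Longrightarrow> d (Cod G u) a \<odot> GA u = d (Dom G u) a"
  obtains e where "is_cone C D FO FA x e" "\<And>n a. n \<in> Obj G \<Longrightarrow> a \<in> Obj D \<Longrightarrow> e a \<odot> c n = d n a"
proof -
  interpret D: cat D using F by (unfold_locales) (simp add: is_functor_def)
  have "\<exists>h. h \<in> hom C x (FO a) \<and> (\<forall>n\<in>Obj G. h \<odot> c n = d n a)" if a: "a \<in> Obj D" for a
  proof -
    have "is_cocone C G GO GA (FO a) (\<lambda>n. d n a)"
      using functor_obj[OF F a] cone_hom[OF d, OF _ a] dG[OF _ a] by (auto simp: is_cocone_def)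
    from colimit_factor[OF G this] show ?thesis by auto
  qed
  then obtain e where e: "\<And>a. a \<in> Obj D \<Longrightarrow> e a \<in> hom C x (FO a)"
      "\<And>a n. a \<in> Obj D \<Longrightarrow> n \<in> Obj G \<Longrightarrow> e a \<odot> c n = d n a" by metis
  have "is_cone C D FO FA x e"
    unfolding is_cone_def
  proof (intro conjI ballI)
    fix u assume u: "u \<in> Arr D"
    note u' = D.dom_obj[OF u] D.cod_obj[OF u]
    show "FA u \<odot> e (Dom D u) = e (Cod D u)"
    proof (rule colimit_eqI[OF G GD GA])
      show "FA u \<odot> e (Dom D u) \<in> hom C x (FO (Cod D u))" "e (Cod D u) \<in> hom C x (FO (Cod D u))"
        using e(1)[OF u'(1)] e(1)[OF u'(2)] functor_arr[OF F u] by auto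
      fix n assume n: "n \<in> Obj G"
      show "(FA u \<odot> e (Dom D u)) \<odot> c n = e (Cod D u) \<odot> c n"
        using comp_assoc[OF functor_arr[OF F u] e(1)[OF u'(1)] colimit_hom[OF G n]] e(2)[OF u'(1) n]
          e(2)[OF u'(2) n] cone_compat[OF d[OF n] u] by simp
    qed
  qed (use e(1) colimit_obj[OF G] in auto)
  with e(2) that show ?thesis by blast
qed

end

context small_cocomplete
begin

text \<open>An object carrying a weakly terminal cone becomes terminal among cones after coequalizing all
  its endomorphisms of cones: if \<open>w\<close> coequalizes two maps \<open>f\<close>, \<open>g\<close> into the quotient \<open>q\<close>, then a
  cone map \<open>s\<close> from the codomain of \<open>w\<close> back to the weakly terminal cone makes \<open>w\<close> split monic,
  because \<open>q\<close> coequalizes \<open>s w q\<close> with the identity.\<close>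

lemma limit_of_weakly_terminal_cone:
  assumes F: "is_functor D C FO FA" and l: "is_cone C D FO FA l \<pi>"
    and weak: "\<And>y e. is_cone C D FO FA y e \<Longrightarrow> \<exists>h \<in> hom C y l. \<forall>a\<in>Obj D. \<pi> a \<odot> h = e a"
  shows "\<exists>x c. is_limit C D FO FA x c"
proof -
  define H where "H = {h \<in> hom C l l. \<forall>a\<in>Obj D. \<pi> a \<odot> h = \<pi> a}"
  have lO: "l \<in> Obj C" by (rule cone_obj[OF l])
  have idH: "Ident C l \<in> H"
    using lO comp_ident[OF cone_hom[OF l]] by (auto simp: H_def)
  \<comment> \<open>Two nodes, both carrying \<open>l\<close>, with one edge for each member of
    \<open>H\<close>: the colimit is the joint coequalizer. Since the identity is among the edges,
    both legs equal \<open>q\<close>, and \<open>q\<close> absorbs every member of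
    \<open>H\<close>.\<close>
  define G where "G = \<lparr>Obj = UNIV, Arr = H, Dom = (\<lambda>_. False), Cod = (\<lambda>_. True),
    Ident = undefined, Comp = undefined\<rparr>"
  have GA: "\<And>u. u \<in> Arr G \<Longrightarrow> id u \<in> hom C l l" by (auto simp: G_def H_def)
  have "\<exists>x c. is_colimit C G (\<lambda>_. l) id x c"
    by (rule graph_colimit) (auto simp: G_def H_def lO small_finite intro: small_mono[OF small_hom[of l l]])
  then obtain x c where xc: "is_colimit C G (\<lambda>_. l) id x c" by blast
  define q where "q = c True"
  have q: "q \<in> hom C l x" using colimit_hom[OF xc, of True] by (simp add: q_def G_def)
  have c_eq: "c b = q" for b
    using colimit_compat[OF xc, of "Ident C l"] idH comp_ident[OF q]
    by (cases b) (auto simp: q_def G_def)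
  have qH: "q \<odot> h = q" if "h \<in> H" for h
    using colimit_compat[OF xc, of h] that by (auto simp: G_def c_eq)
  have q_epi: "h = k" if "h \<in> hom C x y" "k \<in> hom C x y" "h \<odot> q = k \<odot> q" for h k y
    by (rule colimit_eqI[OF xc]) (use that GA in \<open>auto simp: G_def c_eq\<close>)
  obtain \<tau> where \<tau>: "is_cone C D FO FA x \<tau>" and \<tau>q: "\<And>a. a \<in> Obj D \<Longrightarrow> \<tau> a \<odot> q = \<pi> a"
    by (rule cone_factor_colimit[OF xc _ _ F, of "\<lambda>_. \<pi>"])
      (use l GA in \<open>auto simp: G_def H_def c_eq\<close>)
  have "is_limit C D FO FA x \<tau>"
    unfolding is_limit_def
  proof (intro conjI allI impI)
    fix y e assume e: "is_cone C D FO FA y e"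
    obtain h where h: "h \<in> hom C y l" "\<And>a. a \<in> Obj D \<Longrightarrow> \<pi> a \<odot> h = e a"
      using weak[OF e] by blast
    show "\<exists>!h. h \<in> hom C y x \<and> (\<forall>a\<in>Obj D. \<tau> a \<odot> h = e a)"
    proof (rule ex1I)
      show "q \<odot> h \<in> hom C y x \<and> (\<forall>a\<in>Obj D. \<tau> a \<odot> q \<odot> h = e a)"
        using q h comp_assoc[OF cone_hom[OF \<tau>] q h(1)] \<tau>q by auto
    next
      fix k assume "k \<in> hom C y x \<and> (\<forall>a\<in>Obj D. \<tau> a \<odot> k = e a)"
      then have k: "k \<in> hom C y x" "\<And>a. a \<in> Obj D \<Longrightarrow> \<tau> a \<odot> k = e a" by auto
      define g where "g = q \<odot> h"
      have g: "g \<in> hom C y x" "\<And>a. a \<in> Obj D \<Longrightarrow> \<tau> a \<odot> g = e a"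
        using q h comp_assoc[OF cone_hom[OF \<tau>] q h(1)] \<tau>q by (auto simp: g_def)
      \<comment> \<open>The coequalizer of two competing factorizations \<open>k\<close> and
        \<open>g\<close>. Both have the same composites with \<open>\<tau>\<close>, so its codomain
        again carries a cone.\<close>
      define E where "E = \<lparr>Obj = UNIV, Arr = {k, g}, Dom = (\<lambda>_. False), Cod = (\<lambda>_. True),
        Ident = undefined, Comp = undefined\<rparr>"
      define EO where "EO = (\<lambda>b. if b then x else y)"
      have EA: "\<And>u. u \<in> Arr E \<Longrightarrow> id u \<in> hom C (EO (Dom E u)) (EO (Cod E u))"
        using k g by (auto simp: E_def EO_def)
      have "\<exists>z w. is_colimit C E EO id z w"
        by (rule graph_colimit[OF _ _ _ _ _ EA])
          (use hom_obj[OF g(1)] in \<open>auto simp: E_def EO_def small_finite\<close>)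
      then obtain z w' where zw: "is_colimit C E EO id z w'" by blast
      define w where "w = w' True"
      have w: "w \<in> hom C x z" using colimit_hom[OF zw, of True] by (simp add: w_def E_def EO_def)
      have wkg: "w \<odot> k = w \<odot> g"
        using colimit_compat[OF zw, of k] colimit_compat[OF zw, of g] by (simp add: E_def w_def)
      obtain \<sigma> where \<sigma>: "is_cone C D FO FA z \<sigma>" and \<sigma>w: "\<And>b a. a \<in> Obj D \<Longrightarrow> \<sigma> a \<odot> w' b = (if b then \<tau> a else e a)"
        by (rule cone_factor_colimit[OF zw _ EA F, of "\<lambda>b. if b then \<tau> else e"])
          (use \<tau> e k g in \<open>auto simp: E_def EO_def if_distrib[of "\<lambda>f. f _"]\<close>)
      obtain s where s: "s \<in> hom C z l" "\<And>a. a \<in> Obj D \<Longrightarrow> \<pi> a \<odot> s = \<sigma> a"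
        using weak[OF \<sigma>] by blast
      have "s \<odot> w \<odot> q \<in> H"
        unfolding H_def
      proof safe
        show "s \<odot> w \<odot> q \<in> hom C l l" using s w q by blast
        fix a assume a: "a \<in> Obj D"
        have "\<pi> a \<odot> s \<odot> w \<odot> q = \<sigma> a \<odot> w \<odot> q"
          using comp_assoc[OF cone_hom[OF l a] s(1) comp_hom[OF w q]] s(2)[OF a] by simp
        also have "\<dots> = \<pi> a"
          using comp_assoc[OF cone_hom[OF \<sigma> a] w q] \<sigma>w[OF a, of True] \<tau>q[OF a] by (simp add: w_def)
        finally show "\<pi> a \<odot> s \<odot> w \<odot> q = \<pi> a" .
      qed
      then have "q \<odot> s \<odot> w \<odot> q = q" by (rule qH)
      then have "(q \<odot> s \<odot> w) \<odot> q = Ident C x \<odot> q"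
        using comp_assoc[OF q comp_hom[OF s(1) w] q] comp_assoc[OF s(1) w q] ident_comp[OF q] by simp
      then have qsw: "q \<odot> s \<odot> w = Ident C x"
        by (rule q_epi[OF comp_hom[OF q comp_hom[OF s(1) w]] ident_hom[OF hom_obj(1)[OF w]]])
      have "k = (q \<odot> s \<odot> w) \<odot> k" unfolding qsw using k by simp
      also have "\<dots> = q \<odot> s \<odot> w \<odot> g"
        using comp_assoc[OF q comp_hom[OF s(1) w] k(1)] comp_assoc[OF s(1) w k(1)] wkg by simp
      also have "\<dots> = (q \<odot> s \<odot> w) \<odot> g"
        using comp_assoc[OF q comp_hom[OF s(1) w] g(1)] comp_assoc[OF s(1) w g(1)] by simp
      also have "\<dots> = g" unfolding qsw using g by simp
      finally show "k = q \<odot> h" by (simp add: g_def)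
    qed
  qed (rule \<tau>)
  then show ?thesis by blast
qed

text \<open>Weak terminality comes from density. The apex of a cone is a colimit of objects of
  \<open>A\<close>; restricting the cone to each of them gives nodes of the graph \<open>G\<close>,
  and the corresponding legs \<open>\<iota>\<close> assemble to a map from the apex to
  \<open>l\<close>.\<close>

lemma complete_of_colimit_dense:
  assumes A: "small \<kappa> A" "A \<subseteq> Obj C"
    and dense: "\<And>x. x \<in> Obj C \<Longrightarrow> \<exists>(r :: 'k rel) FO FA c. category (poset_cat r) \<and>
      is_functor (poset_cat r) C FO FA \<and> (\<forall>a \<in> Field r. FO a \<in> A) \<and> is_colimit C (poset_cat r) FO FA x c"
  shows "complete \<kappa> C"
  unfolding complete_def
proof (intro allI impI, elim conjE)
  fix D :: "('k, 'k) cat" and FO FA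
  assume D: "small_category \<kappa> D" and F: "is_functor D C FO FA"
  interpret D: cat D using F by (unfold_locales) (simp add: is_functor_def)
  \<comment> \<open>Legs are normalized outside \<open>Obj D\<close>; otherwise the arbitrary values
    there would be counted as different cones.\<close>
  define N where "N = {(a, d). a \<in> A \<and> is_cone C D FO FA a d \<and> (\<forall>i. i \<notin> Obj D \<longrightarrow> d i = undefined)}"
  \<comment> \<open>An edge records its endpoints, since one morphism of \<open>C\<close> may be a
    map between many pairs of cones.\<close>
  define E where "E = {(n, n', m). n \<in> N \<and> n' \<in> N \<and> m \<in> hom C (fst n) (fst n') \<and> (\<forall>i\<in>Obj D. snd n' i \<odot> m = snd n i)}"
  define G where "G = \<lparr>Obj = N, Arr = E, Dom = fst, Cod = fst \<circ> snd, Ident = undefined, Comp = undefined\<rparr>"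
  have smN: "small \<kappa> N"
  proof (rule small_mono)
    let ?B = "\<lambda>a. \<Union>i\<in>Obj D. hom C a (FO i)"
    show "small \<kappa> (SIGMA a : A. {d. (\<forall>i\<in>Obj D. d i \<in> ?B a) \<and> (\<forall>i. i \<notin> Obj D \<longrightarrow> d i = undefined)})"
      using D by (intro small_Sigma A small_funs small_UN small_hom) (auto simp: small_category_def)
    show "N \<subseteq> (SIGMA a : A. {d. (\<forall>i\<in>Obj D. d i \<in> ?B a) \<and> (\<forall>i. i \<notin> Obj D \<longrightarrow> d i = undefined)})"
      by (auto simp: N_def is_cone_def)
  qed
  have smE: "small \<kappa> E"
  proof (rule small_mono)
    show "small \<kappa> (SIGMA n : N. SIGMA n' : N. hom C (fst n) (fst n'))"
      by (intro small_Sigma smN small_hom)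
  qed (auto simp: E_def)
  have GD: "\<And>u. u \<in> Arr G \<Longrightarrow> Dom G u \<in> Obj G \<and> Cod G u \<in> Obj G"
    and GA: "\<And>u. u \<in> Arr G \<Longrightarrow> (snd \<circ> snd) u \<in> hom C (fst (Dom G u)) (fst (Cod G u))"
    by (auto simp: G_def E_def)
  have "\<exists>x c. is_colimit C G fst (snd \<circ> snd) x c"
    by (rule graph_colimit[OF _ _ _ _ _ GA]) (use smN smE A GD in \<open>auto simp: G_def N_def E_def\<close>)
  then obtain l \<iota> where l: "is_colimit C G fst (snd \<circ> snd) l \<iota>" by blast
  obtain \<pi> where \<pi>: "is_cone C D FO FA l \<pi>" and \<pi>\<iota>: "\<And>n a. n \<in> N \<Longrightarrow> a \<in> Obj D \<Longrightarrow> \<pi> a \<odot> \<iota> n = snd n a"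
    by (rule cone_factor_colimit[OF l GD GA F, of snd]) (auto simp: G_def N_def E_def)
  show "\<exists>x c. is_limit C D FO FA x c"
  proof (rule limit_of_weakly_terminal_cone[OF F \<pi>])
    fix y e assume e: "is_cone C D FO FA y e"
    obtain r :: "'k rel" and YO YA c where r: "category (poset_cat r)" and Y: "is_functor (poset_cat r) C YO YA"
      and YA: "\<And>a. a \<in> Field r \<Longrightarrow> YO a \<in> A" and c: "is_colimit C (poset_cat r) YO YA y c"
      using dense[OF cone_obj[OF e]] by blast
    \<comment> \<open>The restriction of the cone \<open>e\<close> along the leg \<open>c s\<close>,
      normalized so as to be a node of \<open>G\<close>.\<close>
    define \<nu> where "\<nu> = (\<lambda>s. (YO s, \<lambda>i. if i \<in> Obj D then e i \<odot> c s else undefined))"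
    have cs: "c s \<in> hom C (YO s) y" if "s \<in> Field r" for s
      using colimit_hom[OF c, of s] that by (simp add: poset_cat_def)
    have YAh: "YA u \<in> hom C (YO (fst u)) (YO (snd u))" "c (snd u) \<odot> YA u = c (fst u)"
      "fst u \<in> Field r" "snd u \<in> Field r" if "u \<in> r" for u
      using that functor_arr[OF Y, of u] colimit_compat[OF c, of u]
      by (auto simp: poset_cat_def Field_def intro: Domain.DomainI[of "fst u" "snd u"] Range.RangeI[of "fst u" "snd u"])
    have \<nu>N: "\<nu> s \<in> N" if s: "s \<in> Field r" for s
      using cone_comp[OF e cs[OF s] F] YA[OF s] by (simp add: N_def \<nu>_def is_cone_def D.dom_obj D.cod_obj)
    have \<nu>E: "(\<nu> (fst u), \<nu> (snd u), YA u) \<in> E" if u: "u \<in> r" for u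
      using YAh[OF u] \<nu>N comp_assoc[OF cone_hom[OF e] cs YAh(1)[OF u]]
      by (auto simp: E_def \<nu>_def)
    have "is_cocone C (poset_cat r) YO YA l (\<lambda>s. \<iota> (\<nu> s))"
      unfolding is_cocone_def
    proof (intro conjI ballI)
      fix s assume "s \<in> Obj (poset_cat r)"
      then show "\<iota> (\<nu> s) \<in> hom C (YO s) l"
        using colimit_hom[OF l, of "\<nu> s"] \<nu>N[of s] by (simp add: poset_cat_def G_def \<nu>_def)
    next
      fix u assume "u \<in> Arr (poset_cat r)"
      then show "\<iota> (\<nu> (Cod (poset_cat r) u)) \<odot> YA u = \<iota> (\<nu> (Dom (poset_cat r) u))"
        using colimit_compat[OF l, of "(\<nu> (fst u), \<nu> (snd u), YA u)"] \<nu>E[of u] by (simp add: poset_cat_def G_def)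
    qed (rule colimit_obj[OF l])
    then obtain h where h: "h \<in> hom C y l" "\<And>s. s \<in> Obj (poset_cat r) \<Longrightarrow> h \<odot> c s = \<iota> (\<nu> s)"
      using colimit_factor[OF c] by blast
    have "\<pi> a \<odot> h = e a" if a: "a \<in> Obj D" for a
    proof (rule colimit_eqI[OF c])
      fix s assume s: "s \<in> Obj (poset_cat r)"
      then have s': "s \<in> Field r" by (simp add: poset_cat_def)
      show "(\<pi> a \<odot> h) \<odot> c s = e a \<odot> c s"
        using comp_assoc[OF cone_hom[OF \<pi> a] h(1) cs[OF s']] h(2)[OF s] \<pi>\<iota>[OF \<nu>N[OF s'] a] a by (simp add: \<nu>_def)
    qed (use YAh h cone_hom[OF \<pi> a] cone_hom[OF e a] in \<open>auto simp: poset_cat_def\<close>)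
    with h(1) show "\<exists>h\<in>hom C y l. \<forall>a\<in>Obj D. \<pi> a \<odot> h = e a" by blast
  qed
qed

end

section \<open>Cellular morphisms\<close>

lemma poset_cat_simps [simp]:
  "Obj (poset_cat r) = Field r" "Arr (poset_cat r) = r" "Dom (poset_cat r) = fst" "Cod (poset_cat r) = snd"
  "Ident (poset_cat r) a = (a, a)" "Comp (poset_cat r) v u = (fst u, snd v)"
  by (simp_all add: poset_cat_def)

lemma category_poset_cat:
  assumes "Partial_order r"
  shows "category (poset_cat r)"
proof -
  have "refl_on (Field r) r" "trans r"
    using assms by (auto simp: partial_order_on_def preorder_on_def)
  then show ?thesis
    by (intro categoryI) (auto simp: Field_def refl_on_def dest: transD)
qed

lemma Field_Restr_underS: "Well_order r \<Longrightarrow> Field (Restr r (underS r a)) = underS r a"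
  by (rule Refl_Field_Restr2) (auto simp: order_on_defs underS_Field)

lemma Well_order_facts:
  assumes "Well_order r"
  shows "a \<in> Field r \<Longrightarrow> (a, a) \<in> r" "(a, b) \<in> r \<Longrightarrow> (b, c) \<in> r \<Longrightarrow> (a, c) \<in> r"
    "(a, b) \<in> r \<Longrightarrow> (b, a) \<in> r \<Longrightarrow> a = b"
    "a \<in> Field r \<Longrightarrow> b \<in> Field r \<Longrightarrow> (a, b) \<in> r \<or> (b, a) \<in> r"
    "(a, b) \<in> r \<Longrightarrow> a \<in> Field r" "(a, b) \<in> r \<Longrightarrow> b \<in> Field r"
    "wf (r - Id)"
proof -
  have wo: "wo_rel r" using assms by (simp add: wo_rel_def)
  show "a \<in> Field r \<Longrightarrow> (a, a) \<in> r" using wo_rel.REFL[OF wo] by (auto simp: refl_on_def)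
  show "(a, b) \<in> r \<Longrightarrow> (b, c) \<in> r \<Longrightarrow> (a, c) \<in> r" using wo_rel.TRANS[OF wo] by (auto dest: transD)
  show "(a, b) \<in> r \<Longrightarrow> (b, a) \<in> r \<Longrightarrow> a = b" using wo_rel.ANTISYM[OF wo] by (auto dest: antisymD)
  show "a \<in> Field r \<Longrightarrow> b \<in> Field r \<Longrightarrow> (a, b) \<in> r \<or> (b, a) \<in> r" using wo_rel.TOTALS[OF wo] by auto
  show "(a, b) \<in> r \<Longrightarrow> a \<in> Field r" "(a, b) \<in> r \<Longrightarrow> b \<in> Field r" by (auto simp: Field_def)
  show "wf (r - Id)" by (rule wo_rel.WF[OF wo])
qed

context cat
begin

lemma
  assumes "is_functor (poset_cat r) C FO FA"
  shows chain_hom: "(a, b) \<in> r \<Longrightarrow> FA (a, b) \<in> hom C (FO a) (FO b)"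
    and chain_comp: "(a, b) \<in> r \<Longrightarrow> (b, c) \<in> r \<Longrightarrow> FA (b, c) \<odot> FA (a, b) = FA (a, c)"
  using functor_arr[OF assms, of "(a, b)"] functor_comp[OF assms, of "(a, b)" "(b, c)"] by auto

text \<open>A lift on the colimit is a compatible family of partial lifts \<open>h a\<close> on the
  stages, chosen by well-founded recursion: \<open>u\<close> at the least stage, a lift against a
  member of \<open>K\<close> at a successor, the induced map at a limit element.\<close>

lemma lifts_transfinite_composition:
  fixes \<kappa> :: "'k rel"
  assumes t: "t \<in> transfinite_compositions \<kappa> C K" and K: "\<And>k. k \<in> K \<Longrightarrow> lifts C k p" and p: "p \<in> Arr C"
  shows "t \<in> Arr C \<and> lifts C t p"
proof -
  obtain r :: "'k rel" and z FO FA x c where r: "Well_order r" and z: "z \<in> Field r" "\<And>a. a \<in> Field r \<Longrightarrow> (z, a) \<in> r"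
    and F: "is_functor (poset_cat r) C FO FA"
    and succ: "\<And>a b. immediate_succ r a b \<Longrightarrow> FA (a, b) \<in> K"
    and lim: "\<And>b. limit_element r b \<Longrightarrow>
      is_colimit C (poset_cat (Restr r (underS r b))) FO FA (FO b) (\<lambda>a. FA (a, b))"
    and c: "is_colimit C (poset_cat r) FO FA x c" and tz: "t = c z"
    using t unfolding transfinite_compositions_def mem_Collect_eq
    by (elim exE conjE) (rule that, auto)
  note wo = Well_order_facts[OF r]
  have ch: "c a \<in> hom C (FO a) x" if "a \<in> Field r" for a
    using colimit_hom[OF c] that by simp
  have cc: "c b \<odot> FA (a, b) = c a" if "(a, b) \<in> r" for a b
    using colimit_compat[OF c, of "(a, b)"] that by simp
  have FA: "FA u \<in> hom C (FO (fst u)) (FO (snd u))" if "u \<in> r" for u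
    using chain_hom[OF F, of "fst u" "snd u"] that by simp
  have t: "t \<in> hom C (FO z) x" using ch[OF z(1)] tz by simp
  let ?P = "Dom C p" and ?Q = "Cod C p"
  have p: "p \<in> hom C ?P ?Q" using arr_hom[OF p] .
  have "lifts C t p"
    unfolding lifts_hom[OF t p]
  proof (intro ballI impI)
    fix u v assume u: "u \<in> hom C (FO z) ?P" and v: "v \<in> hom C x ?Q" and sq: "p \<odot> u = v \<odot> t"
    \<comment> \<open>A candidate \<open>y\<close> at stage \<open>a\<close> refers to
      \<open>h\<close> only at strictly earlier stages, as dependent well-founded choice
      demands.\<close>
    define G where "G = (\<lambda>h a y. a \<in> Field r \<longrightarrow> y \<in> hom C (FO a) ?P \<and> p \<odot> y = v \<odot> c a \<and>
      (\<forall>b\<in>underS r a. y \<odot> FA (b, a) = h b) \<and> (a = z \<longrightarrow> y = u))"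
    have "\<exists>h. \<forall>a. G h a (h a)"
    proof (rule dependent_wf_choice[OF wo(7)])
      show "G f a y = G g a y" if "\<And>b. (b, a) \<in> r - Id \<Longrightarrow> f b = g b" for f g a y
        using that by (simp add: G_def underS_def)
    next
      fix a h assume IH: "\<And>b. (b, a) \<in> r - Id \<Longrightarrow> G h b (h b)"
      have h: "h b \<in> hom C (FO b) ?P" "p \<odot> h b = v \<odot> c b" "\<And>d. d \<in> underS r b \<Longrightarrow> h b \<odot> FA (d, b) = h d"
        "(b, a) \<in> r" "b \<noteq> a" "b \<in> Field r"
        if "b \<in> underS r a" for b
        using IH[of b] that wo(5)[of b a] by (auto simp: G_def underS_def)
      consider "a \<notin> Field r" | "a = z" | b where "a \<in> Field r" "a \<noteq> z" "immediate_succ r b a" | "a \<in> Field r" "a \<noteq> z" "limit_element r a"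
      proof (cases "a \<in> Field r \<and> a \<noteq> z")
        case True
        then have "z \<in> underS r a" using z by (auto simp: underS_def)
        then have "underS r a \<noteq> {}" by blast
        with True that(3,4) show ?thesis unfolding limit_element_def by blast
      qed (use that in blast)
      then show "\<exists>y. G h a y"
      proof cases
        case 1 then show ?thesis by (simp add: G_def)
      next
        case 2
        have "underS r z = {}"
          using wo(3,5) z by (auto simp: underS_def)
        then show ?thesis using 2 u sq tz by (auto simp: G_def)
      next
        case (3 b)
        have b: "b \<in> underS r a" using 3 by (simp add: immediate_succ_def)
        note hb = h[OF b]
        have "p \<odot> h b = (v \<odot> c a) \<odot> FA (b, a)"
          using hb(2) comp_assoc[OF v ch[OF 3(1)] chain_hom[OF F hb(4)]] cc[OF hb(4)] by simp
        then obtain y where y: "y \<in> hom C (FO a) ?P" "y \<odot> FA (b, a) = h b" "p \<odot> y = v \<odot> c a"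
          using liftsE[OF K[OF succ[OF 3(3)]] chain_hom[OF F hb(4)] p hb(1) comp_hom[OF v ch[OF 3(1)]]] by blast
        \<comment> \<open>Every earlier stage lies weakly below the predecessor \<open>b\<close>, so
          compatibility with \<open>b\<close> entails compatibility with all of them.\<close>
        have "y \<odot> FA (d, a) = h d" if d: "d \<in> underS r a" for d
        proof (cases "d = b")
          case False
          have db: "(d, b) \<in> r" using d 3(3) by (simp add: immediate_succ_def)
          have "y \<odot> FA (d, a) = h b \<odot> FA (d, b)"
            using comp_assoc[OF y(1) chain_hom[OF F hb(4)] chain_hom[OF F db]] chain_comp[OF F db hb(4)] y(2) by simp
          then show ?thesis using hb(3)[of d] db False by (simp add: underS_def)
        qed (simp add: y)
        then show ?thesis using y 3 by (auto simp: G_def)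
      next
        case 4
        note L = lim[OF 4(3)]
        have "is_cocone C (poset_cat (Restr r (underS r a))) FO FA ?P h"
          unfolding is_cocone_def
        proof (intro conjI ballI)
          fix u assume "u \<in> Arr (poset_cat (Restr r (underS r a)))"
          then have u: "(fst u, snd u) \<in> r" "fst u \<in> underS r a" "snd u \<in> underS r a" by auto
          have "h (snd u) \<odot> FA (fst u, snd u) = h (fst u)"
          proof (cases "fst u = snd u")
            case True
            then show ?thesis
              using functor_ident[OF F, of "snd u"] comp_ident[OF h(1)[OF u(3)]] h(6)[OF u(3)] by simp
          qed (use u h(3)[OF u(3), of "fst u"] in \<open>auto simp: underS_def\<close>)
          then show "h (Cod (poset_cat (Restr r (underS r a))) u) \<odot> FA u = h (Dom (poset_cat (Restr r (underS r a))) u)"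
            by simp
        qed (use h(1) hom_obj[OF p] Field_Restr_underS[OF r, of a] in auto)
        from colimit_factor[OF L this] obtain y
          where y: "y \<in> hom C (FO a) ?P" "\<And>b. b \<in> underS r a \<Longrightarrow> y \<odot> FA (b, a) = h b"
          using Field_Restr_underS[OF r, of a] by auto
        \<comment> \<open>Two maps out of a limit stage agree as soon as they agree on the earlier
          stages.\<close>
        have "p \<odot> y = v \<odot> c a"
        proof (rule colimit_eqI[OF L])
          show "p \<odot> y \<in> hom C (FO a) ?Q" "v \<odot> c a \<in> hom C (FO a) ?Q"
            using p y v ch[OF 4(1)] by auto
          fix b assume "b \<in> Obj (poset_cat (Restr r (underS r a)))"
          then have b: "b \<in> underS r a" using Field_Restr_underS[OF r, of a] by simp
          show "(p \<odot> y) \<odot> FA (b, a) = (v \<odot> c a) \<odot> FA (b, a)"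
            using comp_assoc[OF v ch[OF 4(1)] chain_hom[OF F h(4)[OF b]]] comp_assoc[OF p y(1) chain_hom[OF F h(4)[OF b]]]
              cc[OF h(4)[OF b]] y(2)[OF b] h(2)[OF b] by simp
        qed (use FA Field_Restr_underS[OF r, of a] in auto)
        then show ?thesis using y 4 by (auto simp: G_def)
      qed
    qed
    then obtain h where "\<And>a. G h a (h a)" by blast
    then have h: "h a \<in> hom C (FO a) ?P" "p \<odot> h a = v \<odot> c a" "\<And>b. b \<in> underS r a \<Longrightarrow> h a \<odot> FA (b, a) = h b" "a = z \<Longrightarrow> h a = u"
      if "a \<in> Field r" for a using that by (auto simp: G_def)
    have hFA: "h a \<odot> FA (b, a) = h b" if "(b, a) \<in> r" for a b
    proof (cases "a = b")
      case True
      then show ?thesis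
        using functor_ident[OF F, of a] wo(6)[OF that] comp_ident[OF h(1)] by simp
    qed (use that h(3)[OF wo(6)[OF that]] in \<open>auto simp: underS_def\<close>)
    have "is_cocone C (poset_cat r) FO FA ?P h"
      unfolding is_cocone_def using h(1) hom_obj[OF p] hFA by auto
    from colimit_factor[OF c this] obtain k
      where k: "k \<in> hom C x ?P" "\<And>a. a \<in> Field r \<Longrightarrow> k \<odot> c a = h a"
      by auto
    have "p \<odot> k = v"
    proof (rule colimit_eqI[OF c])
      fix a assume "a \<in> Obj (poset_cat r)"
      then have a: "a \<in> Field r" by simp
      show "(p \<odot> k) \<odot> c a = v \<odot> c a"
        using comp_assoc[OF p k(1) ch[OF a]] k(2)[OF a] h(2)[OF a] by simp
    qed (use FA p k v wo(5,6) in auto)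
    then show "\<exists>h\<in>hom C x ?P. h \<odot> t = u \<and> p \<odot> h = v"
      using k z(1) h(4) tz by auto
  qed
  with t show ?thesis by (simp add: in_hom_iff)
qed

lemma cell_subset_llp_rlp: "cell \<kappa> C K \<subseteq> llp C (rlp C K)"
proof
  fix f assume "f \<in> cell \<kappa> C K"
  then obtain g where g: "g \<in> transfinite_compositions \<kappa> C (pushouts_of C K)" "is_retract C f g"
    by (auto simp: cell_def)
  have "lifts C f p" if p: "p \<in> rlp C K" for p
  proof (rule lifts_retract[OF g(2)])
    show p': "p \<in> Arr C" using p by (simp add: rlp_def)
    show "lifts C g p"
    proof (rule conjunct2[OF lifts_transfinite_composition[OF g(1) _ p']])
      fix k assume "k \<in> pushouts_of C K"
      then show "lifts C k p"
        using p p' lifts_pushout by (auto simp: pushouts_of_def rlp_def)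
    qed
  qed
  then show "f \<in> llp C (rlp C K)" using g(2) by (simp add: llp_def is_retract_def)
qed

end

section \<open>Presentability and chains of large cofinality\<close>

text \<open>For a chain without largest element this says that the cofinality exceeds the
  cardinality of \<open>Q\<close>. Bounds are weak, so a largest element is allowed.
  \<open>Q\<close> is a set of arbitrary type, so that ranks from different sources can be merged
  into sums.\<close>

definition wide :: "'q set \<Rightarrow> 'k rel \<Rightarrow> bool" where
  "wide Q r \<longleftrightarrow> (\<forall>S \<subseteq> Field r. |S| \<le>o |Q| \<longrightarrow> (\<exists>b \<in> Field r. \<forall>a \<in> S. (a, b) \<in> r))"

lemma wide_mono: "wide Q r \<Longrightarrow> |Q'| \<le>o |Q| \<Longrightarrow> wide Q' r"
  unfolding wide_def by (meson ordLeq_transitive)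

text \<open>The half of presentability that the small object argument consumes: maps into the
  colimit of a long chain factor through a stage. The set \<open>Q\<close> measures how long the
  chain has to be.\<close>

definition chain_compact :: "'k rel \<Rightarrow> ('o, 'm) cat \<Rightarrow> 'q set \<Rightarrow> 'o \<Rightarrow> bool" where
  "chain_compact \<kappa> C Q x \<longleftrightarrow> (\<forall>(r :: 'k rel) FO FA y c h.
     Well_order r \<longrightarrow> small \<kappa> (Field r) \<longrightarrow> wide Q r \<longrightarrow> is_functor (poset_cat r) C FO FA \<longrightarrow>
     is_colimit C (poset_cat r) FO FA y c \<longrightarrow> h \<in> hom C x y \<longrightarrow>
     (\<exists>b \<in> Field r. \<exists>g \<in> hom C x (FO b). c b \<odot>\<^bsub>C\<^esub> g = h))"

lemma chain_compact_mono: "chain_compact \<kappa> C Q x \<Longrightarrow> |Q| \<le>o |Q'| \<Longrightarrow> chain_compact \<kappa> C Q' x"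
  unfolding chain_compact_def using wide_mono by blast

locale presentable_category = small_cocomplete \<kappa> C
  for \<kappa> :: "'k rel" and C :: "('o, 'm) cat" (structure) +
  assumes locally_presentable: "locally_presentable \<kappa> C"
begin

lemma complete: "complete \<kappa> C"
proof -
  obtain \<mu> :: "'k rel" and A where A: "small \<kappa> A" "\<And>a. a \<in> A \<Longrightarrow> presentable \<kappa> C \<mu> a"
    and dense: "\<forall>x \<in> Obj C. \<exists>(r :: 'k rel) FO FA c.
           small_directed_poset \<kappa> \<mu> r \<and> is_functor (poset_cat r) C FO FA \<and>
           (\<forall>a \<in> Field r. FO a \<in> A) \<and> is_colimit C (poset_cat r) FO FA x c"
    using locally_presentable unfolding locally_presentable_def by blast
  show ?thesis
  proof (rule complete_of_colimit_dense[OF A(1)])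
    show "A \<subseteq> Obj C" using A(2) by (auto simp: presentable_def)
    fix x assume "x \<in> Obj C"
    with dense show "\<exists>(r :: 'k rel) FO FA c. category (poset_cat r) \<and>
      is_functor (poset_cat r) C FO FA \<and> (\<forall>a \<in> Field r. FO a \<in> A) \<and> is_colimit C (poset_cat r) FO FA x c"
      unfolding is_functor_def by blast
  qed
qed

text \<open>Write \<open>x\<close> as a colimit over \<open>q\<close> of presentable generators. A
  map \<open>h\<close> from \<open>x\<close> to the colimit of a chain factors on each generator
  through some stage, and the factorizations become compatible along each arrow of \<open>q\<close>
  at some later stage. The chain is wide enough to contain one stage \<open>B\<close> above all of
  these, where they assemble to a map from \<open>x\<close>.\<close>

lemma chain_compact_exists:
  assumes x: "x \<in> Obj C"
  shows "\<exists>Q :: ('k + 'k \<times> 'k) set. small \<kappa> Q \<and> chain_compact \<kappa> C Q x"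
proof -
  obtain \<mu> :: "'k rel" and A where \<mu>: "small_regular_cardinal \<kappa> \<mu>" and A: "\<And>a. a \<in> A \<Longrightarrow> presentable \<kappa> C \<mu> a"
    and dense: "\<forall>x \<in> Obj C. \<exists>(r :: 'k rel) FO FA c.
           small_directed_poset \<kappa> \<mu> r \<and> is_functor (poset_cat r) C FO FA \<and>
           (\<forall>a \<in> Field r. FO a \<in> A) \<and> is_colimit C (poset_cat r) FO FA x c"
    using locally_presentable unfolding locally_presentable_def by blast
  obtain q :: "'k rel" and YO YA e where q: "small_directed_poset \<kappa> \<mu> q" and Y: "is_functor (poset_cat q) C YO YA"
    and YOA: "\<And>a. a \<in> Field q \<Longrightarrow> YO a \<in> A" and e: "is_colimit C (poset_cat q) YO YA x e"
    using bspec[OF dense x] by (elim exE conjE) (rule that, auto)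
  have qF: "\<And>s t. (s, t) \<in> q \<Longrightarrow> s \<in> Field q \<and> t \<in> Field q" by (auto simp: Field_def)
  have qrefl: "(s, s) \<in> q" if "s \<in> Field q" for s
    using q that by (auto simp: small_directed_poset_def order_on_defs refl_on_def)
  have smq: "small \<kappa> q"
    by (rule small_mono[of "Field q \<times> Field q"])
      (use q qF in \<open>auto simp: small_directed_poset_def intro: small_Times\<close>)
  have sm\<mu>: "|Field \<mu>| =o \<mu>" "\<mu> <o \<kappa>" 
    using \<mu> card_of_Field_ordIso by (auto simp: small_regular_cardinal_def)
  have eh: "e s \<in> hom C (YO s) x" if "s \<in> Field q" for s using colimit_hom[OF e] that by simp
  have ec: "e t \<odot> YA (s, t) = e s" if "(s, t) \<in> q" for s t using colimit_compat[OF e, of "(s, t)"] that by simp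
  \<comment> \<open>The summand \<open>Field \<mu>\<close> makes the chain
    \<open>\<mu>\<close>-directed, so that presentability of the generators applies; the summand
    \<open>q\<close> bounds one stage for each arrow of \<open>q\<close>.\<close>
  define Q where "Q = Field \<mu> <+> q"
  have "small \<kappa> Q"
    using smq ordIso_ordLess_trans[OF sm\<mu>] unfolding Q_def by (intro small_Plus) (simp_all add: small_def)
  moreover have "chain_compact \<kappa> C Q x"
    unfolding chain_compact_def
  proof (intro allI impI)
    fix r :: "'k rel" and FO FA y c h
    assume r: "Well_order r" and smr: "small \<kappa> (Field r)" and wide: "wide Q r"
      and F: "is_functor (poset_cat r) C FO FA" and c: "is_colimit C (poset_cat r) FO FA y c" and h: "h \<in> hom C x y"
    note wo = Well_order_facts[OF r]
    have ch: "c a \<in> hom C (FO a) y" if "a \<in> Field r" for a using colimit_hom[OF c] that by simp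
    have cc: "c b \<odot> FA (a, b) = c a" if "(a, b) \<in> r" for a b using colimit_compat[OF c, of "(a, b)"] that by simp
    have "wide (Field \<mu>) r"
      using wide card_of_Plus1 wide_mono unfolding Q_def by blast
    then have dir: "small_directed_poset \<kappa> \<mu> r"
      using r smr unfolding small_directed_poset_def wide_def
      by (metis ordLess_imp_ordLeq ordLeq_ordIso_trans ordIso_symmetric sm\<mu>(1) order_on_defs(1-3) order_on_defs)
    have pres: "(\<forall>h\<in>hom C a y. \<exists>b\<in>Field r. \<exists>g\<in>hom C a (FO b). c b \<odot> g = h) \<and>
      (\<forall>b\<in>Field r. \<forall>b'\<in>Field r. \<forall>g\<in>hom C a (FO b). \<forall>g'\<in>hom C a (FO b').
         c b \<odot> g = c b' \<odot> g' \<longrightarrow> (\<exists>d. (b, d) \<in> r \<and> (b', d) \<in> r \<and> FA (b, d) \<odot> g = FA (b', d) \<odot> g'))"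
      if "a \<in> A" for a
      using A[OF that] dir F c unfolding presentable_def by blast
    have "\<exists>b g. b \<in> Field r \<and> g \<in> hom C (YO s) (FO b) \<and> c b \<odot> g = h \<odot> e s" if "s \<in> Field q" for s
      using pres[OF YOA[OF that]] comp_hom[OF h eh[OF that]] by blast
    then obtain b g where b: "\<And>s. s \<in> Field q \<Longrightarrow> b s \<in> Field r"
      and g: "\<And>s. s \<in> Field q \<Longrightarrow> g s \<in> hom C (YO s) (FO (b s))"
      and cg: "\<And>s. s \<in> Field q \<Longrightarrow> c (b s) \<odot> g s = h \<odot> e s" by metis
    \<comment> \<open>The two factorizations of \<open>h \<odot> e s\<close>, chosen at
      \<open>s\<close> and restricted from \<open>t\<close>, agree only in the colimit; the
      injectivity half of presentability of \<open>YO s\<close> makes them agree at a stage.\<close>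
    have "\<exists>d. (b s, d) \<in> r \<and> (b t, d) \<in> r \<and> FA (b s, d) \<odot> g s = FA (b t, d) \<odot> g t \<odot> YA (s, t)" if st: "(s, t) \<in> q" for s t
    proof -
      note f = qF[OF st, THEN conjunct1] qF[OF st, THEN conjunct2]
      have "c (b s) \<odot> g s = h \<odot> e t \<odot> YA (s, t)" using cg[OF f(1)] ec[OF st] by simp
      also have "\<dots> = c (b t) \<odot> g t \<odot> YA (s, t)"
        using comp_assoc[OF h eh[OF f(2)] chain_hom[OF Y st]] comp_assoc[OF ch[OF b] g[OF f(2)] chain_hom[OF Y st]]
          cg[OF f(2)] f by simp
      finally show ?thesis
        using pres[OF YOA[OF f(1)]] b[OF f(1)] b[OF f(2)] g[OF f(1)] comp_hom[OF g[OF f(2)] chain_hom[OF Y st]] by blast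
    qed
    then have "\<exists>d. (b (fst u), d) \<in> r \<and> (b (snd u), d) \<in> r \<and>
        FA (b (fst u), d) \<odot> g (fst u) = FA (b (snd u), d) \<odot> g (snd u) \<odot> YA u" if "u \<in> q" for u
      using that by (cases u) simp
    then obtain d where "\<And>u. u \<in> q \<Longrightarrow> (b (fst u), d u) \<in> r \<and> (b (snd u), d u) \<in> r \<and>
        FA (b (fst u), d u) \<odot> g (fst u) = FA (b (snd u), d u) \<odot> g (snd u) \<odot> YA u"
      by metis
    from this[of "(_, _)"] have d: "(b s, d (s, t)) \<in> r \<and> (b t, d (s, t)) \<in> r \<and>
        FA (b s, d (s, t)) \<odot> g s = FA (b t, d (s, t)) \<odot> g t \<odot> YA (s, t)" if "(s, t) \<in> q" for s t
      using that by simp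
    have "|d ` q| \<le>o |Q|"
      using ordLeq_transitive[OF card_of_image card_of_Plus2] unfolding Q_def by blast
    moreover have "d ` q \<subseteq> Field r" using d wo(6) by force
    ultimately have "\<exists>B\<in>Field r. \<forall>a\<in>d ` q. (a, B) \<in> r"
      using wide[unfolded wide_def, rule_format, of "d ` q"] by blast
    then obtain B where B: "B \<in> Field r" "\<And>s t. (s, t) \<in> q \<Longrightarrow> (d (s, t), B) \<in> r"
      by auto
    \<comment> \<open>\<open>B\<close> bounds the stages \<open>d\<close> of arrows only; the
      identity \<open>(s, s)\<close> of \<open>q\<close> carries this over to
      \<open>b s\<close>.\<close>
    have bB: "(b s, B) \<in> r" if "s \<in> Field q" for s
      using wo(2) d B(2) qrefl[OF that] by blast
    have "is_cocone C (poset_cat q) YO YA (FO B) (\<lambda>s. FA (b s, B) \<odot> g s)"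
      unfolding is_cocone_def
    proof (intro conjI ballI)
      show "FO B \<in> Obj C" using functor_obj[OF F] B by simp
      show "FA (b s, B) \<odot> g s \<in> hom C (YO s) (FO B)" if "s \<in> Obj (poset_cat q)" for s
        using that chain_hom[OF F bB] g by auto
      fix u assume "u \<in> Arr (poset_cat q)"
      then obtain s t where u: "u = (s, t)" "(s, t) \<in> q" by (cases u) auto
      note f = qF[OF u(2), THEN conjunct1] qF[OF u(2), THEN conjunct2]
      note d' = d[OF u(2), THEN conjunct1] d[OF u(2), THEN conjunct2, THEN conjunct1] d[OF u(2), THEN conjunct2, THEN conjunct2]
      note dB = B(2)[OF u(2)]
      have "FA (b s, B) \<odot> g s = FA (d (s, t), B) \<odot> FA (b s, d (s, t)) \<odot> g s"
        using comp_assoc[OF chain_hom[OF F dB] chain_hom[OF F d'(1)] g[OF f(1)]] chain_comp[OF F d'(1) dB] by simp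
      also have "\<dots> = FA (d (s, t), B) \<odot> FA (b t, d (s, t)) \<odot> g t \<odot> YA (s, t)" using d'(3) by simp
      also have "\<dots> = FA (b t, B) \<odot> g t \<odot> YA (s, t)"
        using comp_assoc[OF chain_hom[OF F dB] chain_hom[OF F d'(2)] comp_hom[OF g[OF f(2)] chain_hom[OF Y u(2)]]] 
          chain_comp[OF F d'(2) dB] by simp
      also have "\<dots> = (FA (b t, B) \<odot> g t) \<odot> YA (s, t)"
        using comp_assoc[OF chain_hom[OF F bB[OF f(2)]] g[OF f(2)] chain_hom[OF Y u(2)]] by simp
      finally show "(FA (b (Cod (poset_cat q) u), B) \<odot> g (Cod (poset_cat q) u)) \<odot> YA u =
          FA (b (Dom (poset_cat q) u), B) \<odot> g (Dom (poset_cat q) u)"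
        using u by simp
    qed
    from colimit_factor[OF e this] obtain k where k: "k \<in> hom C x (FO B)"
      "\<And>s. s \<in> Field q \<Longrightarrow> k \<odot> e s = FA (b s, B) \<odot> g s" by auto
    have "c B \<odot> k = h"
    proof (rule colimit_eqI[OF e])
      fix s assume "s \<in> Obj (poset_cat q)"
      then have s: "s \<in> Field q" by simp
      show "(c B \<odot> k) \<odot> e s = h \<odot> e s"
        using comp_assoc[OF ch[OF B(1)] k(1) eh[OF s]] k(2)[OF s] cg[OF s] cc[OF bB[OF s]]
          comp_assoc[OF ch[OF B(1)] chain_hom[OF F bB[OF s]] g[OF s]] by simp
    next
      show "YA u \<in> hom C (YO (Dom (poset_cat q) u)) (YO (Cod (poset_cat q) u))" if "u \<in> Arr (poset_cat q)" for u
        using functor_arr[OF Y that] .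
    qed (use qF ch[OF B(1)] k(1) h in auto)
    with B(1) k(1) show "\<exists>b\<in>Field r. \<exists>g\<in>hom C x (FO b). c b \<odot> g = h" by blast
  qed
  ultimately show ?thesis by blast
qed

lemma chain_compact_family:
  assumes K: "small \<kappa> K" "K \<subseteq> Arr C"
  shows "\<exists>Q :: ('m \<times> ('k + 'k \<times> 'k) + nat) set. small \<kappa> Q \<and> infinite Q \<and> (\<forall>k\<in>K. chain_compact \<kappa> C Q (Dom C k))"
proof -
  have "\<exists>Q :: ('k + 'k \<times> 'k) set. small \<kappa> Q \<and> chain_compact \<kappa> C Q (Dom C k)" if "k \<in> K" for k
    using chain_compact_exists[OF dom_obj] K(2) that by blast
  then obtain q :: "'m \<Rightarrow> ('k + 'k \<times> 'k) set" where q: "\<And>k. k \<in> K \<Longrightarrow> small \<kappa> (q k)" "\<And>k. k \<in> K \<Longrightarrow> chain_compact \<kappa> C (q k) (Dom C k)"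
    by metis
  \<comment> \<open>One bound for all domains at once. The summand of natural numbers makes it
    infinite, which is required for its successor cardinal to be regular.\<close>
  define Q where "Q = (SIGMA k:K. q k) <+> (UNIV :: nat set)"
  have "small \<kappa> (UNIV :: nat set)"
    using inacc card_of_nat ordIso_ordLess_trans unfolding inaccessible_def small_def by blast
  then have "small \<kappa> Q" unfolding Q_def by (intro small_Plus small_Sigma K(1) q(1))
  moreover have "infinite Q" unfolding Q_def by (simp add: finite_Plus_iff)
  moreover have "chain_compact \<kappa> C Q (Dom C k)" if k: "k \<in> K" for k
  proof (rule chain_compact_mono[OF q(2)[OF k]])
    have "inj_on (\<lambda>x. Inl (k, x)) (q k)" "(\<lambda>x. Inl (k, x)) ` q k \<subseteq> Q"
      using k by (auto simp: Q_def inj_on_def)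
    then show "|q k| \<le>o |Q|" using card_of_ordLeq by blast
  qed
  ultimately show ?thesis by blast
qed

end

section \<open>Closure points and bookkeeping below an inaccessible cardinal\<close>

context inaccessible_cardinal
begin

lemmas \<kappa>_facts = Well_order_facts[OF wo_\<kappa>]

lemma \<kappa>_underS_trans: "a \<in> underS \<kappa> b \<Longrightarrow> (b, c) \<in> \<kappa> \<Longrightarrow> a \<in> underS \<kappa> c"
  and \<kappa>_underS_trans': "(a, b) \<in> \<kappa> \<Longrightarrow> b \<in> underS \<kappa> c \<Longrightarrow> a \<in> underS \<kappa> c"
  using \<kappa>_facts(2,3) unfolding underS_def by blast+

lemma \<kappa>_underS_linear: "a \<in> Field \<kappa> \<Longrightarrow> b \<in> Field \<kappa> \<Longrightarrow> a \<notin> underS \<kappa> b \<Longrightarrow> (b, a) \<in> \<kappa>"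
  using \<kappa>_facts(1,4) unfolding underS_def by blast

text \<open>Let \<open>\<nu>\<close> be the successor cardinal of \<open>|Q|\<close> and build a
  strictly increasing chain \<open>d\<close> of length \<open>\<nu>\<close> in
  \<open>\<kappa>\<close> that outruns \<open>G\<close>. Its supremum \<open>\<delta>\<close> is
  closed under \<open>G\<close>, and regularity of \<open>\<nu>\<close> bounds every set of at most
  \<open>|Q|\<close> elements below \<open>\<delta>\<close>.\<close>

lemma closure_point_exists:
  fixes Q :: "'q set"
  assumes Q: "small \<kappa> Q" "infinite Q" and G: "\<And>\<beta>. \<beta> \<in> Field \<kappa> \<Longrightarrow> G \<beta> \<in> Field \<kappa>"
  shows "\<exists>\<delta> \<in> Field \<kappa>. underS \<kappa> \<delta> \<noteq> {} \<and> (\<forall>\<beta> \<in> underS \<kappa> \<delta>. G \<beta> \<in> underS \<kappa> \<delta>) \<and>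
    wide Q (Restr \<kappa> (underS \<kappa> \<delta>))"
proof -
  \<comment> \<open>A successor cardinal is regular, and it is still below \<open>\<kappa>\<close>:
    it is at most the cardinality of \<open>Pow Q\<close>, and \<open>\<kappa>\<close> is a strong
    limit.\<close>
  define \<nu> where "\<nu> = cardSuc |Q|"
  have card\<nu>: "Card_order \<nu>" unfolding \<nu>_def by (rule cardSuc_Card_order[OF card_of_Card_order])
  have inf\<nu>: "infinite (Field \<nu>)" using Q(2) by (simp add: \<nu>_def cardSuc_finite[OF card_of_Card_order] Field_card_of)
  have reg\<nu>: "regularCard \<nu>" unfolding \<nu>_def
    by (rule infinite_cardSuc_regularCard) (use Q(2) in \<open>simp_all add: Field_card_of card_of_card_order_on\<close>)
  have wo\<nu>: "Well_order \<nu>" using card\<nu> by (rule card_order_on_well_order_on)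
  note n = Well_order_facts[OF wo\<nu>]
  have "\<nu> \<le>o |Pow Q|" unfolding \<nu>_def by (rule cardSuc_least) (simp_all add: card_of_Pow card_of_Card_order)
  then have "\<nu> <o \<kappa>" using small_Pow[OF Q(1)] unfolding small_def by (rule ordLeq_ordLess_trans)
  then have sm\<nu>: "small \<kappa> (Field \<nu>)"
    using ordIso_ordLess_trans[OF card_of_Field_ordIso[OF card\<nu>]] by (simp add: small_def)
  \<comment> \<open>The next value exceeds all earlier values \<open>d \<eta>\<close> and all
    \<open>G \<beta>\<close> with \<open>\<beta>\<close> weakly below one of them.\<close>
  define P where "P = (\<lambda>d \<xi> v. v \<in> Field \<kappa> \<and> (\<forall>\<eta>. (\<eta>, \<xi>) \<in> \<nu> - Id \<longrightarrow>
    d \<eta> \<in> underS \<kappa> v \<and> (\<forall>\<beta>. (\<beta>, d \<eta>) \<in> \<kappa> \<longrightarrow> G \<beta> \<in> underS \<kappa> v)))"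
  have "\<exists>d. \<forall>\<xi>. P d \<xi> (d \<xi>)"
  proof (rule dependent_wf_choice[OF n(7)])
    show "P f \<xi> v = P g \<xi> v" if "\<And>\<eta>. (\<eta>, \<xi>) \<in> \<nu> - Id \<Longrightarrow> f \<eta> = g \<eta>" for f g \<xi> v
      using that by (simp add: P_def)
  next
    fix \<xi> d assume IH: "\<And>\<eta>. (\<eta>, \<xi>) \<in> \<nu> - Id \<Longrightarrow> P d \<eta> (d \<eta>)"
    let ?D = "\<Union>\<eta>\<in>{\<eta>. (\<eta>, \<xi>) \<in> \<nu> - Id}. insert (d \<eta>) (G ` insert (d \<eta>) (underS \<kappa> (d \<eta>)))"
    have dF: "d \<eta> \<in> Field \<kappa>" if "(\<eta>, \<xi>) \<in> \<nu> - Id" for \<eta> using IH[OF that] by (simp add: P_def)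
    have "{\<eta>. (\<eta>, \<xi>) \<in> \<nu> - Id} \<subseteq> Field \<nu>" using n(5) by blast
    then have "small \<kappa> {\<eta>. (\<eta>, \<xi>) \<in> \<nu> - Id}" using small_mono sm\<nu> by blast
    moreover have sm_insert: "small \<kappa> (insert a B)" if "small \<kappa> B" for a :: 'k and B
      using small_Un[OF small_finite[of "{a}"] that] by simp
    ultimately have "small \<kappa> ?D"
      by (intro small_UN sm_insert small_image small_underS) (use dF in auto)
    moreover have "?D \<subseteq> Field \<kappa>"
    proof (rule UN_least)
      fix \<eta> assume "\<eta> \<in> {\<eta>. (\<eta>, \<xi>) \<in> \<nu> - Id}"
      then have "d \<eta> \<in> Field \<kappa>" using dF by simp
      moreover have "insert (d \<eta>) (underS \<kappa> (d \<eta>)) \<subseteq> Field \<kappa>"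
        using calculation by (auto intro: underS_Field)
      ultimately show "insert (d \<eta>) (G ` insert (d \<eta>) (underS \<kappa> (d \<eta>))) \<subseteq> Field \<kappa>"
        using G by auto
    qed
    ultimately obtain v where v: "v \<in> Field \<kappa>" "?D \<subseteq> underS \<kappa> v" by (rule small_bounded)
    have "G \<beta> \<in> underS \<kappa> v" if "(\<eta>, \<xi>) \<in> \<nu> - Id" "(\<beta>, d \<eta>) \<in> \<kappa>" for \<eta> \<beta>
    proof -
      have "\<beta> \<in> insert (d \<eta>) (underS \<kappa> (d \<eta>))" using that(2) by (auto simp: underS_def)
      then show ?thesis using that(1) v(2) by blast
    qed
    moreover have "d \<eta> \<in> underS \<kappa> v" if "(\<eta>, \<xi>) \<in> \<nu> - Id" for \<eta>
      using that v(2) by blast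
    ultimately have "P d \<xi> v" using v(1) by (simp add: P_def)
    then show "\<exists>v. P d \<xi> v" ..
  qed
  then obtain d where "\<And>\<xi>. P d \<xi> (d \<xi>)" by blast
  then have d: "d \<xi> \<in> Field \<kappa>" "(\<eta>, \<xi>) \<in> \<nu> - Id \<Longrightarrow> d \<eta> \<in> underS \<kappa> (d \<xi>)"
    "(\<eta>, \<xi>) \<in> \<nu> - Id \<Longrightarrow> (\<beta>, d \<eta>) \<in> \<kappa> \<Longrightarrow> G \<beta> \<in> underS \<kappa> (d \<xi>)" for \<xi> \<eta> \<beta>
    by (auto simp: P_def)
  \<comment> \<open>The minimum \<open>\<delta>\<close> of the strict upper bounds is taken because
    minimality makes the chain cofinal below \<open>\<delta>\<close>.\<close>
  define U where "U = {b \<in> Field \<kappa>. d ` Field \<nu> \<subseteq> underS \<kappa> b}"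
  have "d ` Field \<nu> \<subseteq> Field \<kappa>" using d(1) by auto
  with small_image[OF sm\<nu>, of d] obtain b where "b \<in> Field \<kappa>" "d ` Field \<nu> \<subseteq> underS \<kappa> b"
    by (rule small_bounded)
  then have "b \<in> U" by (simp add: U_def)
  then obtain \<delta> where \<delta>: "\<delta> \<in> U" "\<And>b. (b, \<delta>) \<in> \<kappa> - Id \<Longrightarrow> b \<notin> U"
    using wfE_min[OF \<kappa>_facts(7)] by metis
  have d\<delta>: "d \<xi> \<in> underS \<kappa> \<delta>" if "\<xi> \<in> Field \<nu>" for \<xi> using \<delta>(1) that by (auto simp: U_def)
  have cof: "\<exists>\<xi>\<in>Field \<nu>. (\<beta>, d \<xi>) \<in> \<kappa>" if "\<beta> \<in> underS \<kappa> \<delta>" for \<beta>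
  proof -
    have "\<beta> \<in> Field \<kappa>" by (rule underS_Field[OF that])
    moreover have "\<beta> \<notin> U" using \<delta>(2)[of \<beta>] that by (auto simp: underS_def)
    ultimately show ?thesis using \<kappa>_underS_linear d(1) unfolding U_def by blast
  qed
  show ?thesis
  proof (intro bexI[of _ \<delta>] conjI ballI)
    show "\<delta> \<in> Field \<kappa>" using \<delta>(1) by (simp add: U_def)
    show "underS \<kappa> \<delta> \<noteq> {}" using d\<delta> inf\<nu> by fastforce
    show "G \<beta> \<in> underS \<kappa> \<delta>" if \<beta>: "\<beta> \<in> underS \<kappa> \<delta>" for \<beta>
    proof -
      obtain \<xi> where \<xi>: "\<xi> \<in> Field \<nu>" "(\<beta>, d \<xi>) \<in> \<kappa>" using cof[OF \<beta>] by blast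
      \<comment> \<open>The value \<open>G \<beta>\<close> is dominated only at an index after
        \<open>\<xi>\<close>; one exists because the infinite cardinal \<open>\<nu>\<close> has no
        largest element.\<close>
      obtain \<xi>' where \<xi>': "\<xi>' \<in> Field \<nu>" "(\<xi>, \<xi>') \<in> \<nu> - Id"
        using infinite_Card_order_limit[OF card\<nu> inf\<nu> \<xi>(1)] by blast
      show ?thesis
        using \<kappa>_underS_trans'[OF _ d\<delta>[OF \<xi>'(1)]] d(3)[OF \<xi>'(2) \<xi>(2)] by (auto simp: underS_def)
    qed
    show "wide Q (Restr \<kappa> (underS \<kappa> \<delta>))"
      unfolding wide_def Field_Restr_underS[OF wo_\<kappa>]
    proof (intro allI impI)
      fix S assume S: "S \<subseteq> underS \<kappa> \<delta>" "|S| \<le>o |Q|"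
      \<comment> \<open>Boundedness is moved from \<open>\<delta>\<close> to the indices:
        \<open>x s\<close> is an index whose value dominates \<open>s\<close>, and a set of at most
        \<open>|Q|\<close> indices is bounded in \<open>\<nu>\<close>.\<close>
      then obtain x where x: "\<And>s. s \<in> S \<Longrightarrow> x s \<in> Field \<nu> \<and> (s, d (x s)) \<in> \<kappa>"
        using cof by (metis subsetD)
      have "|x ` S| \<le>o |Q|" using S(2) card_of_image ordLeq_transitive by blast
      moreover have "|Q| <o \<nu>" unfolding \<nu>_def by (rule cardSuc_greater[OF card_of_Card_order])
      ultimately have "\<not> |x ` S| =o \<nu>"
        using not_ordLess_ordIso ordLeq_ordLess_trans by blast
      then have "\<not> cofinal (x ` S) \<nu>" using reg\<nu> x unfolding regularCard_def by blast
      then obtain a where a: "a \<in> Field \<nu>" "\<And>s. s \<in> S \<Longrightarrow> (x s, a) \<in> \<nu>"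
        using x n(1,4) unfolding cofinal_def by (metis imageI)
      have "(s, d a) \<in> \<kappa>" if "s \<in> S" for s
      proof (cases "x s = a")
        case False
        then have "d (x s) \<in> underS \<kappa> (d a)" using d(2) a(2)[OF that] by blast
        then show ?thesis using \<kappa>_facts(2) x[OF that] by (auto simp: underS_def)
      qed (use x[OF that] in auto)
      with d\<delta>[OF a(1)] S(1) show "\<exists>b\<in>underS \<kappa> \<delta>. \<forall>a\<in>S. (a, b) \<in> Restr \<kappa> (underS \<kappa> \<delta>)" by blast
    qed
  qed
qed

text \<open>Every pair receives as many codes as \<open>\<kappa>\<close> has elements, while the
  segment below \<open>\<beta>\<close> is small; so some code \<open>\<gamma>\<close> is not below
  \<open>\<beta>\<close>. This guarantees that the problem is posed no later than the step which is
  to solve it.\<close>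

lemma bookkeeping:
  "\<exists>e :: 'k \<Rightarrow> 'k \<times> 'k. \<forall>\<beta>\<in>Field \<kappa>. \<forall>\<xi>\<in>Field \<kappa>. \<exists>\<gamma>. (\<beta>, \<gamma>) \<in> \<kappa> \<and> e \<gamma> = (\<beta>, \<xi>)"
proof -
  let ?F = "Field \<kappa>"
  have "|?F \<times> ?F| =o |?F|" by (rule card_of_Times_same_infinite[OF infinite_\<kappa>])
  then obtain f where f: "bij_betw f (?F \<times> ?F) ?F" using card_of_ordIso by blast
  \<comment> \<open>The argument \<open>x\<close> is padding: it varies over
    \<open>Field \<kappa>\<close> and is forgotten by \<open>e\<close>.\<close>
  define g where "g = (\<lambda>\<beta> \<xi> x. f (f (\<beta>, \<xi>), x))"
  define e where "e = (\<lambda>\<gamma>. inv_into (?F \<times> ?F) f (fst (inv_into (?F \<times> ?F) f \<gamma>)))"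
  have fF: "f (x, y) \<in> ?F" if "x \<in> ?F" "y \<in> ?F" for x y using f that by (auto simp: bij_betw_def)
  have inj: "inj_on f (?F \<times> ?F)" using f by (simp add: bij_betw_def)
  have e: "e (g \<beta> \<xi> x) = (\<beta>, \<xi>)" if "\<beta> \<in> ?F" "\<xi> \<in> ?F" "x \<in> ?F" for \<beta> \<xi> x
    using that fF by (simp add: e_def g_def inv_into_f_f[OF inj])
  show ?thesis
  proof (intro exI[of _ e] ballI)
    fix \<beta> \<xi> assume b: "\<beta> \<in> ?F" "\<xi> \<in> ?F"
    show "\<exists>\<gamma>. (\<beta>, \<gamma>) \<in> \<kappa> \<and> e \<gamma> = (\<beta>, \<xi>)"
    proof (rule ccontr)
      assume "\<nexists>\<gamma>. (\<beta>, \<gamma>) \<in> \<kappa> \<and> e \<gamma> = (\<beta>, \<xi>)"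
      then have "g \<beta> \<xi> x \<in> underS \<kappa> \<beta>" if "x \<in> ?F" for x
        using \<kappa>_underS_linear[of "g \<beta> \<xi> x" \<beta>] e[OF b that] b fF that by (auto simp: g_def)
      moreover have "inj_on (g \<beta> \<xi>) ?F"
      proof (rule inj_onI)
        fix x y assume "x \<in> ?F" "y \<in> ?F" "g \<beta> \<xi> x = g \<beta> \<xi> y"
        then have "(f (\<beta>, \<xi>), x) = (f (\<beta>, \<xi>), y)"
          using inj_onD[OF inj, of "(f (\<beta>, \<xi>), x)" "(f (\<beta>, \<xi>), y)"] fF[OF b] by (simp add: g_def)
        then show "x = y" by simp
      qed
      ultimately have "small \<kappa> ?F"
        using small_inj_on[of "g \<beta> \<xi>" ?F "underS \<kappa> \<beta>"] small_underS[OF b(1)] by blast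
      then show False
        using card_of_Field_ordIso[OF card_\<kappa>] not_ordLess_ordIso unfolding small_def by blast
    qed
  qed
qed

lemma successor_exists:
  assumes "a \<in> Field \<kappa>"
  shows "\<exists>b \<in> Field \<kappa>. immediate_succ \<kappa> a b"
proof -
  define U where "U = {b \<in> Field \<kappa>. a \<in> underS \<kappa> b}"
  obtain b where "b \<in> U"
    using infinite_Card_order_limit[OF card_\<kappa> infinite_\<kappa> assms] by (auto simp: U_def underS_def)
  then obtain m where m: "m \<in> U" "\<And>b. (b, m) \<in> \<kappa> - Id \<Longrightarrow> b \<notin> U"
    using wfE_min[OF \<kappa>_facts(7)] by metis
  have "(d, a) \<in> \<kappa>" if "d \<in> underS \<kappa> m" for d
  proof -
    have dF: "d \<in> Field \<kappa>" by (rule underS_Field[OF that])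
    then have "a \<notin> underS \<kappa> d" using m(2)[of d] that by (auto simp: U_def underS_def)
    then show ?thesis using \<kappa>_underS_linear[OF assms dF] by blast
  qed
  with m(1) show ?thesis by (auto simp: immediate_succ_def U_def)
qed

end

section \<open>The small object argument\<close>

definition squares :: "('o, 'm) cat \<Rightarrow> 'm set \<Rightarrow> 'o \<Rightarrow> 'o \<Rightarrow> 'm \<Rightarrow> ('m \<times> 'm \<times> 'm) set" where
  "squares C K y z p = {(k, u, v). k \<in> K \<and> u \<in> hom C (Dom C k) z \<and> v \<in> hom C (Cod C k) y \<and>
     p \<odot>\<^bsub>C\<^esub> u = v \<odot>\<^bsub>C\<^esub> k}"

context small_cocomplete
begin

lemma small_squares:
  assumes "small \<kappa> K"
  shows "small \<kappa> (squares C K y z p)"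
proof (rule small_mono)
  show "small \<kappa> (SIGMA k : K. hom C (Dom C k) z \<times> hom C (Cod C k) y)"
    by (intro small_Sigma small_Times small_hom assms)
qed (auto simp: squares_def)

lemma rlp_if_no_squares:
  assumes "p \<in> hom C z y" "squares C K y z p = {}"
  shows "p \<in> rlp C K"
  using assms unfolding rlp_def lifts_def squares_def by (auto simp: in_hom_iff)

text \<open>The pushout of \<open>k\<close> along \<open>u\<close> solves the problem one stage
  later: \<open>w\<close> is a lift once the top map is extended by \<open>g\<close>, and
  \<open>q\<close> is induced by \<open>p\<close> and \<open>v\<close>.\<close>

lemma attach_cell:
  assumes K: "K \<subseteq> Arr C" and p: "p \<in> hom C z y" and s: "(k, u, v) \<in> squares C K y z p"
  obtains z' g q w where "g \<in> hom C z z'" "q \<in> hom C z' y" "q \<odot> g = p" "g \<in> pushouts_of C K"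
    "w \<in> hom C (Cod C k) z'" "w \<odot> k = g \<odot> u" "q \<odot> w = v"
proof -
  have k: "k \<in> K" "k \<in> hom C (Dom C k) (Cod C k)" and u: "u \<in> hom C (Dom C k) z" and v: "v \<in> hom C (Cod C k) y"
    and eq: "p \<odot> u = v \<odot> k"
    using s K by (auto simp: squares_def in_hom_iff)
  obtain z' g w where po: "is_pushout C k u g w" and g: "g \<in> hom C z z'" and w: "w \<in> hom C (Cod C k) z'"
    using pushout_exists[OF k(2) u] .
  have "\<exists>!h. h \<in> hom C (Cod C g) y \<and> h \<odot> g = p \<and> h \<odot> w = v"
    using po p v eq hom_cod[OF u] unfolding is_pushout_def by blast
  then obtain q where "q \<in> hom C z' y" "q \<odot> g = p" "q \<odot> w = v"
    unfolding hom_cod[OF g] by blast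
  moreover have "w \<odot> k = g \<odot> u" using po by (simp add: is_pushout_def)
  moreover have "g \<in> pushouts_of C K" using po k(1) by (auto simp: pushouts_of_def)
  ultimately show ?thesis using that g w by blast
qed

text \<open>The value of a chain at \<open>\<alpha>\<close> is a triple \<open>(z, T, p)\<close> of an object, the transition
  morphisms \<open>T \<beta>\<close> from the stages \<open>\<beta> \<le> \<alpha>\<close>, and a morphism to \<open>y\<close>.  The pair \<open>e \<gamma> = (\<beta>, \<xi>)\<close> prescribes
  that the step from \<open>\<gamma>\<close> to its successor solves the lifting problem at stage \<open>\<beta>\<close> with code \<open>\<xi>\<close>.\<close>

definition chain_step ::
  "'m set \<Rightarrow> 'o \<Rightarrow> 'o \<Rightarrow> 'm \<Rightarrow> ('k \<Rightarrow> 'k \<times> 'k) \<Rightarrow> ('o \<Rightarrow> 'm \<Rightarrow> 'm \<times> 'm \<times> 'm \<Rightarrow> 'k) \<Rightarrow>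
   ('k \<Rightarrow> 'o \<times> ('k \<Rightarrow> 'm) \<times> 'm) \<Rightarrow> 'k \<Rightarrow> 'o \<times> ('k \<Rightarrow> 'm) \<times> 'm \<Rightarrow> bool" where
  "chain_step K y x0 f e enc F \<alpha> = (\<lambda>(z, T, p). \<alpha> \<in> Field \<kappa> \<longrightarrow>
     z \<in> Obj C \<and> T \<alpha> = Ident C z \<and> p \<in> hom C z y \<and>
     (\<forall>\<beta>\<in>underS \<kappa> \<alpha>. T \<beta> \<in> hom C (fst (F \<beta>)) z \<and> p \<odot> T \<beta> = snd (snd (F \<beta>)) \<and>
        (\<forall>\<gamma>\<in>underS \<kappa> \<beta>. T \<beta> \<odot> fst (snd (F \<beta>)) \<gamma> = T \<gamma>)) \<and>
     (underS \<kappa> \<alpha> = {} \<longrightarrow> z = x0 \<and> p = f) \<and>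
     (\<forall>\<gamma>. immediate_succ \<kappa> \<gamma> \<alpha> \<longrightarrow>
        (squares C K y (fst (F \<gamma>)) (snd (snd (F \<gamma>))) \<noteq> {} \<longrightarrow> T \<gamma> \<in> pushouts_of C K) \<and>
        (\<forall>\<beta> k u v. \<beta> = fst (e \<gamma>) \<longrightarrow> (\<beta>, \<gamma>) \<in> \<kappa> \<longrightarrow>
           (k, u, v) \<in> squares C K y (fst (F \<beta>)) (snd (snd (F \<beta>))) \<longrightarrow>
           enc (fst (F \<beta>)) (snd (snd (F \<beta>))) (k, u, v) = snd (e \<gamma>) \<longrightarrow>
           (\<exists>w\<in>hom C (Cod C k) z. w \<odot> k = T \<beta> \<odot> u \<and> p \<odot> w = v))) \<and>
     (limit_element \<kappa> \<alpha> \<longrightarrow>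
        is_colimit C (poset_cat (Restr \<kappa> (underS \<kappa> \<alpha>))) (\<lambda>\<beta>. fst (F \<beta>))
          (\<lambda>u. fst (snd (F (snd u))) (fst u)) z T))"

text \<open>Well-founded choice needs the step condition to see only earlier stages. The stage
  \<open>fst (e \<gamma>)\<close> is arbitrary in general, and the guard
  \<open>(\<beta>, \<gamma>) \<in> \<kappa>\<close> keeps it below \<open>\<alpha>\<close>.\<close>

lemma chain_step_cong:
  assumes FG: "\<And>\<beta>. \<beta> \<in> underS \<kappa> \<alpha> \<Longrightarrow> F \<beta> = G \<beta>" and F: "chain_step K y x0 f e enc F \<alpha> v"
  shows "chain_step K y x0 f e enc G \<alpha> v"
proof -
  obtain z T p where v: "v = (z, T, p)" by (cases v)
  show ?thesis
    unfolding chain_step_def v split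
  proof (intro impI)
    assume \<alpha>: "\<alpha> \<in> Field \<kappa>"
    have succ: "F \<gamma> = G \<gamma>" "(\<beta>, \<gamma>) \<in> \<kappa> \<Longrightarrow> F \<beta> = G \<beta>" if "immediate_succ \<kappa> \<gamma> \<alpha>" for \<beta> \<gamma>
      using FG \<kappa>_underS_trans'[of \<beta> \<gamma> \<alpha>] that by (auto simp: immediate_succ_def)
    have lim: "is_colimit C (poset_cat (Restr \<kappa> (underS \<kappa> \<alpha>))) (\<lambda>\<beta>. fst (G \<beta>))
        (\<lambda>u. fst (snd (G (snd u))) (fst u)) z T"
      if "is_colimit C (poset_cat (Restr \<kappa> (underS \<kappa> \<alpha>))) (\<lambda>\<beta>. fst (F \<beta>))
        (\<lambda>u. fst (snd (F (snd u))) (fst u)) z T"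
      by (rule colimit_cong[OF that]) (auto simp: FG Field_Restr_underS[OF wo_\<kappa>])
    note F' = F[unfolded chain_step_def v split, THEN mp, OF \<alpha>]
    show "z \<in> Obj C \<and> T \<alpha> = Ident C z \<and> p \<in> hom C z y \<and>
     (\<forall>\<beta>\<in>underS \<kappa> \<alpha>. T \<beta> \<in> hom C (fst (G \<beta>)) z \<and> p \<odot> T \<beta> = snd (snd (G \<beta>)) \<and>
        (\<forall>\<gamma>\<in>underS \<kappa> \<beta>. T \<beta> \<odot> fst (snd (G \<beta>)) \<gamma> = T \<gamma>)) \<and>
     (underS \<kappa> \<alpha> = {} \<longrightarrow> z = x0 \<and> p = f) \<and>
     (\<forall>\<gamma>. immediate_succ \<kappa> \<gamma> \<alpha> \<longrightarrow>
        (squares C K y (fst (G \<gamma>)) (snd (snd (G \<gamma>))) \<noteq> {} \<longrightarrow> T \<gamma> \<in> pushouts_of C K) \<and>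
        (\<forall>\<beta> k u v. \<beta> = fst (e \<gamma>) \<longrightarrow> (\<beta>, \<gamma>) \<in> \<kappa> \<longrightarrow>
           (k, u, v) \<in> squares C K y (fst (G \<beta>)) (snd (snd (G \<beta>))) \<longrightarrow>
           enc (fst (G \<beta>)) (snd (snd (G \<beta>))) (k, u, v) = snd (e \<gamma>) \<longrightarrow>
           (\<exists>w\<in>hom C (Cod C k) z. w \<odot> k = T \<beta> \<odot> u \<and> p \<odot> w = v))) \<and>
     (limit_element \<kappa> \<alpha> \<longrightarrow>
        is_colimit C (poset_cat (Restr \<kappa> (underS \<kappa> \<alpha>))) (\<lambda>\<beta>. fst (G \<beta>))
          (\<lambda>u. fst (snd (G (snd u))) (fst u)) z T)"
    proof (intro conjI)
      show "\<forall>\<beta>\<in>underS \<kappa> \<alpha>. T \<beta> \<in> hom C (fst (G \<beta>)) z \<and> p \<odot> T \<beta> = snd (snd (G \<beta>)) \<and>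
        (\<forall>\<gamma>\<in>underS \<kappa> \<beta>. T \<beta> \<odot> fst (snd (G \<beta>)) \<gamma> = T \<gamma>)"
        using F' FG by simp
      show "\<forall>\<gamma>. immediate_succ \<kappa> \<gamma> \<alpha> \<longrightarrow>
        (squares C K y (fst (G \<gamma>)) (snd (snd (G \<gamma>))) \<noteq> {} \<longrightarrow> T \<gamma> \<in> pushouts_of C K) \<and>
        (\<forall>\<beta> k u v. \<beta> = fst (e \<gamma>) \<longrightarrow> (\<beta>, \<gamma>) \<in> \<kappa> \<longrightarrow>
           (k, u, v) \<in> squares C K y (fst (G \<beta>)) (snd (snd (G \<beta>))) \<longrightarrow>
           enc (fst (G \<beta>)) (snd (snd (G \<beta>))) (k, u, v) = snd (e \<gamma>) \<longrightarrow>
           (\<exists>w\<in>hom C (Cod C k) z. w \<odot> k = T \<beta> \<odot> u \<and> p \<odot> w = v))"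
      proof (intro allI impI)
        fix \<gamma> assume \<gamma>: "immediate_succ \<kappa> \<gamma> \<alpha>"
        note F'' = F'[THEN conjunct2, THEN conjunct2, THEN conjunct2, THEN conjunct2, THEN conjunct2, THEN conjunct1, THEN spec, THEN mp, OF \<gamma>]
        show "(squares C K y (fst (G \<gamma>)) (snd (snd (G \<gamma>))) \<noteq> {} \<longrightarrow> T \<gamma> \<in> pushouts_of C K) \<and>
        (\<forall>\<beta> k u v. \<beta> = fst (e \<gamma>) \<longrightarrow> (\<beta>, \<gamma>) \<in> \<kappa> \<longrightarrow>
           (k, u, v) \<in> squares C K y (fst (G \<beta>)) (snd (snd (G \<beta>))) \<longrightarrow>
           enc (fst (G \<beta>)) (snd (snd (G \<beta>))) (k, u, v) = snd (e \<gamma>) \<longrightarrow>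
           (\<exists>w\<in>hom C (Cod C k) z. w \<odot> k = T \<beta> \<odot> u \<and> p \<odot> w = v))"
        \<comment> \<open>If the scheduled stage is not weakly below \<open>\<gamma>\<close>, the
          solving clause is vacuous.\<close>
        proof (cases "(fst (e \<gamma>), \<gamma>) \<in> \<kappa>")
          case True
          show ?thesis using F'' succ(1)[OF \<gamma>] succ(2)[OF \<gamma> True] by simp
        next
          case False
          then show ?thesis using F'' succ(1)[OF \<gamma>] by simp
        qed
      qed
    qed (use F' lim in blast)+
  qed
qed

text \<open>The least stage is \<open>f\<close> itself, and a limit stage is the colimit of the
  earlier ones. At the successor of \<open>\<gamma>\<close> the problem coded by
  \<open>e \<gamma>\<close> is solved if there is one, otherwise any problem at
  \<open>\<gamma>\<close>; only in the absence of problems is the step an identity.\<close>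

lemma chain_step_exists:
  assumes K: "K \<subseteq> Arr C" and f: "f \<in> hom C x0 y"
    and enc: "\<And>z p. inj_on (enc z p) (squares C K y z p)"
    and IH: "\<And>\<beta>. \<beta> \<in> underS \<kappa> \<alpha> \<Longrightarrow> chain_step K y x0 f e enc F \<beta> (F \<beta>)"
  shows "\<exists>v. chain_step K y x0 f e enc F \<alpha> v"
proof (cases "\<alpha> \<in> Field \<kappa>")
  case False
  then show ?thesis by (auto simp: chain_step_def)
next
  case \<alpha>: True
  define Z where "Z = (\<lambda>\<beta>. fst (F \<beta>))"
  define T where "T = (\<lambda>\<beta>. fst (snd (F \<beta>)))"
  define p where "p = (\<lambda>\<beta>. snd (snd (F \<beta>)))"
  have F: "fst (F \<beta>) = Z \<beta>" "fst (snd (F \<beta>)) = T \<beta>" "snd (snd (F \<beta>)) = p \<beta>" for \<beta>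
    by (simp_all add: Z_def T_def p_def)
  have Z: "Z \<beta> \<in> Obj C" and Tid: "T \<beta> \<beta> = Ident C (Z \<beta>)" and p: "p \<beta> \<in> hom C (Z \<beta>) y"
    and T': "\<And>\<gamma>. \<gamma> \<in> underS \<kappa> \<beta> \<Longrightarrow> T \<beta> \<gamma> \<in> hom C (Z \<gamma>) (Z \<beta>) \<and> p \<beta> \<odot> T \<beta> \<gamma> = p \<gamma>"
    and TT': "\<And>\<gamma> \<eta>. \<gamma> \<in> underS \<kappa> \<beta> \<Longrightarrow> \<eta> \<in> underS \<kappa> \<gamma> \<Longrightarrow> T \<beta> \<gamma> \<odot> T \<gamma> \<eta> = T \<beta> \<eta>"
    if "\<beta> \<in> underS \<kappa> \<alpha>" for \<beta>
    using IH[OF that] underS_Field[OF that] by (auto simp: chain_step_def Z_def T_def p_def split: prod.splits)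
  have T: "T \<beta> \<gamma> \<in> hom C (Z \<gamma>) (Z \<beta>)" and pT: "p \<beta> \<odot> T \<beta> \<gamma> = p \<gamma>" if "\<beta> \<in> underS \<kappa> \<alpha>" "(\<gamma>, \<beta>) \<in> \<kappa>" for \<beta> \<gamma>
    using T'[OF that(1), of \<gamma>] Tid[OF that(1)] Z[OF that(1)] comp_ident[OF p[OF that(1)]] that(2)
    by (cases "\<gamma> = \<beta>", auto simp: underS_def)+
  have TT: "T \<beta> \<gamma> \<odot> T \<gamma> \<eta> = T \<beta> \<eta>" if "\<beta> \<in> underS \<kappa> \<alpha>" "(\<gamma>, \<beta>) \<in> \<kappa>" "(\<eta>, \<gamma>) \<in> \<kappa>" for \<beta> \<gamma> \<eta>
  proof -
    have \<gamma>: "\<gamma> \<in> underS \<kappa> \<alpha>" using \<kappa>_underS_trans'[OF that(2,1)] .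
    have "(\<eta>, \<beta>) \<in> \<kappa>" using \<kappa>_facts(2) that by blast
    then show ?thesis
      using Tid[OF that(1)] Tid[OF \<gamma>] TT'[OF that(1), of \<gamma> \<eta>] comp_ident[OF T[OF that(1,2)]]
        ident_comp[OF T[OF that(1)], of \<eta>] that(2,3)
      by (cases "\<gamma> = \<beta>"; cases "\<eta> = \<gamma>") (auto simp: underS_def)
  qed
  consider "underS \<kappa> \<alpha> = {}" | \<gamma> where "immediate_succ \<kappa> \<gamma> \<alpha>" | "limit_element \<kappa> \<alpha>"
    using \<alpha> unfolding limit_element_def by blast
  then show ?thesis
  proof cases
    case 1
    then have "\<not> immediate_succ \<kappa> \<gamma> \<alpha>" "\<not> limit_element \<kappa> \<alpha>" for \<gamma>
      by (auto simp: immediate_succ_def limit_element_def)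
    then have "chain_step K y x0 f e enc F \<alpha> (x0, \<lambda>_. Ident C x0, f)"
      using 1 f hom_obj[OF f] by (simp add: chain_step_def)
    then show ?thesis ..
  next
    case (2 \<gamma>)
    have \<gamma>: "\<gamma> \<in> underS \<kappa> \<alpha>" and le\<gamma>: "\<And>\<beta>. \<beta> \<in> underS \<kappa> \<alpha> \<Longrightarrow> (\<beta>, \<gamma>) \<in> \<kappa>"
      using 2 by (auto simp: immediate_succ_def)
    have \<gamma>_uniq: "\<gamma>' = \<gamma>" if "immediate_succ \<kappa> \<gamma>' \<alpha>" for \<gamma>'
      using that 2 \<kappa>_facts(3) by (auto simp: immediate_succ_def)
    \<comment> \<open>The scheduled problem. Injectivity of \<open>enc\<close> makes it unique, so
      attaching a single cell settles all clauses of the successor condition.\<close>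
    define match where "match = (\<lambda>k u v. (fst (e \<gamma>), \<gamma>) \<in> \<kappa> \<and> (k, u, v) \<in> squares C K y (Z (fst (e \<gamma>))) (p (fst (e \<gamma>))) \<and>
      enc (Z (fst (e \<gamma>))) (p (fst (e \<gamma>))) (k, u, v) = snd (e \<gamma>))"
    have match_uniq: "k = k' \<and> u = u' \<and> v = v'" if "match k u v" "match k' u' v'" for k u v k' u' v'
      using inj_onD[OF enc[of "Z (fst (e \<gamma>))" "p (fst (e \<gamma>))"], of "(k, u, v)" "(k', u', v')"] that by (simp add: match_def)
    \<comment> \<open>The problem may have been posed at an earlier stage; it is carried to
      \<open>\<gamma>\<close> by composing its top map with the transition.\<close>
    have match_sq: "(k, T \<gamma> (fst (e \<gamma>)) \<odot> u, v) \<in> squares C K y (Z \<gamma>) (p \<gamma>)" if "match k u v" for k u v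
    proof -
      have m: "(fst (e \<gamma>), \<gamma>) \<in> \<kappa>" "k \<in> K" "u \<in> hom C (Dom C k) (Z (fst (e \<gamma>)))" "v \<in> hom C (Cod C k) y" "p (fst (e \<gamma>)) \<odot> u = v \<odot> k"
        using that by (auto simp: match_def squares_def)
      show ?thesis
        using m comp_assoc[OF p[OF \<gamma>] T[OF \<gamma> m(1)] m(3)] pT[OF \<gamma> m(1)] comp_hom[OF T[OF \<gamma> m(1)] m(3)]
        by (auto simp: squares_def)
    qed
    have "\<exists>z g q. g \<in> hom C (Z \<gamma>) z \<and> q \<in> hom C z y \<and> q \<odot> g = p \<gamma> \<and>
      (squares C K y (Z \<gamma>) (p \<gamma>) \<noteq> {} \<longrightarrow> g \<in> pushouts_of C K) \<and>
      (\<forall>k u v. match k u v \<longrightarrow> (\<exists>w \<in> hom C (Cod C k) z. w \<odot> k = g \<odot> T \<gamma> (fst (e \<gamma>)) \<odot> u \<and> q \<odot> w = v))"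
    proof (cases "\<exists>k u v. match k u v")
      case True
      then obtain k u v where m: "match k u v" by blast
      obtain z g q w where "g \<in> hom C (Z \<gamma>) z" "q \<in> hom C z y" "q \<odot> g = p \<gamma>" "g \<in> pushouts_of C K"
        "w \<in> hom C (Cod C k) z" "w \<odot> k = g \<odot> T \<gamma> (fst (e \<gamma>)) \<odot> u" "q \<odot> w = v"
        by (rule attach_cell[OF K p[OF \<gamma>] match_sq[OF m]])
      moreover have "k' = k \<and> u' = u \<and> v' = v" if "match k' u' v'" for k' u' v'
        using match_uniq[OF that m] .
      ultimately show ?thesis by metis
    next
      case no: False
      show ?thesis
      proof (cases "squares C K y (Z \<gamma>) (p \<gamma>) = {}")
        case True
        then show ?thesis
          using no ident_hom[OF Z[OF \<gamma>]] p[OF \<gamma>] comp_ident[OF p[OF \<gamma>]] by metis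
      next
        case False
        \<comment> \<open>Nothing is scheduled, yet some cell is attached, so that the step is a
          pushout of a member of \<open>K\<close>.\<close>
        then obtain k u v where "(k, u, v) \<in> squares C K y (Z \<gamma>) (p \<gamma>)" by auto
        from attach_cell[OF K p[OF \<gamma>] this] obtain z g q where
          "g \<in> hom C (Z \<gamma>) z" "q \<in> hom C z y" "q \<odot> g = p \<gamma>" "g \<in> pushouts_of C K" by metis
        then show ?thesis using no by metis
      qed
    qed
    then obtain z g q where g: "g \<in> hom C (Z \<gamma>) z" and q: "q \<in> hom C z y" "q \<odot> g = p \<gamma>"
      and push: "squares C K y (Z \<gamma>) (p \<gamma>) \<noteq> {} \<Longrightarrow> g \<in> pushouts_of C K"
      and match: "\<And>k u v. match k u v \<Longrightarrow> \<exists>w \<in> hom C (Cod C k) z. w \<odot> k = g \<odot> T \<gamma> (fst (e \<gamma>)) \<odot> u \<and> q \<odot> w = v"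
      by metis
    define S where "S = (\<lambda>\<beta>. if \<beta> = \<alpha> then Ident C z else g \<odot> T \<gamma> \<beta>)"
    have S: "S \<beta> = g \<odot> T \<gamma> \<beta>" if "\<beta> \<in> underS \<kappa> \<alpha>" for \<beta>
      using that by (auto simp: S_def underS_def)
    have "chain_step K y x0 f e enc F \<alpha> (z, S, q)"
      unfolding chain_step_def split F
    proof (intro impI conjI ballI allI)
      fix \<beta> assume \<beta>: "\<beta> \<in> underS \<kappa> \<alpha>"
      show "S \<beta> \<in> hom C (Z \<beta>) z" using S[OF \<beta>] g T[OF \<gamma> le\<gamma>[OF \<beta>]] by auto
      show "q \<odot> S \<beta> = p \<beta>"
        using S[OF \<beta>] comp_assoc[OF q(1) g T[OF \<gamma> le\<gamma>[OF \<beta>]]] q(2) pT[OF \<gamma> le\<gamma>[OF \<beta>]] by simp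
      fix \<eta> assume \<eta>: "\<eta> \<in> underS \<kappa> \<beta>"
      then have \<eta>\<beta>: "(\<eta>, \<beta>) \<in> \<kappa>" by (simp add: underS_def)
      show "S \<beta> \<odot> T \<beta> \<eta> = S \<eta>"
        using S[OF \<beta>] S[OF \<kappa>_underS_trans'[OF \<eta>\<beta> \<beta>]] comp_assoc[OF g T[OF \<gamma> le\<gamma>[OF \<beta>]] T[OF \<beta> \<eta>\<beta>]]
          TT[OF \<gamma> le\<gamma>[OF \<beta>] \<eta>\<beta>] by simp
    next
      fix \<gamma>' assume g': "immediate_succ \<kappa> \<gamma>' \<alpha>"
      note \<gamma>' = \<gamma>_uniq[OF g']
      { assume "squares C K y (Z \<gamma>') (p \<gamma>') \<noteq> {}"
        then show "S \<gamma>' \<in> pushouts_of C K"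
          using push S[OF \<gamma>] Tid[OF \<gamma>] comp_ident[OF g] \<gamma>' by simp }
      fix \<beta> k u v assume \<beta>: "\<beta> = fst (e \<gamma>')" "(\<beta>, \<gamma>') \<in> \<kappa>" "(k, u, v) \<in> squares C K y (Z \<beta>) (p \<beta>)"
        "enc (Z \<beta>) (p \<beta>) (k, u, v) = snd (e \<gamma>')"
      then have m: "match k u v" using \<gamma>' by (simp add: match_def)
      have u: "u \<in> hom C (Dom C k) (Z \<beta>)" using \<beta>(3) by (simp add: squares_def)
      have \<beta>\<gamma>: "(\<beta>, \<gamma>) \<in> \<kappa>" using \<beta>(2) \<gamma>' by simp
      show "\<exists>w\<in>hom C (Cod C k) z. w \<odot> k = S \<beta> \<odot> u \<and> q \<odot> w = v"
        using match[OF m] S[OF \<kappa>_underS_trans'[OF \<beta>\<gamma> \<gamma>]] comp_assoc[OF g T[OF \<gamma> \<beta>\<gamma>] u] \<beta>(1) \<gamma>' by simp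
    next
      assume "limit_element \<kappa> \<alpha>"
      then show "is_colimit C (poset_cat (Restr \<kappa> (underS \<kappa> \<alpha>))) Z (\<lambda>u. T (snd u) (fst u)) z S"
        using 2 by (auto simp: limit_element_def)
    qed (use \<gamma> q(1) hom_obj[OF g] in \<open>auto simp: S_def\<close>)
    then show ?thesis ..
  next
    case 3
    let ?D = "poset_cat (Restr \<kappa> (underS \<kappa> \<alpha>))" and ?FA = "\<lambda>u. T (snd u) (fst u)"
    have smU: "small \<kappa> (underS \<kappa> \<alpha>)" by (rule small_underS[OF \<alpha>])
    have "small \<kappa> (Restr \<kappa> (underS \<kappa> \<alpha>))"
      by (rule small_mono[OF small_Times[OF smU smU]]) blast
    then have "\<exists>z c. is_colimit C ?D Z ?FA z c"
      by (intro graph_colimit) (use smU Z T Field_Restr_underS[OF wo_\<kappa>, of \<alpha>] in auto)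
    then obtain z c where c: "is_colimit C ?D Z ?FA z c" by blast
    have ch: "c \<beta> \<in> hom C (Z \<beta>) z" if "\<beta> \<in> underS \<kappa> \<alpha>" for \<beta>
      using colimit_hom[OF c, of \<beta>] that Field_Restr_underS[OF wo_\<kappa>, of \<alpha>] by simp
    have cc: "c \<beta> \<odot> T \<beta> \<gamma> = c \<gamma>" if "\<beta> \<in> underS \<kappa> \<alpha>" "\<gamma> \<in> underS \<kappa> \<alpha>" "(\<gamma>, \<beta>) \<in> \<kappa>" for \<beta> \<gamma>
      using colimit_compat[OF c, of "(\<gamma>, \<beta>)"] that by simp
    have "is_cocone C ?D Z ?FA y p"
      unfolding is_cocone_def using p pT hom_obj[OF f] Field_Restr_underS[OF wo_\<kappa>, of \<alpha>] by auto
    from colimit_factor[OF c this] obtain q where q: "q \<in> hom C z y" "\<And>\<beta>. \<beta> \<in> underS \<kappa> \<alpha> \<Longrightarrow> q \<odot> c \<beta> = p \<beta>"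
      using Field_Restr_underS[OF wo_\<kappa>, of \<alpha>] by auto
    \<comment> \<open>The colimit over the earlier stages says nothing about the value of
      \<open>c\<close> at \<open>\<alpha>\<close> itself.\<close>
    define S where "S = c(\<alpha> := Ident C z)"
    have S: "S \<beta> = c \<beta>" if "\<beta> \<in> underS \<kappa> \<alpha>" for \<beta> using that by (auto simp: S_def underS_def)
    have "chain_step K y x0 f e enc F \<alpha> (z, S, q)"
      unfolding chain_step_def split F
    proof (intro impI conjI ballI allI)
      fix \<beta> \<eta> assume \<beta>: "\<beta> \<in> underS \<kappa> \<alpha>" and \<eta>: "\<eta> \<in> underS \<kappa> \<beta>"
      then have \<eta>\<beta>: "(\<eta>, \<beta>) \<in> \<kappa>" by (simp add: underS_def)
      show "S \<beta> \<odot> T \<beta> \<eta> = S \<eta>"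
        using S[OF \<beta>] S[OF \<kappa>_underS_trans'[OF \<eta>\<beta> \<beta>]] cc[OF \<beta> \<kappa>_underS_trans'[OF \<eta>\<beta> \<beta>] \<eta>\<beta>] by simp
    next
      show "is_colimit C ?D Z ?FA z S"
        by (rule colimit_cong[OF c]) (auto simp: S Field_Restr_underS[OF wo_\<kappa>])
    qed (use 3 q colimit_obj[OF c] S ch in \<open>auto simp: S_def limit_element_def\<close>)
    then show ?thesis ..
  qed
qed

text \<open>Turns the recursion into a functor on \<open>\<kappa>\<close> over \<open>y\<close>.
  Identities and non-strict transitions are treated apart, because the step condition speaks of
  strictly earlier stages.\<close>

lemma attaching_chain:
  fixes e :: "'k \<Rightarrow> 'k \<times> 'k" and enc :: "'o \<Rightarrow> 'm \<Rightarrow> 'm \<times> 'm \<times> 'm \<Rightarrow> 'k"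
  assumes K: "K \<subseteq> Arr C" and f: "f \<in> hom C x0 y"
    and enc: "\<And>z p. inj_on (enc z p) (squares C K y z p)"
  obtains Z FA p where "is_functor (poset_cat \<kappa>) C Z FA"
    "\<And>a. a \<in> Field \<kappa> \<Longrightarrow> p a \<in> hom C (Z a) y" "\<And>a b. (a, b) \<in> \<kappa> \<Longrightarrow> p b \<odot> FA (a, b) = p a"
    "\<And>a. a \<in> Field \<kappa> \<Longrightarrow> underS \<kappa> a = {} \<Longrightarrow> Z a = x0 \<and> p a = f"
    "\<And>b. limit_element \<kappa> b \<Longrightarrow>
      is_colimit C (poset_cat (Restr \<kappa> (underS \<kappa> b))) Z FA (Z b) (\<lambda>a. FA (a, b))"
    "\<And>a b. immediate_succ \<kappa> a b \<Longrightarrow> squares C K y (Z a) (p a) \<noteq> {} \<Longrightarrow> FA (a, b) \<in> pushouts_of C K"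
    "\<And>a b c k u v. immediate_succ \<kappa> a b \<Longrightarrow> (c, a) \<in> \<kappa> \<Longrightarrow> (k, u, v) \<in> squares C K y (Z c) (p c) \<Longrightarrow>
      e a = (c, enc (Z c) (p c) (k, u, v)) \<Longrightarrow> \<exists>w\<in>hom C (Cod C k) (Z b). w \<odot> k = FA (c, b) \<odot> u \<and> p b \<odot> w = v"
proof -
  let ?P = "chain_step K y x0 f e enc"
  have "\<exists>F. \<forall>\<alpha>. ?P F \<alpha> (F \<alpha>)"
  proof (rule dependent_wf_choice[OF \<kappa>_facts(7)])
    show "?P F \<alpha> v = ?P G \<alpha> v" if "\<And>\<beta>. (\<beta>, \<alpha>) \<in> \<kappa> - Id \<Longrightarrow> F \<beta> = G \<beta>" for F G \<alpha> v
    proof -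
      have FG: "F \<beta> = G \<beta>" if "\<beta> \<in> underS \<kappa> \<alpha>" for \<beta> using \<open>\<And>\<beta>. _ \<Longrightarrow> F \<beta> = G \<beta>\<close> that by (simp add: underS_def)
      show ?thesis using chain_step_cong[of \<alpha> F G] chain_step_cong[of \<alpha> G F] FG by metis
    qed
    show "\<exists>v. ?P F \<alpha> v" if "\<And>\<beta>. (\<beta>, \<alpha>) \<in> \<kappa> - Id \<Longrightarrow> ?P F \<beta> (F \<beta>)" for F \<alpha>
      by (rule chain_step_exists[OF K f enc]) (use that in \<open>simp add: underS_def\<close>)
  qed
  then obtain F where F: "\<And>\<alpha>. ?P F \<alpha> (F \<alpha>)" by blast
  define Z where "Z = (\<lambda>\<beta>. fst (F \<beta>))"
  \<comment> \<open>Transition morphisms are stored with their target stage.\<close>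
  define FA where "FA = (\<lambda>u. fst (snd (F (snd u))) (fst u))"
  define p where "p = (\<lambda>\<beta>. snd (snd (F \<beta>)))"
  have eqs: "fst (F \<beta>) = Z \<beta>" "fst (snd (F \<beta>)) \<gamma> = FA (\<gamma>, \<beta>)" "snd (snd (F \<beta>)) = p \<beta>" for \<beta> \<gamma>
    by (simp_all add: Z_def FA_def p_def)
  have lim: "is_colimit C (poset_cat (Restr \<kappa> (underS \<kappa> b))) Z FA (Z b) (\<lambda>a. FA (a, b))" if b: "limit_element \<kappa> b" for b
  proof -
    have "is_colimit C (poset_cat (Restr \<kappa> (underS \<kappa> b))) (\<lambda>\<beta>. fst (F \<beta>))
      (\<lambda>u. fst (snd (F (snd u))) (fst u)) (fst (F b)) (fst (snd (F b)))"
      using F[of b] b by (auto simp: chain_step_def limit_element_def split: prod.splits)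
    then show ?thesis by (simp add: Z_def FA_def)
  qed
  note F' = F[unfolded chain_step_def case_prod_beta, simplified eqs, rule_format]
  have Z: "Z a \<in> Obj C" and FAid: "FA (a, a) = Ident C (Z a)" and p: "p a \<in> hom C (Z a) y" if "a \<in> Field \<kappa>" for a
    using F'[OF that] by simp_all
  have FA: "FA (a, b) \<in> hom C (Z a) (Z b)" and pFA: "p b \<odot> FA (a, b) = p a" if ab: "(a, b) \<in> \<kappa>" for a b
  proof -
    note b = \<kappa>_facts(6)[OF ab]
    have "FA (a, b) \<in> hom C (Z a) (Z b) \<and> p b \<odot> FA (a, b) = p a"
    proof (cases "a = b")
      case True
      then show ?thesis using FAid[OF b] Z[OF b] comp_ident[OF p[OF b]] by simp
    next
      case False
      then have "a \<in> underS \<kappa> b" using ab by (simp add: underS_def)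
      then show ?thesis using F'[OF b] by blast
    qed
    then show "FA (a, b) \<in> hom C (Z a) (Z b)" "p b \<odot> FA (a, b) = p a" by auto
  qed
  have FAc: "FA (b, c) \<odot> FA (a, b) = FA (a, c)" if ab: "(a, b) \<in> \<kappa>" and bc: "(b, c) \<in> \<kappa>" for a b c
  proof -
    note f = \<kappa>_facts(6)[OF ab] \<kappa>_facts(6)[OF bc]
    have ac: "(a, c) \<in> \<kappa>" using \<kappa>_facts(2)[OF ab bc] .
    show ?thesis
    proof (cases "a = b \<or> b = c")
      case True
      then show ?thesis
        using FAid[OF f(1)] comp_ident[OF FA[OF bc]] FAid[OF f(2)] ident_comp[OF FA[OF ab]] by auto
    next
      case False
      then have "a \<in> underS \<kappa> b" "b \<in> underS \<kappa> c" using ab bc by (auto simp: underS_def)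
      then show ?thesis using F'[OF f(2)] by blast
    qed
  qed
  show ?thesis
  proof (rule that[of Z FA p])
    show "is_functor (poset_cat \<kappa>) C Z FA"
    proof (rule functorI[OF category_poset_cat category])
      show "Partial_order \<kappa>" using wo_\<kappa> by (simp add: order_on_defs)
    qed (use Z FA FAid FAc in auto)
    show "Z a = x0 \<and> p a = f" if "a \<in> Field \<kappa>" "underS \<kappa> a = {}" for a
      using F'[OF that(1)] that(2) by blast
    show "FA (a, b) \<in> pushouts_of C K" if "immediate_succ \<kappa> a b" "squares C K y (Z a) (p a) \<noteq> {}" for a b
    proof -
      have "b \<in> Field \<kappa>" using that(1) \<kappa>_facts(6) by (auto simp: immediate_succ_def underS_def)
      from F'[OF this] that show ?thesis by blast
    qed
    show "\<exists>w\<in>hom C (Cod C k) (Z b). w \<odot> k = FA (c, b) \<odot> u \<and> p b \<odot> w = v"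
      if "immediate_succ \<kappa> a b" "(c, a) \<in> \<kappa>" "(k, u, v) \<in> squares C K y (Z c) (p c)"
        "e a = (c, enc (Z c) (p c) (k, u, v))" for a b c k u v
    proof -
      have "b \<in> Field \<kappa>" using that(1) \<kappa>_facts(6) by (auto simp: immediate_succ_def underS_def)
      note F'[OF this, THEN conjunct2, THEN conjunct2, THEN conjunct2, THEN conjunct2, THEN conjunct2,
        THEN conjunct1, THEN spec, THEN mp, OF that(1), THEN conjunct2, THEN spec, THEN spec, THEN spec, THEN spec, of c k u v]
      then show ?thesis using that(2-4) by simp
    qed
  qed (use p pFA lim in blast)+
qed

end

section \<open>Cutting a chain at an initial segment\<close>

context inaccessible_cardinal
begin

text \<open>Transfinite compositions have small index, while the chain runs along
  \<open>\<kappa>\<close>. A downward closed \<open>D\<close> sees the same predecessors as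
  \<open>\<kappa>\<close>, so successor and limit conditions pass to the segment.\<close>

lemma
  assumes D: "D \<subseteq> Field \<kappa>" "\<And>a b. (a, b) \<in> \<kappa> \<Longrightarrow> b \<in> D \<Longrightarrow> a \<in> D"
  shows Field_segment: "Field (Restr \<kappa> D) = D"
    and immediate_succ_segment: "immediate_succ (Restr \<kappa> D) a b \<longleftrightarrow> b \<in> D \<and> immediate_succ \<kappa> a b"
    and limit_element_segment: "limit_element (Restr \<kappa> D) b \<longleftrightarrow> b \<in> D \<and> limit_element \<kappa> b"
    and Restr_underS_segment: "b \<in> D \<Longrightarrow> Restr (Restr \<kappa> D) (underS (Restr \<kappa> D) b) = Restr \<kappa> (underS \<kappa> b)"
proof -
  show F: "Field (Restr \<kappa> D) = D"
    by (rule Refl_Field_Restr2) (use wo_\<kappa> D(1) in \<open>auto simp: order_on_defs\<close>)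
  have u: "underS (Restr \<kappa> D) b = underS \<kappa> b" if "b \<in> D" for b
    using D(2) that by (auto simp: underS_def)
  have sub: "underS \<kappa> b \<subseteq> D" if "b \<in> D" for b
    using D(2) that by (auto simp: underS_def)
  show i: "immediate_succ (Restr \<kappa> D) a b \<longleftrightarrow> b \<in> D \<and> immediate_succ \<kappa> a b" for a b
  proof (cases "b \<in> D")
    case True
    then show ?thesis using u[OF True] sub[OF True] by (auto simp: immediate_succ_def)
  next
    case False
    then show ?thesis by (auto simp: immediate_succ_def underS_def)
  qed
  show "limit_element (Restr \<kappa> D) b \<longleftrightarrow> b \<in> D \<and> limit_element \<kappa> b"
    using D(1) u[of b] by (auto simp: limit_element_def F i)
  show "Restr (Restr \<kappa> D) (underS (Restr \<kappa> D) b) = Restr \<kappa> (underS \<kappa> b)" if "b \<in> D"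
    unfolding u[OF that] using sub[OF that] by auto
qed

end

context small_cocomplete
begin

lemma transfinite_composition_segment:
  assumes D: "D \<subseteq> Field \<kappa>" "\<And>a b. (a, b) \<in> \<kappa> \<Longrightarrow> b \<in> D \<Longrightarrow> a \<in> D" "small \<kappa> D"
    and z: "z \<in> D" "\<And>a. a \<in> D \<Longrightarrow> (z, a) \<in> \<kappa>"
    and F: "is_functor (poset_cat \<kappa>) C Z FA"
    and succ: "\<And>a b. b \<in> D \<Longrightarrow> immediate_succ \<kappa> a b \<Longrightarrow> FA (a, b) \<in> K"
    and lim: "\<And>b. limit_element \<kappa> b \<Longrightarrow>
      is_colimit C (poset_cat (Restr \<kappa> (underS \<kappa> b))) Z FA (Z b) (\<lambda>a. FA (a, b))"
    and c: "is_colimit C (poset_cat (Restr \<kappa> D)) Z FA x c"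
  shows "c z \<in> transfinite_compositions \<kappa> C K"
proof -
  have r: "Well_order (Restr \<kappa> D)" by (rule Well_order_Restr[OF wo_\<kappa>])
  have "is_functor (poset_cat (Restr \<kappa> D)) C Z FA"
  proof (rule functorI[OF category_poset_cat category])
    show "Partial_order (Restr \<kappa> D)" using r by (simp add: order_on_defs)
    fix a assume "a \<in> Obj (poset_cat (Restr \<kappa> D))"
    then have "a \<in> Field \<kappa>" using D(1) Field_segment[OF D(1,2)] by auto
    then show "Z a \<in> Obj C" "FA (Ident (poset_cat (Restr \<kappa> D)) a) = Ident C (Z a)"
      using functor_obj[OF F, of a] functor_ident[OF F, of a] by auto
  next
    fix u assume "u \<in> Arr (poset_cat (Restr \<kappa> D))"
    then show "FA u \<in> hom C (Z (Dom (poset_cat (Restr \<kappa> D)) u)) (Z (Cod (poset_cat (Restr \<kappa> D)) u))"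
      using functor_arr[OF F, of u] by simp
    fix v assume "v \<in> Arr (poset_cat (Restr \<kappa> D))" "Dom (poset_cat (Restr \<kappa> D)) v = Cod (poset_cat (Restr \<kappa> D)) u"
    then show "FA (Comp (poset_cat (Restr \<kappa> D)) v u) = FA v \<odot> FA u"
      using functor_comp[OF F, of u v] \<open>u \<in> _\<close> by simp
  qed
  moreover have "is_colimit C (poset_cat (Restr (Restr \<kappa> D) (underS (Restr \<kappa> D) b))) Z FA (Z b) (\<lambda>a. FA (a, b))"
    if "limit_element (Restr \<kappa> D) b" for b
    using that lim[of b] Restr_underS_segment[OF D(1,2)] limit_element_segment[OF D(1,2)] by simp
  moreover have "FA (a, b) \<in> K" if "immediate_succ (Restr \<kappa> D) a b" for a b
    using that succ immediate_succ_segment[OF D(1,2)] by simp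
  ultimately show ?thesis
    unfolding transfinite_compositions_def mem_Collect_eq
    using r z D(3) c Field_segment[OF D(1,2)]
    by (intro exI[of _ "Restr \<kappa> D"] exI[of _ z] exI[of _ Z] exI[of _ FA] exI[of _ x] exI[of _ c]) auto
qed

text \<open>The stage \<open>a\<close> is the largest element of the segment, hence terminal in its
  shape. This serves the case where the chain stops at a stage without lifting problems.\<close>

lemma colimit_of_top:
  assumes F: "is_functor (poset_cat \<kappa>) C Z FA" and a: "a \<in> Field \<kappa>"
  shows "is_colimit C (poset_cat (Restr \<kappa> (under \<kappa> a))) Z FA (Z a) (\<lambda>b. FA (b, a))"
proof -
  have Fld: "Field (Restr \<kappa> (under \<kappa> a)) = under \<kappa> a"
    by (rule Field_segment) (use \<kappa>_facts(2,5) in \<open>auto simp: under_def\<close>)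
  have aa: "(a, a) \<in> \<kappa>" by (rule \<kappa>_facts(1)[OF a])
  have id: "FA (a, a) = Ident C (Z a)" using functor_ident[OF F] a by simp
  show ?thesis
    unfolding is_colimit_def
  proof (intro conjI allI impI)
    show "is_cocone C (poset_cat (Restr \<kappa> (under \<kappa> a))) Z FA (Z a) (\<lambda>b. FA (b, a))"
      using functor_obj[OF F] a Fld chain_hom[OF F] chain_comp[OF F] by (auto simp: is_cocone_def under_def)
    fix y d assume d: "is_cocone C (poset_cat (Restr \<kappa> (under \<kappa> a))) Z FA y d"
    have da: "d a \<in> hom C (Z a) y" using cocone_hom[OF d, of a] Fld aa by (simp add: under_def)
    show "\<exists>!h. h \<in> hom C (Z a) y \<and> (\<forall>b\<in>Obj (poset_cat (Restr \<kappa> (under \<kappa> a))). h \<odot> FA (b, a) = d b)"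
    proof (rule ex1I[of _ "d a"])
      show "d a \<in> hom C (Z a) y \<and> (\<forall>b\<in>Obj (poset_cat (Restr \<kappa> (under \<kappa> a))). d a \<odot> FA (b, a) = d b)"
      proof (intro conjI ballI)
        fix b assume "b \<in> Obj (poset_cat (Restr \<kappa> (under \<kappa> a)))"
        then have "(b, a) \<in> \<kappa>" using Fld by (simp add: under_def)
        then show "d a \<odot> FA (b, a) = d b" using cocone_compat[OF d, of "(b, a)"] aa by (simp add: under_def)
      qed (rule da)
      fix h assume "h \<in> hom C (Z a) y \<and> (\<forall>b\<in>Obj (poset_cat (Restr \<kappa> (under \<kappa> a))). h \<odot> FA (b, a) = d b)"
      then have h: "h \<in> hom C (Z a) y" "h \<odot> FA (a, a) = d a" using aa Fld by (auto simp: under_def)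
      then show "h = d a" using id comp_ident[OF h(1)] by simp
    qed
  qed
qed

end

context presentable_category
begin

text \<open>Cells are attached one at a time along \<open>\<kappa>\<close>.  Either some stage has no lifting problem
  left, or the chain is cut at a stage \<open>\<delta>\<close> below which every lifting problem of an earlier stage is
  solved and whose cofinality exceeds the presentability ranks of the domains in \<open>K\<close>.\<close>

lemma small_object_argument:
  assumes K: "small \<kappa> K" "K \<subseteq> Arr C" and f: "f \<in> Arr C"
  shows "\<exists>h \<in> transfinite_compositions \<kappa> C (pushouts_of C K). \<exists>g \<in> rlp C K. Dom C g = Cod C h \<and> f = g \<odot> h"
proof -
  let ?x = "Dom C f" and ?y = "Cod C f" and ?tc = "transfinite_compositions \<kappa> C (pushouts_of C K)"
  let ?sq = "squares C K ?y"
  have f: "f \<in> hom C ?x ?y" by (rule arr_hom[OF f])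
  have "\<exists>\<phi>. inj_on \<phi> (?sq z p) \<and> \<phi> ` ?sq z p \<subseteq> Field \<kappa>" for z p
    by (rule small_embedding[OF small_squares[OF K(1), of ?y z p]]) blast
  then obtain enc :: "'o \<Rightarrow> 'm \<Rightarrow> 'm \<times> 'm \<times> 'm \<Rightarrow> 'k" where
    enc: "\<And>z p. inj_on (enc z p) (?sq z p)" "\<And>z p s. s \<in> ?sq z p \<Longrightarrow> enc z p s \<in> Field \<kappa>"
    by (metis image_subset_iff)
  obtain e :: "'k \<Rightarrow> 'k \<times> 'k" where e: "\<And>\<beta> \<xi>. \<beta> \<in> Field \<kappa> \<Longrightarrow> \<xi> \<in> Field \<kappa> \<Longrightarrow> \<exists>\<gamma>. (\<beta>, \<gamma>) \<in> \<kappa> \<and> e \<gamma> = (\<beta>, \<xi>)"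
    using bookkeeping by metis
  obtain Z FA p where F: "is_functor (poset_cat \<kappa>) C Z FA"
    and p: "\<And>a. a \<in> Field \<kappa> \<Longrightarrow> p a \<in> hom C (Z a) ?y" and pFA: "\<And>a b. (a, b) \<in> \<kappa> \<Longrightarrow> p b \<odot> FA (a, b) = p a"
    and zero: "\<And>a. a \<in> Field \<kappa> \<Longrightarrow> underS \<kappa> a = {} \<Longrightarrow> Z a = ?x \<and> p a = f"
    and lim: "\<And>b. limit_element \<kappa> b \<Longrightarrow>
      is_colimit C (poset_cat (Restr \<kappa> (underS \<kappa> b))) Z FA (Z b) (\<lambda>a. FA (a, b))"
    and push: "\<And>a b. immediate_succ \<kappa> a b \<Longrightarrow> ?sq (Z a) (p a) \<noteq> {} \<Longrightarrow> FA (a, b) \<in> pushouts_of C K"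
    and solve: "\<And>a b c k u v. immediate_succ \<kappa> a b \<Longrightarrow> (c, a) \<in> \<kappa> \<Longrightarrow> (k, u, v) \<in> ?sq (Z c) (p c) \<Longrightarrow>
      e a = (c, enc (Z c) (p c) (k, u, v)) \<Longrightarrow> \<exists>w\<in>hom C (Cod C k) (Z b). w \<odot> k = FA (c, b) \<odot> u \<and> p b \<odot> w = v"
    by (rule attaching_chain[OF K(2) f enc(1), where e = e]) (rule that, (assumption | simp)+)
  obtain a0 where "a0 \<in> Field \<kappa>" using infinite_\<kappa> by fastforce
  then obtain z where z: "z \<in> Field \<kappa>" "\<And>b. (b, z) \<in> \<kappa> - Id \<Longrightarrow> b \<notin> Field \<kappa>"
    using wfE_min[OF \<kappa>_facts(7)] by metis
  have z_least: "(z, a) \<in> \<kappa>" if "a \<in> Field \<kappa>" for a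
    using z(2)[of a] \<kappa>_underS_linear[OF that z(1)] that by (auto simp: underS_def)
  have "underS \<kappa> z = {}" using z(2) \<kappa>_facts(5) by (auto simp: underS_def)
  then have Zz: "Z z = ?x" "p z = f" using zero[OF z(1)] by auto
  have arrow: "a \<in> Field \<kappa> \<and> FA (z, a) \<in> hom C ?x (Z a) \<and> f = p a \<odot> FA (z, a)" if "a \<in> Field \<kappa>" for a
    using chain_hom[OF F z_least[OF that]] pFA[OF z_least[OF that]] Zz that by simp
  have finish: ?thesis if "a \<in> Field \<kappa>" "FA (z, a) \<in> ?tc" "p a \<in> rlp C K" for a
    using that arrow[OF that(1)] hom_dom[OF p[OF that(1)]] hom_cod[of "FA (z, a)" ?x "Z a"] by metis
  show ?thesis
  proof (cases "\<exists>a \<in> Field \<kappa>. ?sq (Z a) (p a) = {}")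
    case True
    \<comment> \<open>The least stage without problems is taken: all earlier stages have one, so
      every step up to it is a pushout of a member of \<open>K\<close>.\<close>
    define U where "U = {a \<in> Field \<kappa>. ?sq (Z a) (p a) = {}}"
    obtain a' where "a' \<in> U" using True by (auto simp: U_def)
    then obtain a where aU: "a \<in> U" and minU: "\<And>b. (b, a) \<in> \<kappa> - Id \<Longrightarrow> b \<notin> U"
      using wfE_min[OF \<kappa>_facts(7)] by metis
    have a: "a \<in> Field \<kappa>" "?sq (Z a) (p a) = {}" using aU by (auto simp: U_def)
    have min: "?sq (Z b) (p b) \<noteq> {}" if "(b, a) \<in> \<kappa> - Id" for b
      using minU[OF that] \<kappa>_facts(5)[of b a] that by (simp add: U_def)
    have "FA (z, a) \<in> ?tc"
    proof (rule transfinite_composition_segment[where c = "\<lambda>b. FA (b, a)", OF _ _ _ _ _ F _ lim colimit_of_top[OF F a(1)]])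
      show "under \<kappa> a \<subseteq> Field \<kappa>" using \<kappa>_facts(5) by (auto simp: under_def)
      show "b \<in> under \<kappa> a" if "(b, c) \<in> \<kappa>" "c \<in> under \<kappa> a" for b c
        using that \<kappa>_facts(2) by (auto simp: under_def)
      have "small \<kappa> (underS \<kappa> a \<union> {a})" by (intro small_Un small_underS a(1) small_finite) simp
      then show "small \<kappa> (under \<kappa> a)" by (rule small_mono) (auto simp: under_def underS_def)
      show "z \<in> under \<kappa> a" using z_least[OF a(1)] by (simp add: under_def)
      show "(z, b) \<in> \<kappa>" if "b \<in> under \<kappa> a" for b using z_least that \<kappa>_facts(5) by (auto simp: under_def)
      show "FA (b, c) \<in> pushouts_of C K" if c: "c \<in> under \<kappa> a" and bc: "immediate_succ \<kappa> b c" for b c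
      proof -
        have "b \<in> underS \<kappa> a"
          using bc c \<kappa>_underS_trans[of b c a] by (auto simp: immediate_succ_def under_def)
        then show ?thesis using push[OF bc] min by (auto simp: underS_def)
      qed
    qed
    then show ?thesis using finish a(1) rlp_if_no_squares[OF p[OF a(1)] a(2)] by blast
  next
    case False
    obtain Q :: "('m \<times> ('k + 'k \<times> 'k) + nat) set" where
      Q: "small \<kappa> Q" "infinite Q" "\<And>k. k \<in> K \<Longrightarrow> chain_compact \<kappa> C Q (Dom C k)"
      using chain_compact_family[OF K] by blast
    obtain nxt where nxt: "\<And>a. a \<in> Field \<kappa> \<Longrightarrow> nxt a \<in> Field \<kappa> \<and> immediate_succ \<kappa> a (nxt a)"
      using successor_exists by metis
    have "\<exists>\<gamma>. (\<beta>, \<gamma>) \<in> \<kappa> \<and> e \<gamma> = (\<beta>, enc (Z \<beta>) (p \<beta>) s)" if "\<beta> \<in> Field \<kappa>" "s \<in> ?sq (Z \<beta>) (p \<beta>)" for \<beta> s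
      using e[OF that(1) enc(2)[OF that(2)]] .
    then obtain st where st: "\<And>\<beta> s. \<beta> \<in> Field \<kappa> \<Longrightarrow> s \<in> ?sq (Z \<beta>) (p \<beta>) \<Longrightarrow>
        (\<beta>, st \<beta> s) \<in> \<kappa> \<and> e (st \<beta> s) = (\<beta>, enc (Z \<beta>) (p \<beta>) s)" by metis
    \<comment> \<open>The closure function \<open>G\<close>: it exceeds every stage at which some
      problem posed at \<open>\<beta>\<close> has been solved. Exceeding \<open>nxt \<beta>\<close>
      as well prevents a closure point from being a successor.\<close>
    have "\<exists>b. b \<in> Field \<kappa> \<and> nxt \<beta> \<in> underS \<kappa> b \<and>
      (\<forall>s\<in>?sq (Z \<beta>) (p \<beta>). nxt (st \<beta> s) \<in> underS \<kappa> b)" if \<beta>: "\<beta> \<in> Field \<kappa>" for \<beta>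
    proof -
      have sm: "small \<kappa> ({nxt \<beta>} \<union> (\<lambda>s. nxt (st \<beta> s)) ` ?sq (Z \<beta>) (p \<beta>))"
        by (intro small_Un small_image small_squares K(1) small_finite) simp
      have "{nxt \<beta>} \<union> (\<lambda>s. nxt (st \<beta> s)) ` ?sq (Z \<beta>) (p \<beta>) \<subseteq> Field \<kappa>"
      proof -
        have "st \<beta> s \<in> Field \<kappa>" if "s \<in> ?sq (Z \<beta>) (p \<beta>)" for s
          using st[OF \<beta> that] \<kappa>_facts(6) by blast
        then show ?thesis using nxt \<beta> by blast
      qed
      with sm obtain b where "b \<in> Field \<kappa>"
        "{nxt \<beta>} \<union> (\<lambda>s. nxt (st \<beta> s)) ` ?sq (Z \<beta>) (p \<beta>) \<subseteq> underS \<kappa> b"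
        by (rule small_bounded)
      then show ?thesis by auto
    qed
    then obtain G where G: "\<And>\<beta>. \<beta> \<in> Field \<kappa> \<Longrightarrow> G \<beta> \<in> Field \<kappa>" "\<And>\<beta>. \<beta> \<in> Field \<kappa> \<Longrightarrow> nxt \<beta> \<in> underS \<kappa> (G \<beta>)"
      "\<And>\<beta> s. \<beta> \<in> Field \<kappa> \<Longrightarrow> s \<in> ?sq (Z \<beta>) (p \<beta>) \<Longrightarrow> nxt (st \<beta> s) \<in> underS \<kappa> (G \<beta>)"
      by metis
    obtain \<delta> where \<delta>: "\<delta> \<in> Field \<kappa>" "underS \<kappa> \<delta> \<noteq> {}" "\<And>\<beta>. \<beta> \<in> underS \<kappa> \<delta> \<Longrightarrow> G \<beta> \<in> underS \<kappa> \<delta>"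
      "wide Q (Restr \<kappa> (underS \<kappa> \<delta>))"
      using closure_point_exists[OF Q(1,2), of G] G(1) by metis
    \<comment> \<open>A predecessor \<open>a\<close> would satisfy
      \<open>a < nxt a < G a \<le> a\<close>. Hence the chain is continuous at
      \<open>\<delta>\<close>, and \<open>Z \<delta>\<close> is the colimit of the stages
      below.\<close>
    have "\<not> immediate_succ \<kappa> a \<delta>" for a
    proof
      assume a: "immediate_succ \<kappa> a \<delta>"
      then have a': "a \<in> underS \<kappa> \<delta>" "a \<in> Field \<kappa>" by (auto simp: immediate_succ_def intro: underS_Field)
      have "(G a, a) \<in> \<kappa>" using a \<delta>(3)[OF a'(1)] by (simp add: immediate_succ_def)
      moreover have "a \<in> underS \<kappa> (nxt a)" using nxt[OF a'(2)] by (simp add: immediate_succ_def)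
      ultimately have "a \<in> underS \<kappa> a"
        using G(2)[OF a'(2)] \<kappa>_underS_trans[of a "nxt a" "G a"] \<kappa>_underS_trans[of a "G a" a] by (auto simp: underS_def)
      then show False by (simp add: underS_def)
    qed
    then have "limit_element \<kappa> \<delta>" using \<delta>(1,2) by (simp add: limit_element_def)
    note L = lim[OF this]
    let ?r = "Restr \<kappa> (underS \<kappa> \<delta>)"
    have seg: "underS \<kappa> \<delta> \<subseteq> Field \<kappa>" "\<And>b c. (b, c) \<in> \<kappa> \<Longrightarrow> c \<in> underS \<kappa> \<delta> \<Longrightarrow> b \<in> underS \<kappa> \<delta>"
      by (auto intro: underS_Field \<kappa>_underS_trans')
    have tc: "FA (z, \<delta>) \<in> ?tc"
    proof (rule transfinite_composition_segment[where c = "\<lambda>b. FA (b, \<delta>)", OF seg(1) _ small_underS[OF \<delta>(1)] _ _ F _ lim L])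
      show "b \<in> underS \<kappa> \<delta>" if "(b, c) \<in> \<kappa>" "c \<in> underS \<kappa> \<delta>" for b c using seg(2)[OF that] .
      obtain b where b: "b \<in> underS \<kappa> \<delta>" using \<delta>(2) by blast
      then show "z \<in> underS \<kappa> \<delta>" using seg z_least by blast
      show "(z, b) \<in> \<kappa>" if "b \<in> underS \<kappa> \<delta>" for b using z_least that seg(1) by blast
      show "FA (b, c) \<in> pushouts_of C K" if "immediate_succ \<kappa> b c" for b c
      proof -
        have "b \<in> Field \<kappa>" using that by (auto simp: immediate_succ_def intro: underS_Field)
        then show ?thesis using push[OF that] False by blast
      qed
    qed
    have Fr: "is_functor (poset_cat ?r) C Z FA"
    proof (rule functorI[OF category_poset_cat category])
      show "Partial_order ?r" using Well_order_Restr[OF wo_\<kappa>] by (simp add: order_on_defs)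
    qed (use functor_obj[OF F] functor_ident[OF F] functor_arr[OF F] functor_comp[OF F] Field_segment[OF seg] seg(1) in auto)
    have "p \<delta> \<in> rlp C K"
      unfolding rlp_def
    proof (intro CollectI conjI ballI)
      show "p \<delta> \<in> Arr C" using p[OF \<delta>(1)] by (rule hom_arr)
      fix k assume k: "k \<in> K"
      then have k': "k \<in> hom C (Dom C k) (Cod C k)" using K(2) arr_hom by blast
      show "lifts C k (p \<delta>)"
        unfolding lifts_hom[OF k' p[OF \<delta>(1)]]
      proof (intro ballI impI)
        fix u v assume u: "u \<in> hom C (Dom C k) (Z \<delta>)" and v: "v \<in> hom C (Cod C k) ?y" and eq: "p \<delta> \<odot> u = v \<odot> k"
        \<comment> \<open>The domain of \<open>k\<close> is compact for chains as wide as this one,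
          so the top map \<open>u\<close> comes from a stage \<open>b\<close> below
          \<open>\<delta>\<close>. The problem was therefore posed at \<open>b\<close>.\<close>
        have "\<exists>b\<in>Field ?r. \<exists>g\<in>hom C (Dom C k) (Z b). FA (b, \<delta>) \<odot> g = u"
          using Q(3)[OF k, unfolded chain_compact_def, rule_format, OF Well_order_Restr[OF wo_\<kappa>] _ \<delta>(4) Fr L u]
            small_underS[OF \<delta>(1)] Field_segment[OF seg] by simp
        then obtain b g where b: "b \<in> underS \<kappa> \<delta>" and g: "g \<in> hom C (Dom C k) (Z b)" "FA (b, \<delta>) \<odot> g = u"
          using Field_segment[OF seg] by auto
        have bF: "b \<in> Field \<kappa>" and b\<delta>: "(b, \<delta>) \<in> \<kappa>" using b seg(1) by (auto simp: underS_def)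
        have sq: "(k, g, v) \<in> ?sq (Z b) (p b)"
          using k g v eq comp_assoc[OF p[OF \<delta>(1)] chain_hom[OF F b\<delta>] g(1)] pFA[OF b\<delta>] by (simp add: squares_def)
        define c where "c = st b (k, g, v)"
        have c: "(b, c) \<in> \<kappa>" "e c = (b, enc (Z b) (p b) (k, g, v))"
          using st[OF bF sq] by (simp_all add: c_def)
        have cF: "c \<in> Field \<kappa>" using \<kappa>_facts(6)[OF c(1)] .
        have nc: "(c, nxt c) \<in> \<kappa>" using nxt[OF cF] by (auto simp: immediate_succ_def underS_def)
        \<comment> \<open>The solving step ends below \<open>G b\<close>, which lies below
          \<open>\<delta>\<close> by closure.\<close>
        have "nxt c \<in> underS \<kappa> \<delta>"
          using G(3)[OF bF sq] \<delta>(3)[OF b] seg(2) by (auto simp: c_def underS_def)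
        then have n\<delta>: "(nxt c, \<delta>) \<in> \<kappa>" by (simp add: underS_def)
        have bn: "(b, nxt c) \<in> \<kappa>" using \<kappa>_facts(2)[OF c(1) nc] .
        obtain w where w: "w \<in> hom C (Cod C k) (Z (nxt c))" "w \<odot> k = FA (b, nxt c) \<odot> g" "p (nxt c) \<odot> w = v"
          using solve[OF conjunct2[OF nxt[OF cF]] c(1) sq c(2)] by blast
        note Fn = chain_hom[OF F n\<delta>]
        have "(FA (nxt c, \<delta>) \<odot> w) \<odot> k = FA (nxt c, \<delta>) \<odot> FA (b, nxt c) \<odot> g"
          using comp_assoc[OF Fn w(1) k'] w(2) by simp
        also have "\<dots> = u"
          using comp_assoc[OF Fn chain_hom[OF F bn] g(1)] chain_comp[OF F bn n\<delta>] g(2) by simp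
        finally have "(FA (nxt c, \<delta>) \<odot> w) \<odot> k = u" .
        moreover have "p \<delta> \<odot> FA (nxt c, \<delta>) \<odot> w = v"
          using comp_assoc[OF p[OF \<delta>(1)] Fn w(1)] pFA[OF n\<delta>] w(3) by simp
        ultimately show "\<exists>h\<in>hom C (Cod C k) (Z \<delta>). h \<odot> k = u \<and> p \<delta> \<odot> h = v"
          using comp_hom[OF Fn w(1)] by blast
      qed
    qed
    then show ?thesis using finish[OF \<delta>(1) tc] by blast
  qed
qed

section \<open>The weak factorization system generated by a small set\<close>

lemma transfinite_subset_cell: "t \<in> transfinite_compositions \<kappa> C (pushouts_of C K) \<Longrightarrow> t \<in> Arr C \<Longrightarrow> t \<in> cell \<kappa> C K"
  using is_retract_refl by (auto simp: cell_def)

text \<open>That \<open>h\<close> is itself a transfinite composition is recorded besides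
  \<open>h \<in> cell \<kappa> C K\<close>: a retract of \<open>h\<close> is then cellular by
  definition, without composing retracts.\<close>

lemma cell_factorization:
  assumes K: "small \<kappa> K" "K \<subseteq> Arr C" and f: "f \<in> Arr C"
  obtains h g where "h \<in> transfinite_compositions \<kappa> C (pushouts_of C K)" "h \<in> cell \<kappa> C K" "g \<in> rlp C K"
    "h \<in> hom C (Dom C f) (Cod C h)" "g \<in> hom C (Cod C h) (Cod C f)" "f = g \<odot> h"
proof -
  obtain h g where h: "h \<in> transfinite_compositions \<kappa> C (pushouts_of C K)" and g: "g \<in> rlp C K"
    and gh: "Dom C g = Cod C h" "f = g \<odot> h"
    using small_object_argument[OF K f] by blast
  have g': "g \<in> Arr C" using g by (simp add: rlp_def)
  moreover have "lifts C k g" if "k \<in> pushouts_of C K" for k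
    using that g lifts_pushout[OF _ _ g'] by (auto simp: pushouts_of_def rlp_def)
  then have "h \<in> Arr C" using lifts_transfinite_composition[OF h _ g'] by blast
  ultimately show ?thesis
    using that[OF h transfinite_subset_cell[OF h] g] gh comp_arr[of h g] by (simp add: in_hom_iff)
qed

lemma cell_eq_llp_rlp:
  assumes K: "small \<kappa> K" "K \<subseteq> Arr C"
  shows "cell \<kappa> C K = llp C (rlp C K)"
proof
  show "cell \<kappa> C K \<subseteq> llp C (rlp C K)" by (rule cell_subset_llp_rlp)
  show "llp C (rlp C K) \<subseteq> cell \<kappa> C K"
  proof
    fix f assume f: "f \<in> llp C (rlp C K)"
    then have "f \<in> Arr C" by (simp add: llp_def)
    then obtain h g where h: "h \<in> transfinite_compositions \<kappa> C (pushouts_of C K)" and g: "g \<in> rlp C K"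
      and hg: "h \<in> hom C (Dom C f) (Cod C h)" "g \<in> hom C (Cod C h) (Cod C f)" "f = g \<odot> h"
      using cell_factorization[OF K] by metis
    have "is_retract C f h"
      by (rule retract_argument[OF hg]) (use f g in \<open>simp add: llp_def\<close>)
    with h show "f \<in> cell \<kappa> C K" by (auto simp: cell_def)
  qed
qed

lemma cell_weak_factorization_system:
  assumes K: "small \<kappa> K" "K \<subseteq> Arr C"
  shows "weak_factorization_system C (cell \<kappa> C K) (rlp C K)"
  unfolding weak_factorization_system_def
proof (intro conjI ballI)
  fix f assume "f \<in> Arr C"
  then obtain h g where "h \<in> cell \<kappa> C K" "g \<in> rlp C K"
    "h \<in> hom C (Dom C f) (Cod C h)" "g \<in> hom C (Cod C h) (Cod C f)" "f = g \<odot> h"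
    using cell_factorization[OF K] by metis
  then show "\<exists>h\<in>cell \<kappa> C K. \<exists>g\<in>rlp C K. Dom C g = Cod C h \<and> f = g \<odot> h"
    using hom_dom by metis
qed (simp_all add: cell_eq_llp_rlp[OF K] rlp_llp_rlp[OF K(2)])

end

section \<open>Morphisms counted by objects\<close>

context cat
begin

text \<open>Maps out of \<open>\<phi>\<close> are unique, so a square from \<open>i\<close> to
  \<open>g\<close> is just a map \<open>v\<close> from \<open>x\<close> to \<open>b\<close>, and a
  lift is a preimage of \<open>v\<close>.\<close>

lemma lifts_initial_iff:
  assumes "is_initial C \<phi>" and i: "i \<in> hom C \<phi> x" and g: "g \<in> hom C a b"
  shows "lifts C i g \<longleftrightarrow> (\<lambda>h. g \<odot> h) ` hom C x a = hom C x b"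
proof -
  have init: "\<exists>!u. u \<in> hom C \<phi> y" if "y \<in> Obj C" for y
    using assms(1) that by (simp add: is_initial_def)
  show ?thesis
  proof
    assume l: "lifts C i g"
    show "(\<lambda>h. g \<odot> h) ` hom C x a = hom C x b"
    proof
      show "(\<lambda>h. g \<odot> h) ` hom C x a \<subseteq> hom C x b" using g by auto
      show "hom C x b \<subseteq> (\<lambda>h. g \<odot> h) ` hom C x a"
      proof
        fix v assume v: "v \<in> hom C x b"
        obtain u where u: "u \<in> hom C \<phi> a" using init[OF hom_obj(1)[OF g]] by blast
        have "g \<odot> u = v \<odot> i"
          using init[OF hom_obj(2)[OF g]] comp_hom[OF g u] comp_hom[OF v i] by blast
        then obtain h where "h \<in> hom C x a" "g \<odot> h = v" using liftsE[OF l i g u v] by metis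
        then show "v \<in> (\<lambda>h. g \<odot> h) ` hom C x a" by blast
      qed
    qed
  next
    assume surj: "(\<lambda>h. g \<odot> h) ` hom C x a = hom C x b"
    show "lifts C i g"
      unfolding lifts_hom[OF i g]
    proof (intro ballI impI)
      fix u v assume u: "u \<in> hom C \<phi> a" and v: "v \<in> hom C x b"
      obtain h where h: "h \<in> hom C x a" "g \<odot> h = v" using v unfolding surj[symmetric] by blast
      moreover have "h \<odot> i = u" using init[OF hom_obj(1)[OF g]] comp_hom[OF h(1) i] u by blast
      ultimately show "\<exists>h\<in>hom C x a. h \<odot> i = u \<and> g \<odot> h = v" by blast
    qed
  qed
qed

text \<open>A map from \<open>s\<close> to \<open>a\<close> is a pair of maps \<open>h\<close>,
  \<open>k\<close> from \<open>x\<close>. It is the top of a square exactly when \<open>g\<close>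
  identifies \<open>h\<close> and \<open>k\<close>, and the square has a lift exactly when
  \<open>h\<close> and \<open>k\<close> are equal.\<close>

lemma lifts_fold_iff:
  assumes "is_coproduct C x x s in1 in2" and j: "j \<in> hom C s x" "j \<odot> in1 = Ident C x" "j \<odot> in2 = Ident C x"
    and g: "g \<in> hom C a b"
  shows "lifts C j g \<longleftrightarrow> inj_on (\<lambda>h. g \<odot> h) (hom C x a)"
proof -
  have in12: "in1 \<in> hom C x s" "in2 \<in> hom C x s"
    using assms(1) by (simp_all add: is_coproduct_def)
  have copair: "\<exists>!h. h \<in> hom C s y \<and> h \<odot> in1 = p \<and> h \<odot> in2 = q" if "p \<in> hom C x y" "q \<in> hom C x y" for p q y
    using assms(1) that by (simp add: is_coproduct_def)
  have ext: "h = k" if "h \<in> hom C s y" "k \<in> hom C s y" "h \<odot> in1 = k \<odot> in1" "h \<odot> in2 = k \<odot> in2" for h k y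
    using copair[OF comp_hom[OF that(1) in12(1)] comp_hom[OF that(1) in12(2)]] that by metis
  have fold: "(h \<odot> j) \<odot> in1 = h" "(h \<odot> j) \<odot> in2 = h" if "h \<in> hom C x y" for h y
    using comp_assoc[OF that j(1) in12(1)] comp_assoc[OF that j(1) in12(2)] comp_ident[OF that] j(2,3) by simp_all
  show ?thesis
  proof
    assume l: "lifts C j g"
    show "inj_on (\<lambda>h. g \<odot> h) (hom C x a)"
    proof (rule inj_onI)
      fix h k assume h: "h \<in> hom C x a" and k: "k \<in> hom C x a" and eq: "g \<odot> h = g \<odot> k"
      obtain u where u: "u \<in> hom C s a" "u \<odot> in1 = h" "u \<odot> in2 = k" using copair[OF h k] by blast
      have gh: "g \<odot> h \<in> hom C x b" and gk: "g \<odot> k \<in> hom C x b" using g h k by auto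
      have "g \<odot> u = (g \<odot> h) \<odot> j"
        by (rule ext[OF comp_hom[OF g u(1)] comp_hom[OF gh j(1)]])
          (simp_all add: fold[OF gk] comp_assoc[OF g u(1) in12(1)] comp_assoc[OF g u(1) in12(2)] u eq)
      then obtain m where m: "m \<in> hom C x a" "m \<odot> j = u" using liftsE[OF l j(1) g u(1) gh] by metis
      show "h = k" using fold[OF m(1)] m(2) u(2,3) by simp
    qed
  next
    assume inj: "inj_on (\<lambda>h. g \<odot> h) (hom C x a)"
    show "lifts C j g"
      unfolding lifts_hom[OF j(1) g]
    proof (intro ballI impI)
      fix u v assume u: "u \<in> hom C s a" and v: "v \<in> hom C x b" and eq: "g \<odot> u = v \<odot> j"
      define h where "h = u \<odot> in1"
      have h: "h \<in> hom C x a" "u \<odot> in2 \<in> hom C x a" using u in12 by (auto simp: h_def)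
      have gh: "g \<odot> h = v" "g \<odot> u \<odot> in2 = v"
        using comp_assoc[OF g u in12(1)] comp_assoc[OF g u in12(2)] eq fold[OF v] by (simp_all add: h_def)
      then have "u \<odot> in2 = h" using inj_onD[OF inj, of "u \<odot> in2" h] h by simp
      then have "h \<odot> j = u"
        by (intro ext[OF comp_hom[OF h(1) j(1)] u]) (simp_all add: fold[OF h(1)] h_def[symmetric])
      with h gh show "\<exists>h\<in>hom C x a. h \<odot> j = u \<and> g \<odot> h = v" by blast
    qed
  qed
qed

text \<open>Postcomposition with \<open>g \<odot> f\<close> is the composite of the two
  postcomposition maps, so two-out-of-three for bijections applies at each
  \<open>X l\<close>.\<close>

lemma two_out_of_three_counting:
  "two_out_of_three C {g \<in> Arr C. \<forall>l \<in> L. bij_betw (\<lambda>h. g \<odot> h) (hom C (X l) (Dom C g)) (hom C (X l) (Cod C g))}"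
  (is "two_out_of_three C ?W")
  unfolding two_out_of_three_def
proof (intro ballI impI)
  fix f g assume f: "f \<in> Arr C" and g: "g \<in> Arr C" and fg: "Dom C g = Cod C f"
  note fg' = comp_arr[OF f g fg]
  have comp: "bij_betw (\<lambda>h. (g \<odot> f) \<odot> h) (hom C (X l) (Dom C f)) B
      \<longleftrightarrow> bij_betw ((\<lambda>h. g \<odot> h) \<circ> (\<lambda>h. f \<odot> h)) (hom C (X l) (Dom C f)) B" for l B
    by (rule bij_betw_cong) (use comp_assoc[OF arr_hom[OF g], of f _ ] arr_hom[OF f] fg in simp)
  have sub: "(\<lambda>h. f \<odot> h) ` hom C (X l) (Dom C f) \<subseteq> hom C (X l) (Cod C f)" for l
    using arr_hom[OF f] by auto
  have W_iff: "k \<in> ?W \<longleftrightarrow> (\<forall>l \<in> L. bij_betw (\<lambda>h. k \<odot> h) (hom C (X l) (Dom C k)) (hom C (X l) (Cod C k)))"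
    if "k \<in> Arr C" for k using that by simp
  show "(f \<in> ?W \<and> g \<in> ?W \<longrightarrow> g \<odot> f \<in> ?W) \<and> (f \<in> ?W \<and> g \<odot> f \<in> ?W \<longrightarrow> g \<in> ?W) \<and>
    (g \<in> ?W \<and> g \<odot> f \<in> ?W \<longrightarrow> f \<in> ?W)"
    unfolding W_iff[OF f] W_iff[OF g] W_iff[OF fg'(1)] fg'(2,3) comp fg
    using bij_betw_comp_iff bij_betw_comp_iff2[OF _ sub] by blast
qed

end

theorem proposition3p1:
  fixes \<kappa> :: "'k rel"
    and C :: "('o, 'm) cat"
    and L :: "'l set" and X :: "'l \<Rightarrow> 'o"
    and \<phi> :: 'o and S :: "'l \<Rightarrow> 'o" and in1 in2 i j :: "'l \<Rightarrow> 'm"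
    and P :: "'p set" and f :: "'p \<Rightarrow> 'm"
    and I J W F Cof :: "'m set"
  assumes "inaccessible \<kappa>"
    and "locally_presentable \<kappa> C"
    and "small \<kappa> L" and "\<And>l. l \<in> L \<Longrightarrow> X l \<in> Obj C"
    and "is_initial C \<phi>"
    and "\<And>l. l \<in> L \<Longrightarrow> i l \<in> hom C \<phi> (X l)"
    and "\<And>l. l \<in> L \<Longrightarrow> is_coproduct C (X l) (X l) (S l) (in1 l) (in2 l)"
    and "\<And>l. l \<in> L \<Longrightarrow> j l \<in> hom C (S l) (X l) \<and>
           j l \<odot>\<^bsub>C\<^esub> in1 l = Ident C (X l) \<and> j l \<odot>\<^bsub>C\<^esub> in2 l = Ident C (X l)"
    and "I = i ` L \<union> j ` L"
    and "W = inj_class C I"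
    and "small \<kappa> P" and "\<And>p. p \<in> P \<Longrightarrow> f p \<in> Arr C"
    and "J = f ` P"
    and "cell \<kappa> C J \<subseteq> W"
    and "F = inj_class C J"
    and "Cof = cell \<kappa> C (I \<union> J)"
  shows "W = {g \<in> Arr C. \<forall>l \<in> L.
               bij_betw (\<lambda>h. g \<odot>\<^bsub>C\<^esub> h) (hom C (X l) (Dom C g)) (hom C (X l) (Cod C g))} \<and>
         closed_model_structure \<kappa> C W F Cof \<and>
         cofibrantly_generated \<kappa> C W F"
proof -
  have C: "category C" "locally_small \<kappa> C" "cocomplete \<kappa> C"
    using assms(2) by (auto simp: locally_presentable_def)
  interpret presentable_category \<kappa> C
    by unfold_locales (fact assms(1) C assms(2))+
  have I_arr: "I \<subseteq> Arr C" using assms(6,8,9) by (auto simp: in_hom_iff)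
  have J_arr: "J \<subseteq> Arr C" using assms(12,13) by auto
  have I_small: "small \<kappa> I" unfolding assms(9) by (intro small_Un small_image assms(3))
  have J_small: "small \<kappa> J" unfolding assms(13) by (intro small_image assms(11))
  have IJ: "small \<kappa> (I \<union> J)" "I \<union> J \<subseteq> Arr C"
    using small_Un[OF I_small J_small] I_arr J_arr by auto
  have W: "W = {g \<in> Arr C. \<forall>l \<in> L.
      bij_betw (\<lambda>h. g \<odot>\<^bsub>C\<^esub> h) (hom C (X l) (Dom C g)) (hom C (X l) (Cod C g))}"
  proof -
    have lifts_iff: "lifts C (i l) g \<and> lifts C (j l) g \<longleftrightarrow>
      bij_betw (\<lambda>h. g \<odot>\<^bsub>C\<^esub> h) (hom C (X l) (Dom C g)) (hom C (X l) (Cod C g))" if "g \<in> Arr C" "l \<in> L" for g l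
      using lifts_initial_iff[OF assms(5) assms(6)[OF that(2)] arr_hom[OF that(1)]]
        lifts_fold_iff[OF assms(7)[OF that(2)] _ _ _ arr_hom[OF that(1)], of "j l"] assms(8)[OF that(2)]
      by (auto simp: bij_betw_def)
    have "(\<forall>k\<in>I. lifts C k g) \<longleftrightarrow> (\<forall>l\<in>L. lifts C (i l) g \<and> lifts C (j l) g)" for g
      unfolding assms(9) by blast
    then show ?thesis
      unfolding assms(10) rlp_def by (intro Collect_cong conj_cong refl) (simp add: lifts_iff)
  qed
  have W_arr: "W \<subseteq> Arr C" by (auto simp: W)
  have two: "two_out_of_three C W" unfolding W by (rule two_out_of_three_counting)
  have FW: "inj_class C (I \<union> J) = F \<inter> W" unfolding assms(10,15) rlp_def by auto
  have cell_J: "cell \<kappa> C J = llp C F" unfolding assms(15) by (rule cell_eq_llp_rlp[OF J_small J_arr])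
  have Cof: "Cof = llp C (F \<inter> W)" unfolding assms(16) FW[symmetric] by (rule cell_eq_llp_rlp[OF IJ])
  have "Cof \<inter> W = cell \<kappa> C J"
  proof
    \<comment> \<open>Lifting against all of \<open>F\<close> includes lifting against
      \<open>F \<inter> W\<close>; membership in \<open>W\<close> is the hypothesis on
      \<open>cell \<kappa> C J\<close>.\<close>
    show "cell \<kappa> C J \<subseteq> Cof \<inter> W"
      using llp_mono[of "F \<inter> W" F] assms(14) unfolding cell_J Cof by auto
    show "Cof \<inter> W \<subseteq> cell \<kappa> C J"
    proof
      fix c assume c: "c \<in> Cof \<inter> W"
      then have c_arr: "c \<in> Arr C" using W_arr by auto
      obtain h g where h: "h \<in> transfinite_compositions \<kappa> C (pushouts_of C J)" "h \<in> cell \<kappa> C J"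
        and g: "g \<in> F" and hg: "h \<in> hom C (Dom C c) (Cod C h)" "g \<in> hom C (Cod C h) (Cod C c)" "c = g \<odot>\<^bsub>C\<^esub> h"
        using cell_factorization[OF J_small J_arr c_arr] unfolding assms(15) by metis
      \<comment> \<open>The same hypothesis places the first factor in \<open>W\<close>. Then
        \<open>g\<close> lies in \<open>F \<inter> W\<close>, against which every cofibration
        lifts.\<close>
      have "h \<in> W" using h(2) assms(14) by blast
      then have "g \<in> W"
        using two c hg hom_arr[OF hg(1)] hom_arr[OF hg(2)] hom_dom[OF hg(2)] unfolding two_out_of_three_def by blast
      then have "lifts C c g" using c g by (auto simp: Cof llp_def)
      then have "is_retract C c h" by (rule retract_argument[OF hg])
      then show "c \<in> cell \<kappa> C J" using h(1) by (auto simp: cell_def)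
    qed
  qed
  moreover have "weak_factorization_system C Cof (F \<inter> W)"
    using cell_weak_factorization_system[OF IJ] by (simp add: assms(16) FW)
  moreover have "weak_factorization_system C (cell \<kappa> C J) F"
    using cell_weak_factorization_system[OF J_small J_arr] by (simp add: assms(15))
  moreover have "F \<subseteq> Arr C" "Cof \<subseteq> Arr C" by (auto simp: assms(15) rlp_def Cof llp_def)
  ultimately have "closed_model_structure \<kappa> C W F Cof"
    using category complete cocomplete W_arr two by (simp add: closed_model_structure_def)
  \<comment> \<open>The generating sets are \<open>I \<union> J\<close> for
    \<open>F \<inter> W\<close> and \<open>J\<close> for \<open>F\<close>.\<close>
  moreover have "cofibrantly_generated \<kappa> C W F"
    unfolding cofibrantly_generated_def using IJ J_small J_arr FW assms(15) by blast
  ultimately show ?thesis using W by blast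
qed

end
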